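(* Let $R$ be a root system of type $\mathsf{B}_2$, let $k_1,k_2\in\mathbb{C}$ be the values of the multiplicity function $k$ on the short, respectively long, roots, and put $\hbar=2(k_1+k_2)+1$. 1. One has $\dim L(\mathrm{triv},k)<\infty$ if and only if one of the following two conditions holds: (a) $\hbar=-n$ for some even $n\in\mathbb{N}$; (b) for some odd $n\in\mathbb{N}$, $\hbar=-n$ and $k_1=-\frac{2j-1}{2}$ with $j\in\{1,\dots,\frac{n+1}{2}\}$. 2. The module $L(\mathrm{std},k)$ is infinite-dimensional. 3. If $\tau\in\{\mathrm{sgn},\chi_1,\chi_2\}$, then $\dim L(\tau,k)<\infty$ if and only if $\dim L(\mathrm{triv},k^\tau)<\infty$.
   Context: $\mathbb{N}$ contains $0$. Let $\mathfrak{a}_{\mathbb{R}}$ be a real vector space of dimension $\ell$, $R\subset\mathfrak{a}_{\mathbb{R}}^*$ a reduced root system (here of type $\mathsf{B}_2$, $\ell=2$), $W$ its Weyl group, $\mathfrak{a}=\mathbb{C}\otimes_{\mathbb{R}}\mathfrak{a}_{\mathbb{R}}$. For $\alpha\in R$ let $r_\alpha$ be the reflection. Let $k:R\to\mathbb{C}$ be $W$-invariant. Let $\mathcal{P}=S(\mathfrak{a}^* )$ with its natural $W$-action. For $y\in\mathfrak{a}$, the Dunkl operator is $T_y=T_y(k)=\partial_y+\sum_{\alpha\in R^+}k_\alpha\frac{\langle\alpha,y\rangle}{\alpha}(1-r_\alpha)\in\mathrm{End}_{\mathbb{C}}(\mathcal{P})$, where $R^+$ is a system of positive roots. The rational Cherednik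 algebra $\mathcal{H}(k)$ is the subalgebra of $\mathrm{End}_{\mathbb{C}}(\mathcal{P})$ generated by all $w\in W$, all multiplications by $x\in\mathfrak{a}^*$ and all $T_y$, $y\in\mathfrak{a}$. The map $y\mapsto T_y$ extends to an algebra isomorphism $T$ from $S(\mathfrak{a})$ onto $\mathcal{S}=\mathbb{C}[T_y:y\in\mathfrak{a}]$; put $\mathcal{S}_+=\bigoplus_{n\ge1}T(S^n(\mathfrak{a}))$. Multiplication gives $\mathcal{H}(k)=\mathcal{P}\otimes\mathbb{C}W\otimes\mathcal{S}$ as vector spaces; $\mathcal{S}\otimes\mathbb{C}W$ denotes the subalgebra generated by $\mathcal{S}$ and $W$. For an irreducible character $\chi$ of $W$ let $V_\chi$ be an irreducible $W$-module of character $\chi$, made into an $\mathcal{S}\otimes\mathbb{C}W$-module by $\mathcal{S}_+V_\chi=0$. The Verma module $M(\chi,k)=\mathcal{H}(k)\otimes_{\mathcal{S}\otimes\mathbb{C}W}V_\chi$ has a unique simple quotient, denoted $L(\chi,k)$, an $\mathcal{H}(k)$-module. Write $\mathcal{P}=\mathbb{C}[x_1,x_2]$ with $R^+=\{x_1,x_2,x_1\pm x_2\}$ ($x_1,x_2$ short). $W$ is generated by $r=r_{x_1-x_2}$ and $s_i=r_{x_i}$, $i=1,2$. The irreducible characters of $W$ are $\mathrm{triv}$ (trivial), $\mathrm{sgn}=\det$, $\mathrm{std}$ (the two-dimensional representation $W\hookrightarrow\mathrm{GL}(\mathfrak{a})$), $\chi_1$ of dimension 1 with $\chi_1(r)=1$,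 $\chi_1(s_1)=\chi_1(s_2)=-1$, and $\chi_2=\chi_1\otimes\mathrm{sgn}$. For a one-dimensional character $\tau:W\to\{\pm1\}$, $k^\tau$ is the multiplicity function $k^\tau(\alpha)=\tau(r_\alpha)k_\alpha$. *)

theory Defs
  imports
    "HOL-Algebra.AbelCoset"
    "HOL-Algebra.Module"
    "HOL-Algebra.Free_Abelian_Groups"
    "HOL-Analysis.Determinants"
    "HOL-Computational_Algebra.Polynomial"
begin

section \<open>Modules over a not necessarily commutative ring\<close>

text \<open>
  Left modules are represented by the record type \<open>module\<close> of HOL-Algebra, whose ring fields
  \<open>mult\<close> and \<open>one\<close> carry no meaning for a module. The locale \<open>module\<close> itself is only for
  commutative rings; the locale \<open>submodule\<close> is not, and it is used below.
\<close>

definition quot_module :: "('r, 'm) module \<Rightarrow> 'm set \<Rightarrow> ('r, 'm set) module" where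
  "quot_module M N =
     \<lparr>carrier = a_rcosets\<^bsub>M\<^esub> N, monoid.mult = undefined, monoid.one = undefined,
      ring.zero = N, ring.add = (\<lambda>X Y. X <+>\<^bsub>M\<^esub> Y),
      module.smult = (\<lambda>r X. \<Union>x\<in>X. N +>\<^bsub>M\<^esub> (r \<odot>\<^bsub>M\<^esub> x))\<rparr>"

definition simple_module :: "'r ring \<Rightarrow> ('r, 'm) module \<Rightarrow> bool" where
  "simple_module R M \<longleftrightarrow>
     carrier M \<noteq> {\<zero>\<^bsub>M\<^esub>} \<and>
     (\<forall>N. submodule N R M \<longrightarrow> N = {\<zero>\<^bsub>M\<^esub>} \<or> N = carrier M)"

text \<open>
  For a subring of \<open>R\<close> with underlying set \<open>B\<close> and a left \<open>B\<close>-module \<open>V\<close>, the tensor product of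
  \<open>R\<close> and \<open>V\<close> over \<open>B\<close> is the free abelian group on pairs modulo the biadditivity and
  \<open>B\<close>-balancing relations, with \<open>R\<close> acting on the left factor.
\<close>

definition tensor_free :: "'r ring \<Rightarrow> ('r, 'v) module \<Rightarrow> ('r, ('r \<times> 'v) \<Rightarrow>\<^sub>0 int) module" where
  "tensor_free R V =
     \<lparr>carrier = carrier (free_Abelian_group (carrier R \<times> carrier V)),
      monoid.mult = undefined, monoid.one = undefined, ring.zero = 0, ring.add = (+),
      module.smult = (\<lambda>r. frag_extend (\<lambda>(a, v). frag_of (r \<otimes>\<^bsub>R\<^esub> a, v)))\<rparr>"

definition tensor_relators :: "'r ring \<Rightarrow> 'r set \<Rightarrow> ('r, 'v) module \<Rightarrow> (('r \<times> 'v) \<Rightarrow>\<^sub>0 int) set" where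
  "tensor_relators R B V =
     {frag_of (a \<oplus>\<^bsub>R\<^esub> a', v) - frag_of (a, v) - frag_of (a', v) | a a' v.
        a \<in> carrier R \<and> a' \<in> carrier R \<and> v \<in> carrier V} \<union>
     {frag_of (a, v \<oplus>\<^bsub>V\<^esub> v') - frag_of (a, v) - frag_of (a, v') | a v v'.
        a \<in> carrier R \<and> v \<in> carrier V \<and> v' \<in> carrier V} \<union>
     {frag_of (a \<otimes>\<^bsub>R\<^esub> b, v) - frag_of (a, b \<odot>\<^bsub>V\<^esub> v) | a b v.
        a \<in> carrier R \<and> b \<in> B \<and> v \<in> carrier V}"

definition induced_module ::
    "'r ring \<Rightarrow> 'r set \<Rightarrow> ('r, 'v) module \<Rightarrow> ('r, (('r \<times> 'v) \<Rightarrow>\<^sub>0 int) set) module" where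
  "induced_module R B V =
     quot_module (tensor_free R V)
       (generate (free_Abelian_group (carrier R \<times> carrier V)) (tensor_relators R B V))"


section \<open>The root system and its Weyl group\<close>

text \<open>
  Both the complexified space and its dual are identified with \<open>complex^2\<close>: a vector \<open>\<alpha>\<close> in the
  dual stands for the linear form with coordinates \<open>\<alpha>\<close> in the basis \<open>x\<^sub>1, x\<^sub>2\<close>, and vectors of the
  space are written in the dual basis.
\<close>

definition pairing :: "complex^2 \<Rightarrow> complex^2 \<Rightarrow> complex" where
  "pairing \<alpha> y = (\<Sum>i\<in>UNIV. \<alpha> $ i * y $ i)"

abbreviation e1 :: "complex^2" where "e1 \<equiv> axis 1 1"
abbreviation e2 :: "complex^2" where "e2 \<equiv> axis 2 1"

definition pos_roots :: "(complex^2) set" where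
  "pos_roots = {e1, e2, e1 + e2, e1 - e2}"

definition roots :: "(complex^2) set" where
  "roots = pos_roots \<union> uminus ` pos_roots"

definition short_roots :: "(complex^2) set" where
  "short_roots = {e1, e2, - e1, - e2}"

definition long_roots :: "(complex^2) set" where
  "long_roots = {e1 + e2, e1 - e2, - (e1 + e2), - (e1 - e2)}"

text \<open>
  The matrix of \<open>y \<mapsto> y - \<langle>\<alpha>, y\<rangle> \<alpha>\<^sup>\<or>\<close>, where the coroot of \<open>\<alpha>\<close> has coordinates \<open>2 \<alpha> / \<langle>\<alpha>, \<alpha>\<rangle>\<close>.
\<close>

definition reflection :: "complex^2 \<Rightarrow> complex^2^2" where
  "reflection \<alpha> = (\<chi> i j. (if i = j then 1 else 0) - \<alpha> $ j * (2 * \<alpha> $ i / pairing \<alpha> \<alpha>))"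

inductive_set W :: "(complex^2^2) set" where
  W_one: "mat 1 \<in> W"
| W_refl: "w \<in> W \<Longrightarrow> \<alpha> \<in> roots \<Longrightarrow> reflection \<alpha> ** w \<in> W"

text \<open>The contragredient action \<open>(w \<alpha>)(y) = \<alpha> (w\<^sup>-\<^sup>1 y)\<close> on linear forms.\<close>

definition dual_act :: "complex^2^2 \<Rightarrow> complex^2 \<Rightarrow> complex^2" where
  "dual_act w \<alpha> = \<alpha> v* matrix_inv w"

definition W_invariant :: "(complex^2 \<Rightarrow> complex) \<Rightarrow> bool" where
  "W_invariant k \<longleftrightarrow> (\<forall>w\<in>W. \<forall>\<alpha>\<in>roots. k (dual_act w \<alpha>) = k \<alpha>)"


section \<open>Polynomials and Dunkl operators\<close>

text \<open>
  The ring of polynomials in \<open>x\<^sub>1, x\<^sub>2\<close> is \<open>complex poly poly\<close>: polynomials in \<open>x\<^sub>2\<close> whose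
  coefficients are polynomials in \<open>x\<^sub>1\<close>.
\<close>

type_synonym pol = "complex poly poly"

definition X1 :: pol where "X1 = [:[:0, 1:]:]"
definition X2 :: pol where "X2 = [:0, 1:]"

definition lin :: "complex^2 \<Rightarrow> pol" where
  "lin \<alpha> = smult [:\<alpha> $ 1:] X1 + smult [:\<alpha> $ 2:] X2"

definition subst_pol :: "pol \<Rightarrow> pol \<Rightarrow> pol \<Rightarrow> pol" where
  "subst_pol a b p = poly (map_poly (\<lambda>q. poly (map_poly (\<lambda>c. [:[:c:]:]) q) a) p) b"

text \<open>\<open>w\<close> acts by the algebra automorphism extending the contragredient action.\<close>

definition wact :: "complex^2^2 \<Rightarrow> pol \<Rightarrow> pol" where
  "wact w = subst_pol (lin (dual_act w e1)) (lin (dual_act w e2))"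

definition scal :: "complex \<Rightarrow> pol \<Rightarrow> pol" where
  "scal c = smult [:c:]"

definition dderiv :: "complex^2 \<Rightarrow> pol \<Rightarrow> pol" where
  "dderiv y p = scal (y $ 1) (map_poly pderiv p) + scal (y $ 2) (pderiv p)"

text \<open>The division is exact, see \<open>lin_dvd_diff_wact\<close> below.\<close>

definition dunkl :: "(complex^2 \<Rightarrow> complex) \<Rightarrow> complex^2 \<Rightarrow> pol \<Rightarrow> pol" where
  "dunkl k y p = dderiv y p +
     (\<Sum>\<alpha>\<in>pos_roots. scal (k \<alpha> * pairing \<alpha> y) ((p - wact (reflection \<alpha>) p) div lin \<alpha>))"


section \<open>The rational Cherednik algebra\<close>

inductive_set lin_span :: "(pol \<Rightarrow> pol) set \<Rightarrow> (pol \<Rightarrow> pol) set" for A where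
  span_zero: "(\<lambda>p. 0) \<in> lin_span A"
| span_base: "f \<in> A \<Longrightarrow> f \<in> lin_span A"
| span_add: "f \<in> lin_span A \<Longrightarrow> g \<in> lin_span A \<Longrightarrow> (\<lambda>p. f p + g p) \<in> lin_span A"
| span_scale: "f \<in> lin_span A \<Longrightarrow> (\<lambda>p. scal c (f p)) \<in> lin_span A"

inductive_set subalg :: "(pol \<Rightarrow> pol) set \<Rightarrow> (pol \<Rightarrow> pol) set" for A where
  subalg_scal: "scal c \<in> subalg A"
| subalg_base: "f \<in> A \<Longrightarrow> f \<in> subalg A"
| subalg_add: "f \<in> subalg A \<Longrightarrow> g \<in> subalg A \<Longrightarrow> (\<lambda>p. f p + g p) \<in> subalg A"
| subalg_comp: "f \<in> subalg A \<Longrightarrow> g \<in> subalg A \<Longrightarrow> f \<circ> g \<in> subalg A"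

definition operator_ring :: "(pol \<Rightarrow> pol) set \<Rightarrow> (pol \<Rightarrow> pol) ring" where
  "operator_ring A =
     \<lparr>carrier = A, monoid.mult = (\<circ>), monoid.one = id,
      ring.zero = (\<lambda>p. 0), ring.add = (\<lambda>f g p. f p + g p)\<rparr>"

definition cherednik :: "(complex^2 \<Rightarrow> complex) \<Rightarrow> (pol \<Rightarrow> pol) ring" where
  "cherednik k =
     operator_ring (subalg (wact ` W \<union> range (\<lambda>\<alpha>. (*) (lin \<alpha>)) \<union> range (dunkl k)))"

definition dunkl_alg :: "(complex^2 \<Rightarrow> complex) \<Rightarrow> (pol \<Rightarrow> pol) set" where
  "dunkl_alg k = subalg (range (dunkl k))"

text \<open>The image under \<open>T\<close> of the homogeneous elements of degree \<open>n\<close>, and the sum over \<open>n \<ge> 1\<close>.\<close>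

definition dunkl_homog :: "(complex^2 \<Rightarrow> complex) \<Rightarrow> nat \<Rightarrow> (pol \<Rightarrow> pol) set" where
  "dunkl_homog k n = lin_span {foldr (\<circ>) (map (dunkl k) ys) id | ys. length ys = n}"

definition dunkl_plus :: "(complex^2 \<Rightarrow> complex) \<Rightarrow> (pol \<Rightarrow> pol) set" where
  "dunkl_plus k = lin_span (\<Union>n\<in>{1..}. dunkl_homog k n)"

definition dunkl_W_alg :: "(complex^2 \<Rightarrow> complex) \<Rightarrow> (pol \<Rightarrow> pol) set" where
  "dunkl_W_alg k = subalg (dunkl_alg k \<union> wact ` W)"


section \<open>Verma modules and their simple quotients\<close>

text \<open>
  For a matrix representation \<open>\<rho>\<close> of \<open>W\<close>, the representation of \<open>dunkl_W_alg k\<close> extending \<open>\<rho>\<close> in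
  which \<open>dunkl_plus k\<close> acts by zero. Values outside \<open>dunkl_W_alg k\<close> are fixed by \<open>extensional\<close>, so
  that the map is unique.
\<close>

definition trivial_ext ::
    "(complex^2 \<Rightarrow> complex) \<Rightarrow> (complex^2^2 \<Rightarrow> complex^'n^'n) \<Rightarrow> (pol \<Rightarrow> pol) \<Rightarrow> complex^'n^'n" where
  "trivial_ext k \<rho> = (THE \<phi>. \<phi> \<in> extensional (dunkl_W_alg k) \<and>
     (\<forall>c. \<phi> (scal c) = mat c) \<and>
     (\<forall>f\<in>dunkl_W_alg k. \<forall>g\<in>dunkl_W_alg k.
        \<phi> (\<lambda>p. f p + g p) = \<phi> f + \<phi> g \<and> \<phi> (f \<circ> g) = \<phi> f ** \<phi> g) \<and>
     (\<forall>w\<in>W. \<phi> (wact w) = \<rho> w) \<and>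
     (\<forall>f\<in>dunkl_plus k. \<phi> f = 0))"

definition lowest_module ::
    "(complex^2 \<Rightarrow> complex) \<Rightarrow> (complex^2^2 \<Rightarrow> complex^'n^'n) \<Rightarrow> (pol \<Rightarrow> pol, complex^'n) module" where
  "lowest_module k \<rho> =
     \<lparr>carrier = UNIV, monoid.mult = undefined, monoid.one = undefined,
      ring.zero = 0, ring.add = (+),
      module.smult = (\<lambda>b v. trivial_ext k \<rho> b *v v)\<rparr>"

definition verma ::
    "(complex^2^2 \<Rightarrow> complex^'n^'n) \<Rightarrow> (complex^2 \<Rightarrow> complex) \<Rightarrow>
     (pol \<Rightarrow> pol, (((pol \<Rightarrow> pol) \<times> (complex^'n)) \<Rightarrow>\<^sub>0 int) set) module" where
  "verma \<rho> k = induced_module (cherednik k) (dunkl_W_alg k) (lowest_module k \<rho>)"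

definition L ::
    "(complex^2^2 \<Rightarrow> complex^'n^'n) \<Rightarrow> (complex^2 \<Rightarrow> complex) \<Rightarrow>
     (pol \<Rightarrow> pol, (((pol \<Rightarrow> pol) \<times> (complex^'n)) \<Rightarrow>\<^sub>0 int) set set) module" where
  "L \<rho> k = quot_module (verma \<rho> k)
     (THE N. submodule N (cherednik k) (verma \<rho> k) \<and>
             simple_module (cherednik k) (quot_module (verma \<rho> k) N))"

text \<open>Modules over \<open>cherednik k\<close> are complex vector spaces through the scalar operators.\<close>

definition finite_dim :: "(pol \<Rightarrow> pol, 'm) module \<Rightarrow> bool" where
  "finite_dim M \<longleftrightarrow>
     (\<exists>S. finite S \<and> S \<subseteq> carrier M \<and>
        (\<forall>x\<in>carrier M. \<exists>c. x = (\<Oplus>\<^bsub>M\<^esub>s\<in>S. scal (c s) \<odot>\<^bsub>M\<^esub> s)))"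


section \<open>Irreducible representations of the Weyl group\<close>

definition triv :: "complex^2^2 \<Rightarrow> complex" where "triv w = 1"

definition sgn_char :: "complex^2^2 \<Rightarrow> complex" where "sgn_char w = det w"

text \<open>
  \<open>W\<close> consists of the signed permutation matrices, and \<open>chi1 w\<close> is the product of the signs;
  the lemmas \<open>chi1_mult\<close> and \<open>chi1_values\<close> below characterise it.
\<close>

definition chi1 :: "complex^2^2 \<Rightarrow> complex" where
  "chi1 w = (\<Prod>i\<in>UNIV. \<Sum>j\<in>UNIV. w $ i $ j)"

definition chi2 :: "complex^2^2 \<Rightarrow> complex" where "chi2 w = chi1 w * sgn_char w"

definition char_rep :: "(complex^2^2 \<Rightarrow> complex) \<Rightarrow> complex^2^2 \<Rightarrow> complex^1^1" where
  "char_rep \<tau> w = mat (\<tau> w)"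

definition std_rep :: "complex^2^2 \<Rightarrow> complex^2^2" where "std_rep w = w"

definition twist :: "(complex^2^2 \<Rightarrow> complex) \<Rightarrow> (complex^2 \<Rightarrow> complex) \<Rightarrow> complex^2 \<Rightarrow> complex" where
  "twist \<tau> k \<alpha> = \<tau> (reflection \<alpha>) * k \<alpha>"


section \<open>Checks on the definitions\<close>

lemma mat_eq_iff2: "A = (B :: complex^2^2) \<longleftrightarrow>
    A$1$1 = B$1$1 \<and> A$1$2 = B$1$2 \<and> A$2$1 = B$2$1 \<and> A$2$2 = B$2$2"
  by (auto simp: vec_eq_iff forall_2)

lemma refl_sq:
  assumes "\<alpha> \<in> roots"
  shows "reflection \<alpha> ** reflection \<alpha> = mat 1"
  using assms
  by (auto simp: roots_def pos_roots_def reflection_def pairing_def mat_eq_iff2 matrix_matrix_mult_def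
      mat_def axis_def sum_2)

lemma matrix_inv_refl:
  assumes "\<alpha> \<in> roots"
  shows "matrix_inv (reflection \<alpha>) = reflection \<alpha>"
proof -
  have "\<exists>A'. reflection \<alpha> ** A' = mat 1 \<and> A' ** reflection \<alpha> = mat 1"
    using refl_sq[OF assms] by blast
  then have "matrix_inv (reflection \<alpha>) ** reflection \<alpha> = mat 1"
    unfolding matrix_inv_def by (rule someI2_ex) blast
  then show ?thesis
    by (metis refl_sq[OF assms] matrix_mul_assoc matrix_mul_lid matrix_mul_rid)
qed

lemma W_signed_perm:
  "w \<in> W \<Longrightarrow>
     (w$1$2 = 0 \<and> w$2$1 = 0 \<and> w$1$1 \<in> {1,-1} \<and> w$2$2 \<in> {1,-1}) \<or>
     (w$1$1 = 0 \<and> w$2$2 = 0 \<and> w$1$2 \<in> {1,-1} \<and> w$2$1 \<in> {1,-1})"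
proof (induction rule: W.induct)
  case W_one
  then show ?case by (simp add: mat_def)
next
  case (W_refl w \<alpha>)
  have "\<alpha> = e1 \<or> \<alpha> = e2 \<or> \<alpha> = e1 + e2 \<or> \<alpha> = e1 - e2 \<or>
        \<alpha> = - e1 \<or> \<alpha> = - e2 \<or> \<alpha> = - (e1 + e2) \<or> \<alpha> = - (e1 - e2)"
    using W_refl.hyps by (auto simp: roots_def pos_roots_def)
  then show ?case
    using W_refl.IH
    by (elim disjE) (auto simp: reflection_def pairing_def matrix_matrix_mult_def axis_def sum_2)
qed

lemma chi1_mult:
  assumes "v \<in> W" "w \<in> W"
  shows "chi1 (v ** w) = chi1 v * chi1 w"
proof -
  have U: "prod f (UNIV :: 2 set) = f 1 * f 2" for f :: "2 \<Rightarrow> complex"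
    by (simp add: UNIV_2)
  show ?thesis
    using W_signed_perm[OF assms(1)] W_signed_perm[OF assms(2)]
    by (elim disjE) (simp_all add: chi1_def U sum_2 matrix_matrix_mult_def)
qed

lemma chi1_values:
  "chi1 (reflection (e1 - e2)) = 1" "chi1 (reflection e1) = -1" "chi1 (reflection e2) = -1"
proof -
  have U: "prod f (UNIV :: 2 set) = f 1 * f 2" for f :: "2 \<Rightarrow> complex"
    by (simp add: UNIV_2)
  show "chi1 (reflection (e1 - e2)) = 1" "chi1 (reflection e1) = -1" "chi1 (reflection e2) = -1"
    by (simp_all add: chi1_def U sum_2 reflection_def pairing_def axis_def)
qed

lemma poly_cong_dvd: "a - b dvd poly p a - poly p (b :: 'a :: comm_ring_1)"
proof (induction p)
  case (pCons c p)
  have "poly (pCons c p) a - poly (pCons c p) b =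
        (a - b) * poly p a + b * (poly p a - poly p b)"
    by (simp add: algebra_simps)
  then show ?case using pCons.IH by simp
qed simp

lemma subst_pol_pCons:
  "subst_pol a b (pCons q p) = poly (map_poly (\<lambda>c. [:[:c:]:]) q) a + b * subst_pol a b p"
  by (simp add: subst_pol_def map_poly_pCons)

lemma subst_pol_0: "subst_pol a b 0 = 0"
  by (simp add: subst_pol_def)

lemma subst_inner_id: "poly (map_poly (\<lambda>c. [:[:c:]:]) q) X1 = [:q:]"
  by (induction q) (simp_all add: map_poly_pCons X1_def)

lemma subst_pol_id: "subst_pol X1 X2 p = p"
  by (induction p) (simp_all add: subst_pol_pCons subst_pol_0 subst_inner_id X2_def)

lemma subst_pol_cong_dvd:
  assumes "d dvd a - a'" "d dvd b - b'"
  shows "d dvd subst_pol a b p - subst_pol a' b' p"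
proof (induction p)
  case 0
  then show ?case by (simp add: subst_pol_0)
next
  case (pCons q p)
  let ?e = "\<lambda>x. poly (map_poly (\<lambda>c. [:[:c:]:]) q) x :: pol"
  have "subst_pol a b (pCons q p) - subst_pol a' b' (pCons q p) =
        (?e a - ?e a') + ((b - b') * subst_pol a b p + b' * (subst_pol a b p - subst_pol a' b' p))"
    by (simp add: subst_pol_pCons algebra_simps)
  moreover have "d dvd ?e a - ?e a'"
    using assms(1) poly_cong_dvd dvd_trans by blast
  ultimately show ?case
    using assms(2) pCons.IH by (metis dvd_add dvd_mult dvd_mult2)
qed

lemma lin_add: "lin (\<alpha> + \<beta>) = lin \<alpha> + lin \<beta>"
  by (simp add: lin_def algebra_simps smult_add_left[symmetric])

lemma lin_e1: "lin e1 = X1" and lin_e2: "lin e2 = X2"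
  by (simp_all add: lin_def axis_def pCons_one)

lemma lin_dvd_lin_refl:
  assumes "\<alpha> \<in> roots"
  shows "lin \<alpha> dvd lin \<beta> - lin (dual_act (reflection \<alpha>) \<beta>)"
proof -
  define c where "c = 2 * pairing \<beta> \<alpha> / pairing \<alpha> \<alpha>"
  have "dual_act (reflection \<alpha>) \<beta> $ j = \<beta> $ j - c * \<alpha> $ j" for j
    using exhaust_2[of j] unfolding dual_act_def matrix_inv_refl[OF assms]
    by (auto simp: reflection_def vector_matrix_mult_def sum_2 c_def pairing_def field_simps
        add_divide_distrib diff_divide_distrib)
  then have "\<beta> $ j = dual_act (reflection \<alpha>) \<beta> $ j + c * \<alpha> $ j" for j
    by simp
  then have "lin \<beta> - lin (dual_act (reflection \<alpha>) \<beta>) = [:[:c:]:] * lin \<alpha>"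
    by (simp add: lin_def X1_def X2_def algebra_simps)
  then show ?thesis by (metis dvd_triv_right)
qed

lemma lin_dvd_diff_wact:
  assumes "\<alpha> \<in> roots"
  shows "lin \<alpha> dvd p - wact (reflection \<alpha>) p"
proof -
  have "lin \<alpha> dvd subst_pol X1 X2 p - wact (reflection \<alpha>) p"
    unfolding wact_def
    by (intro subst_pol_cong_dvd)
      (use lin_dvd_lin_refl[OF assms] in \<open>simp_all add: lin_e1[symmetric] lin_e2[symmetric]\<close>)
  then show ?thesis by (simp add: subst_pol_id)
qed

end

theory Submission
  imports Defs
begin

text \<open>
  The Verma module of \<open>\<rho>\<close> is realised on vector-valued polynomials, with Dunkl operators twisted by
  \<open>\<rho>\<close>. The Dunkl operators, the multiplications and their commutators act by operators with unique
  normal forms, so every relation that holds on polynomials also holds on these modules. The simple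
  quotient is the quotient by the largest proper stable subspace, and it is finite-dimensional iff
  some proper stable subspace has finite codimension.

  For the trivial character, the largest proper stable subspace is the radical of a contravariant
  form. After exponentiating the Dunkl Laplacian, this form becomes the Gaussian functional
  \<open>Phi\<close>, and a proper stable subspace of finite codimension exists iff \<open>Phi\<close> vanishes in all high degrees.
  By invariance it suffices to test \<open>(x\<^sub>1\<^sup>2 + x\<^sub>2\<^sup>2)\<^sup>m\<close> times a power of one further invariant, and
  these moments are products of linear factors in \<open>k\<close> whose zeros give the stated conditions. For
  \<open>std\<close>, the reflections sum to zero on the lowest weight space, so the Dunkl Laplacian maps
  \<open>(x\<^sub>1\<^sup>2 + x\<^sub>2\<^sup>2)\<^sup>m v\<close> to a nonzero multiple of \<open>(x\<^sub>1\<^sup>2 + x\<^sub>2\<^sup>2)\<^sup>m\<^sup>-\<^sup>1 v\<close>, and no power can lie in a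
  proper stable subspace. For a one-dimensional \<open>\<tau>\<close>, the twisted Dunkl operators for \<open>k\<close> are the
  ordinary ones for \<open>k\<^sup>\<tau>\<close>.
\<close>

section \<open>Polynomials, reflections and divided differences\<close>

text \<open>The algebra consists of operators on polynomials, so an element has no preferred
  expression in the generators, and two expressions of one operator might act differently on another
  module. Normal forms are therefore studied on the product of the polynomial module with the module
  of \<open>\<rho>\<close>, where a word acts on both components at once. Their uniqueness comes
  from commutators with the basic invariants: an invariant commutes with \<open>W\<close>, its
  commutator with a Dunkl operator is an ordinary derivative, and the Jacobian of the two invariants
  is a multiple of the product of the positive roots. The same transfer shows that the map described
  in \<open>trivial_ext\<close> exists. The Euler element supplies the grading: its eigenvalues
  separate degrees inside every stable subspace. \<open>Phi p\<close> is the constant term of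
  exp(Laplacian / 2) p, which lets a factor \<open>X1\<close> or \<open>X2\<close> be traded for a
  Dunkl operator. In the moments, \<open>2 * hbar = 2 + 4 * (k1 + k2)\<close> is the scalar by which
  the sum of the commutators of \<open>T_i\<close> with \<open>X_i\<close> acts on an invariant, and
  \<open>4 * i + 2 + 4 * k2\<close> comes from the sign change of \<open>X1^2 - X2^2\<close> under
  the long reflections.\<close>

definition pconst :: "complex \<Rightarrow> pol" where "pconst c = [:[:c:]:]"

lemma pconst_add: "pconst (a + b) = pconst a + pconst b"
  and pconst_diff: "pconst (a - b) = pconst a - pconst b"
  and pconst_minus: "pconst (- a) = - pconst a"
  and pconst_mult: "pconst (a * b) = pconst a * pconst b"
  and pconst_0 [simp]: "pconst 0 = 0"
  and pconst_1 [simp]: "pconst 1 = 1"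
  and pconst_eq_iff [simp]: "pconst a = pconst b \<longleftrightarrow> a = b"
  and pconst_eq_0_iff [simp]: "pconst a = 0 \<longleftrightarrow> a = 0"
  by (simp_all add: pconst_def one_pCons)

lemma pconst_sum: "pconst (sum f A) = (\<Sum>x\<in>A. pconst (f x))"
  by (induction A rule: infinite_finite_induct) (simp_all add: pconst_add)

lemma pconst_of_nat: "pconst (of_nat n) = of_nat n"
  by (induction n) (simp_all add: pconst_add)

lemma pconst_numeral: "pconst (numeral n) = numeral n"
  using pconst_of_nat[of "numeral n"] by simp

lemma scal_eq: "scal c p = pconst c * p"
  by (simp add: scal_def pconst_def)

lemma lin_eq: "lin \<alpha> = pconst (\<alpha> $ 1) * X1 + pconst (\<alpha> $ 2) * X2"
  by (simp add: lin_def pconst_def)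

text \<open>The four cases are those of the axiom \<open>m_induct\<close> of the module locale
  below, so polynomials and module elements are treated by the same inductions.\<close>

lemma pol_induct [case_names const X1 X2 add]:
  assumes const: "\<And>c. P (pconst c)"
    and X1: "\<And>p. P p \<Longrightarrow> P (X1 * p)" and X2: "\<And>p. P p \<Longrightarrow> P (X2 * p)"
    and add: "\<And>p q. P p \<Longrightarrow> P q \<Longrightarrow> P (p + q)"
  shows "P p"
proof (induction p)
  case 0
  then show ?case using const[of 0] by simp
next
  case (pCons q p)
  have "P [:q:]"
  proof (induction q)
    case 0
    then show ?case using const[of 0] by simp
  next
    case (pCons c q)
    have "[:pCons c q:] = pconst c + X1 * [:q:]"
      by (simp add: pconst_def X1_def)
    then show ?case using const X1 add pCons.IH by metis
  qed
  moreover have "pCons q p = [:q:] + X2 * p" by (simp add: X2_def)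
  ultimately show ?case using X2 add pCons.IH by metis
qed

lemma subst_const: "subst_pol a b (pconst c) = pconst c"
  by (simp add: subst_pol_def pconst_def map_poly_pCons)

lemma subst_X1: "subst_pol a b X1 = a"
  by (simp add: subst_pol_def X1_def map_poly_pCons pCons_one)

lemma subst_X2: "subst_pol a b X2 = b"
  by (simp add: X2_def subst_pol_pCons subst_pol_0 map_poly_1 flip: pCons_one) (simp add: subst_pol_def map_poly_pCons pCons_one)

lemma subst_add: "subst_pol a b (p + q) = subst_pol a b p + subst_pol a b q"
proof -
  let ?f = "\<lambda>c::complex. [:[:c:]:] :: pol"
  have 1: "map_poly ?f (u + v) = map_poly ?f u + map_poly ?f v" for u v
    by (intro poly_eqI) (simp add: coeff_map_poly)
  have 2: "map_poly (\<lambda>q. poly (map_poly ?f q) a) (u + v)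
     = map_poly (\<lambda>q. poly (map_poly ?f q) a) u + map_poly (\<lambda>q. poly (map_poly ?f q) a) v" for u v
    by (intro poly_eqI) (simp add: coeff_map_poly 1)
  show ?thesis unfolding subst_pol_def 2 by simp
qed

lemma subst_X1_mult: "subst_pol a b (X1 * p) = a * subst_pol a b p"
proof (induction p)
  case 0
  then show ?case by (simp add: subst_pol_0)
next
  case (pCons q p)
  have "X1 * pCons q p = pCons (pCons 0 q) (X1 * p)" by (simp add: X1_def)
  then show ?case using pCons.IH
    by (simp add: subst_pol_pCons map_poly_pCons algebra_simps)
qed

lemma subst_X2_mult: "subst_pol a b (X2 * p) = b * subst_pol a b p"
  by (simp add: X2_def subst_pol_pCons)

lemma subst_const_mult: "subst_pol a b (pconst c * p) = pconst c * subst_pol a b p"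
proof (induction p rule: pol_induct)
  case (const d)
  then show ?case by (simp add: pconst_mult[symmetric] subst_const)
next
  case (X1 p)
  then show ?case using subst_X1_mult[of a b "pconst c * p"] subst_X1_mult[of a b p]
    by (simp add: mult.left_commute)
next
  case (X2 p)
  then show ?case using subst_X2_mult[of a b "pconst c * p"] subst_X2_mult[of a b p]
    by (simp add: mult.left_commute)
next
  case (add p q)
  then show ?case by (simp add: algebra_simps subst_add)
qed

lemma subst_mult: "subst_pol a b (p * q) = subst_pol a b p * subst_pol a b q"
proof (induction p rule: pol_induct)
  case (const d)
  then show ?case by (simp add: subst_const_mult subst_const)
next
  case (X1 p)
  then show ?case by (simp add: subst_X1_mult mult.assoc)
next
  case (X2 p)
  then show ?case by (simp add: subst_X2_mult mult.assoc)
next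
  case (add p q)
  then show ?case by (simp add: algebra_simps subst_add)
qed

section \<open>The Weyl group as signed permutation matrices, and its action on polynomials\<close>

abbreviation s1 :: "complex^2^2" where "s1 \<equiv> reflection e1"
abbreviation s2 :: "complex^2^2" where "s2 \<equiv> reflection e2"
abbreviation sm :: "complex^2^2" where "sm \<equiv> reflection (e1 - e2)"
abbreviation sp :: "complex^2^2" where "sp \<equiv> reflection (e1 + e2)"

lemma reflection_uminus: "reflection (- \<alpha>) = reflection \<alpha>"
  by (simp add: reflection_def pairing_def vec_eq_iff sum_negf)

lemma refl_entries:
  "s1$1$1 = -1" "s1$1$2 = 0" "s1$2$1 = 0" "s1$2$2 = 1"
  "s2$1$1 = 1" "s2$1$2 = 0" "s2$2$1 = 0" "s2$2$2 = -1"
  "sm$1$1 = 0" "sm$1$2 = 1" "sm$2$1 = 1" "sm$2$2 = 0"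
  "sp$1$1 = 0" "sp$1$2 = -1" "sp$2$1 = -1" "sp$2$2 = 0"
  by (simp_all add: reflection_def pairing_def sum_2 axis_def)

lemma roots_refl: "\<alpha> \<in> roots \<Longrightarrow> reflection \<alpha> \<in> {s1, s2, sm, sp}"
  by (auto simp: roots_def pos_roots_def reflection_uminus simp del: minus_diff_eq minus_add_distrib)

lemma pos_roots_roots: "\<alpha> \<in> pos_roots \<Longrightarrow> \<alpha> \<in> roots"
  by (simp add: roots_def)

lemma refl_in_W: "\<alpha> \<in> roots \<Longrightarrow> reflection \<alpha> \<in> W"
  using W_refl[OF W_one] by simp

lemma basic_refl_in_W [simp]: "s1 \<in> W" "s2 \<in> W" "sm \<in> W" "sp \<in> W"
  by (auto intro!: refl_in_W simp: roots_def pos_roots_def)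

text \<open>Opposite roots have the same reflection, so four reflections generate.\<close>

lemma W_induct' [consumes 1, case_names one s1 s2 sm sp]:
  assumes "w \<in> W" "P (mat 1)"
    and "\<And>w. w \<in> W \<Longrightarrow> P w \<Longrightarrow> P (s1 ** w)" "\<And>w. w \<in> W \<Longrightarrow> P w \<Longrightarrow> P (s2 ** w)"
    and "\<And>w. w \<in> W \<Longrightarrow> P w \<Longrightarrow> P (sm ** w)" "\<And>w. w \<in> W \<Longrightarrow> P w \<Longrightarrow> P (sp ** w)"
  shows "P w"
  using assms(1)
proof (induction rule: W.induct)
  case W_one
  then show ?case by fact
next
  case (W_refl w \<alpha>)
  then show ?case using roots_refl[of \<alpha>] assms by auto
qed

lemma W_mult [simp]: "v \<in> W \<Longrightarrow> w \<in> W \<Longrightarrow> v ** w \<in> W"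
  by (induction rule: W.induct) (auto simp: matrix_mul_assoc[symmetric] intro: W.intros)

lemma one_in_W [simp]: "mat 1 \<in> W"
  by (rule W_one)

lemma W_orthogonal: "w \<in> W \<Longrightarrow> transpose w ** w = mat 1 \<and> w ** transpose w = mat 1"
  using W_signed_perm[of w]
  by (auto simp: mat_eq_iff2 matrix_matrix_mult_def transpose_def mat_def sum_2)

lemma transpose_basic: "transpose s1 = s1" "transpose s2 = s2" "transpose sm = sm" "transpose sp = sp"
  by (simp_all add: mat_eq_iff2 transpose_def refl_entries)

lemma transpose_in_W: "w \<in> W \<Longrightarrow> transpose w \<in> W"
  by (induction rule: W_induct') (simp_all add: transpose_mat matrix_transpose_mul transpose_basic)

text \<open>Elements of \<open>W\<close> are orthogonal, so inverse and transpose agree and the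
  contragredient action has the matrix \<open>w\<close> itself.\<close>

lemma dual_act_W:
  assumes "w \<in> W" shows "dual_act w \<alpha> = w *v \<alpha>"
proof -
  have "\<exists>A'. w ** A' = mat 1 \<and> A' ** w = mat 1"
    using W_orthogonal[OF assms] by blast
  then have "matrix_inv w ** w = mat 1"
    unfolding matrix_inv_def by (rule someI2_ex) blast
  then have "matrix_inv w = transpose w"
    by (metis W_orthogonal[OF assms] matrix_mul_assoc matrix_mul_lid matrix_mul_rid)
  then show ?thesis
    by (simp add: dual_act_def vector_matrix_mult_def matrix_vector_mult_def transpose_def mult.commute)
qed

lemma wact_const [simp]: "wact w (pconst c) = pconst c"
  by (simp add: wact_def subst_const)
lemma wact_add [simp]: "wact w (p + q) = wact w p + wact w q"
  by (simp add: wact_def subst_add)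
lemma wact_mult [simp]: "wact w (p * q) = wact w p * wact w q"
  by (simp add: wact_def subst_mult)
lemma wact_0 [simp]: "wact w 0 = 0"
  by (simp add: wact_def subst_pol_0)
lemma wact_1 [simp]: "wact w 1 = 1"
  using wact_const[of w 1] by simp
lemma wact_minus [simp]: "wact w (- p) = - wact w p"
  by (metis wact_0 wact_add add_eq_0_iff)
lemma wact_diff [simp]: "wact w (p - q) = wact w p - wact w q"
  by (metis wact_add wact_minus diff_conv_add_uminus)
lemma wact_sum: "wact w (sum f A) = (\<Sum>x\<in>A. wact w (f x))"
  by (induction A rule: infinite_finite_induct) simp_all
lemma wact_power [simp]: "wact w (p ^ n) = wact w p ^ n"
  by (induction n) simp_all

lemma wact_X1: "w \<in> W \<Longrightarrow> wact w X1 = pconst (w$1$1) * X1 + pconst (w$2$1) * X2"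
  and wact_X2: "w \<in> W \<Longrightarrow> wact w X2 = pconst (w$1$2) * X1 + pconst (w$2$2) * X2"
  by (simp_all add: wact_def subst_X1 subst_X2 dual_act_W lin_eq matrix_vector_mult_def sum_2 axis_def)

lemma matrix_mult_entry: "(v ** w) $ i $ j = v $ i $ 1 * w $ 1 $ j + v $ i $ 2 * (w :: complex^2^2) $ 2 $ j"
  by (simp add: matrix_matrix_mult_def sum_2)

lemma wact_comp:
  assumes "v \<in> W" "w \<in> W"
  shows "wact v (wact w p) = wact (v ** w) p"
  by (induction p rule: pol_induct)
    (simp_all add: assms wact_X1 wact_X2 matrix_mult_entry pconst_add pconst_mult algebra_simps)

lemma mat_1_entry: "(mat 1 :: complex^2^2) $ i $ j = (if i = j then 1 else 0)"
  by (simp add: mat_def)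

lemma wact_one: "wact (mat 1) p = p"
  by (induction p rule: pol_induct) (simp_all add: wact_X1 wact_X2 mat_1_entry)

lemma wact_basic [simp]:
  "wact s1 X1 = - X1" "wact s1 X2 = X2" "wact s2 X1 = X1" "wact s2 X2 = - X2"
  "wact sm X1 = X2" "wact sm X2 = X1" "wact sp X1 = - X2" "wact sp X2 = - X1"
  by (simp_all add: wact_X1 wact_X2 refl_entries pconst_minus)

section \<open>Divided differences, the non-differential part of the Dunkl operators\<close>

definition divdiff :: "complex^2 \<Rightarrow> pol \<Rightarrow> pol" where
  "divdiff \<alpha> p = (p - wact (reflection \<alpha>) p) div lin \<alpha>"

lemma lin_mult_divdiff: "\<alpha> \<in> pos_roots \<Longrightarrow> lin \<alpha> * divdiff \<alpha> p = p - wact (reflection \<alpha>) p"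
  unfolding divdiff_def using lin_dvd_diff_wact[OF pos_roots_roots] by simp

lemma X_indep: "pconst a * X1 + pconst b * X2 = 0 \<longleftrightarrow> a = 0 \<and> b = 0"
  by (auto simp: pconst_def X1_def X2_def)

lemma X1_nz [simp]: "X1 \<noteq> 0" and X2_nz [simp]: "X2 \<noteq> 0"
  by (simp_all add: X1_def X2_def)

lemma lin_pos_root_nz: "\<alpha> \<in> pos_roots \<Longrightarrow> lin \<alpha> \<noteq> 0"
  by (auto simp: pos_roots_def lin_eq X_indep axis_def)

lemma divdiffI:
  assumes "\<alpha> \<in> pos_roots" "lin \<alpha> * q = p - wact (reflection \<alpha>) p"
  shows "divdiff \<alpha> p = q"
  using lin_mult_divdiff[OF assms(1), of p] assms(2) lin_pos_root_nz[OF assms(1)] by (metis mult_left_cancel)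

lemma divdiff_add: "\<alpha> \<in> pos_roots \<Longrightarrow> divdiff \<alpha> (p + q) = divdiff \<alpha> p + divdiff \<alpha> q"
  by (rule divdiffI) (simp_all add: distrib_left lin_mult_divdiff)

text \<open>Twisted Leibniz rule, from the splitting p q - r(p) r(q) = p (q - r(q)) + (p - r(p))
  r(q). The reflected second factor is what produces the reflections in the commutators with Dunkl
  operators.\<close>

lemma divdiff_mult:
  assumes "\<alpha> \<in> pos_roots"
  shows "divdiff \<alpha> (p * q) = p * divdiff \<alpha> q + divdiff \<alpha> p * wact (reflection \<alpha>) q"
proof (rule divdiffI[OF assms])
  have "lin \<alpha> * (p * divdiff \<alpha> q + divdiff \<alpha> p * wact (reflection \<alpha>) q)
     = p * (lin \<alpha> * divdiff \<alpha> q) + (lin \<alpha> * divdiff \<alpha> p) * wact (reflection \<alpha>) q"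
    by (simp add: algebra_simps)
  then show "lin \<alpha> * (p * divdiff \<alpha> q + divdiff \<alpha> p * wact (reflection \<alpha>) q) =
      p * q - wact (reflection \<alpha>) (p * q)"
    by (simp add: lin_mult_divdiff[OF assms] algebra_simps)
qed

lemma divdiff_const: "\<alpha> \<in> pos_roots \<Longrightarrow> divdiff \<alpha> (pconst c) = 0"
  by (rule divdiffI) simp_all

lemma divdiff_invariant: "wact (reflection \<alpha>) p = p \<Longrightarrow> divdiff \<alpha> p = 0"
  by (simp add: divdiff_def)

lemma in_pos_roots [simp]:
  "e1 \<in> pos_roots" "e2 \<in> pos_roots" "e1 + e2 \<in> pos_roots" "e1 - e2 \<in> pos_roots"
  by (simp_all add: pos_roots_def)

lemma lin_diff: "lin (\<alpha> - \<beta>) = lin \<alpha> - lin \<beta>"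
  by (simp add: lin_eq pconst_diff algebra_simps)

lemma divdiff_X [simp]:
  "divdiff e1 X1 = 2" "divdiff e1 X2 = 0" "divdiff e2 X1 = 0" "divdiff e2 X2 = 2"
  "divdiff (e1 - e2) X1 = 1" "divdiff (e1 - e2) X2 = - 1"
  "divdiff (e1 + e2) X1 = 1" "divdiff (e1 + e2) X2 = 1"
  by (rule divdiffI; simp add: lin_e1 lin_e2 lin_add lin_diff)+

lemma sum_pos_roots: "(\<Sum>\<alpha>\<in>pos_roots. f \<alpha>) = f e1 + f e2 + f (e1 + e2) + f (e1 - e2)"
proof -
  have "e1 \<noteq> e2" "e1 \<noteq> e1 + e2" "e1 \<noteq> e1 - e2" "e2 \<noteq> e1 + e2" "e2 \<noteq> e1 - e2" "e1 + e2 \<noteq> e1 - e2"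
    by (auto simp: vec_eq_iff forall_2 axis_def)
  then show ?thesis by (simp add: pos_roots_def add.assoc)
qed

section \<open>Directional derivatives and the Dunkl operators in terms of them\<close>

lemma pderiv_sum: "pderiv (sum f A) = (\<Sum>x\<in>A. pderiv (f x))"
  by (induction A rule: infinite_finite_induct) (simp_all add: pderiv_add)

lemma map_pderiv_add: "map_poly pderiv (p + q) = map_poly pderiv p + map_poly pderiv (q :: pol)"
  by (intro poly_eqI) (simp add: coeff_map_poly pderiv_add)

lemma map_pderiv_mult:
  "map_poly pderiv (p * q) = p * map_poly pderiv q + map_poly pderiv p * (q :: pol)"
proof -
  have "pderiv (a * b) = a * pderiv b + pderiv a * b" for a b :: "complex poly"
    by (simp add: pderiv_mult mult.commute)
  then show ?thesis
    by (intro poly_eqI) (simp add: coeff_map_poly coeff_mult pderiv_sum sum.distrib[symmetric])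
qed

lemma dderiv_add: "dderiv y (p + q) = dderiv y p + dderiv y q"
  by (simp add: dderiv_def map_pderiv_add pderiv_add scal_eq algebra_simps)

lemma dderiv_mult: "dderiv y (p * q) = p * dderiv y q + dderiv y p * q"
  by (simp add: dderiv_def map_pderiv_mult pderiv_mult scal_eq algebra_simps)

lemma dderiv_const [simp]: "dderiv y (pconst c) = 0"
  by (simp add: dderiv_def pconst_def map_poly_pCons pderiv_pCons scal_eq)

lemma dderiv_X [simp]: "dderiv y X1 = pconst (y $ 1)" "dderiv y X2 = pconst (y $ 2)"
  by (simp_all add: dderiv_def X1_def X2_def map_poly_pCons pderiv_pCons scal_eq pconst_def)

lemma dderiv_e: "dderiv y p = pconst (y $ 1) * dderiv e1 p + pconst (y $ 2) * dderiv e2 p"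
  by (simp add: dderiv_def scal_eq axis_def)

lemma dunkl_eq:
  "dunkl k y p = dderiv y p + (\<Sum>\<alpha>\<in>pos_roots. pconst (k \<alpha> * pairing \<alpha> y) * divdiff \<alpha> p)"
  by (simp add: dunkl_def scal_eq divdiff_def)

lemma pairing_values [simp]:
  "pairing e1 y = y $ 1" "pairing e2 y = y $ 2"
  "pairing (e1 + e2) y = y $ 1 + y $ 2" "pairing (e1 - e2) y = y $ 1 - y $ 2"
  by (simp_all add: pairing_def sum_2 axis_def)

section \<open>Modules over the Cherednik relations\<close>

text \<open>Each nontrivial rotation receives one normal form, \<open>s1 ** s2\<close>,
  \<open>s1 ** sm\<close> or \<open>s2 ** sm\<close>, so that the simplifier decides equality
  between products of two reflections.\<close>

lemma refl_mult [simp]: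
  "s1 ** s1 = mat 1" "s2 ** s2 = mat 1" "sm ** sm = mat 1" "sp ** sp = mat 1"
  "s2 ** s1 = s1 ** s2" "sm ** sp = s1 ** s2" "sp ** sm = s1 ** s2"
  "sm ** s2 = s1 ** sm" "sp ** s1 = s1 ** sm" "s2 ** sp = s1 ** sm"
  "sm ** s1 = s2 ** sm" "sp ** s2 = s2 ** sm" "s1 ** sp = s2 ** sm"
  by (simp_all add: mat_eq_iff2 matrix_mult_entry refl_entries mat_1_entry)

lemma e_entries: "e1 $ 1 = 1" "e1 $ 2 = 0" "e2 $ 1 = 0" "e2 $ 2 = 1"
  by (simp_all add: axis_def)

text \<open>The commutation relations of the algebra in coordinates, for a module generated over the
  polynomials by a space \<open>V0\<close> killed by the Dunkl operators; \<open>m_induct\<close>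
  expresses this generation. The factor 2 in front of \<open>k1\<close> is the pairing of a short
  root coordinate with its coroot. Equivariance and commutativity of \<open>T1\<close>,
  \<open>T2\<close> are not assumed: they hold on \<open>V0\<close> and propagate. Polynomials,
  vector-valued polynomials and products of both are instances.\<close>

locale cherednik_module = module act
  for act :: "pol \<Rightarrow> 'm::ab_group_add \<Rightarrow> 'm" (infixr \<open>\<star>\<close> 75) +
  fixes k1 k2 :: complex
    and wa :: "complex^2^2 \<Rightarrow> 'm \<Rightarrow> 'm"
    and T1 T2 :: "'m \<Rightarrow> 'm"
    and V0 :: "'m set"
  assumes wa_add: "wa w (x + y) = wa w x + wa w y"
    and wa_act: "w \<in> W \<Longrightarrow> wa w (p \<star> x) = wact w p \<star> wa w x"
    and wa_wa: "u \<in> W \<Longrightarrow> w \<in> W \<Longrightarrow> wa u (wa w x) = wa (u ** w) x"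
    and wa_one [simp]: "wa (mat 1) x = x"
    and T1_add: "T1 (x + y) = T1 x + T1 y"
    and T2_add: "T2 (x + y) = T2 x + T2 y"
    and T1_X1: "T1 (X1 \<star> x) = X1 \<star> T1 x + x + pconst (2 * k1) \<star> wa s1 x + pconst k2 \<star> (wa sp x + wa sm x)"
    and T1_X2: "T1 (X2 \<star> x) = X2 \<star> T1 x + pconst k2 \<star> (wa sp x - wa sm x)"
    and T2_X1: "T2 (X1 \<star> x) = X1 \<star> T2 x + pconst k2 \<star> (wa sp x - wa sm x)"
    and T2_X2: "T2 (X2 \<star> x) = X2 \<star> T2 x + x + pconst (2 * k1) \<star> wa s2 x + pconst k2 \<star> (wa sp x + wa sm x)"
    and T_V0: "v \<in> V0 \<Longrightarrow> T1 v = 0" "v \<in> V0 \<Longrightarrow> T2 v = 0"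
    and V0_zero: "0 \<in> V0"
    and V0_wa: "w \<in> W \<Longrightarrow> v \<in> V0 \<Longrightarrow> wa w v \<in> V0"
    and V0_const: "v \<in> V0 \<Longrightarrow> pconst c \<star> v \<in> V0"
    and m_induct [case_names base X1 X2 add]:
      "\<And>P x. (\<And>v. v \<in> V0 \<Longrightarrow> P v) \<Longrightarrow> (\<And>x. P x \<Longrightarrow> P (X1 \<star> x)) \<Longrightarrow> (\<And>x. P x \<Longrightarrow> P (X2 \<star> x)) \<Longrightarrow>
         (\<And>x y. P x \<Longrightarrow> P y \<Longrightarrow> P (x + y)) \<Longrightarrow> P x"
begin

lemma wa_0 [simp]: "wa w 0 = 0" and T1_0 [simp]: "T1 0 = 0" and T2_0 [simp]: "T2 0 = 0"
  using wa_add[of w 0 0] T1_add[of 0 0] T2_add[of 0 0] by simp_all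

lemma wa_minus: "wa w (- x) = - wa w x" and T1_minus: "T1 (- x) = - T1 x" and T2_minus: "T2 (- x) = - T2 x"
  using wa_add[of w "- x" x] T1_add[of "- x" x] T2_add[of "- x" x] by (simp_all add: eq_neg_iff_add_eq_0)

lemma wa_diff: "wa w (x - y) = wa w x - wa w y" and T1_diff: "T1 (x - y) = T1 x - T1 y"
  and T2_diff: "T2 (x - y) = T2 x - T2 y"
  by (simp_all only: diff_conv_add_uminus wa_add T1_add T2_add wa_minus T1_minus T2_minus)

lemma wa_const: "w \<in> W \<Longrightarrow> wa w (pconst c \<star> x) = pconst c \<star> wa w x"
  by (simp add: wa_act)

lemma T1_const: "T1 (pconst c \<star> x) = pconst c \<star> T1 x"
proof (induction x rule: m_induct)
  case (base v)
  then show ?case by (simp add: T_V0 V0_const)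
next
  case (X1 x)
  have "pconst c \<star> X1 \<star> x = X1 \<star> pconst c \<star> x" by (simp add: mult.commute)
  then show ?case using X1 by (simp add: T1_X1 wa_const algebra_simps del: scale_scale) 
     (simp add: algebra_simps)
next
  case (X2 x)
  have "pconst c \<star> X2 \<star> x = X2 \<star> pconst c \<star> x" by (simp add: mult.commute)
  then show ?case using X2 by (simp add: T1_X2 wa_const algebra_simps del: scale_scale) 
     (simp add: algebra_simps)
next
  case (add x y)
  then show ?case by (simp add: T1_add scale_right_distrib)
qed

lemma T2_const: "T2 (pconst c \<star> x) = pconst c \<star> T2 x"
proof (induction x rule: m_induct)
  case (base v)
  then show ?case by (simp add: T_V0 V0_const)
next
  case (X1 x)
  have "pconst c \<star> X1 \<star> x = X1 \<star> pconst c \<star> x" by (simp add: mult.commute)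
  then show ?case using X1 by (simp add: T2_X1 wa_const algebra_simps del: scale_scale) 
     (simp add: algebra_simps)
next
  case (X2 x)
  have "pconst c \<star> X2 \<star> x = X2 \<star> pconst c \<star> x" by (simp add: mult.commute)
  then show ?case using X2 by (simp add: T2_X2 wa_const algebra_simps del: scale_scale) 
     (simp add: algebra_simps)
next
  case (add x y)
  then show ?case by (simp add: T2_add scale_right_distrib)
qed

lemmas T_simps = T1_add T2_add T1_minus T2_minus T1_diff T2_diff T1_const T2_const T1_X1 T1_X2 T2_X1 T2_X2
lemmas wa_simps = wa_add wa_minus wa_diff wa_act wa_wa

lemma T_refl:
  "T1 (wa s1 x) = - wa s1 (T1 x)" "T2 (wa s1 x) = wa s1 (T2 x)"
  "T1 (wa s2 x) = wa s2 (T1 x)" "T2 (wa s2 x) = - wa s2 (T2 x)"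
  "T1 (wa sm x) = wa sm (T2 x)" "T2 (wa sm x) = wa sm (T1 x)"
  "T1 (wa sp x) = - wa sp (T2 x)" "T2 (wa sp x) = - wa sp (T1 x)"
proof -
  have "(T1 (wa s1 x) = - wa s1 (T1 x) \<and> T2 (wa s1 x) = wa s1 (T2 x)) \<and>
    (T1 (wa s2 x) = wa s2 (T1 x) \<and> T2 (wa s2 x) = - wa s2 (T2 x)) \<and>
    (T1 (wa sm x) = wa sm (T2 x) \<and> T2 (wa sm x) = wa sm (T1 x)) \<and>
    (T1 (wa sp x) = - wa sp (T2 x) \<and> T2 (wa sp x) = - wa sp (T1 x))"
  proof (induction x rule: m_induct)
    case (base v)
    then show ?case by (simp add: T_V0 V0_wa)
  next
    case (X1 x)
    then show ?case by (simp add: T_simps wa_simps scale_minus_left algebra_simps)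
  next
    case (X2 x)
    then show ?case by (simp add: T_simps wa_simps scale_minus_left algebra_simps)
  next
    case (add x y)
    then show ?case by (simp add: T1_add T2_add wa_add)
  qed
  then show "T1 (wa s1 x) = - wa s1 (T1 x)" "T2 (wa s1 x) = wa s1 (T2 x)"
  "T1 (wa s2 x) = wa s2 (T1 x)" "T2 (wa s2 x) = - wa s2 (T2 x)"
  "T1 (wa sm x) = wa sm (T2 x)" "T2 (wa sm x) = wa sm (T1 x)"
  "T1 (wa sp x) = - wa sp (T2 x)" "T2 (wa sp x) = - wa sp (T1 x)" by blast+
qed

text \<open>Both sides vanish on \<open>V0\<close>, and by \<open>T_refl\<close> the reflection
  terms in the commutator of \<open>T1 T2 - T2 T1\<close> with a coordinate cancel.\<close>

lemma T1_T2: "T1 (T2 x) = T2 (T1 x)"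
proof (induction x rule: m_induct)
  case (base v)
  then show ?case by (simp add: T_V0)
next
  case (X1 x)
  then show ?case by (simp add: T_simps T_refl algebra_simps)
next
  case (X2 x)
  then show ?case by (simp add: T_simps T_refl algebra_simps)
next
  case (add x y)
  then show ?case by (simp add: T1_add T2_add)
qed

text \<open>This is the relation for one coordinate extended to all polynomials by the twisted
  Leibniz rule. The coefficients are the multiplicities times the pairings of the positive roots
  with \<open>e1\<close>; in \<open>T2_act\<close> the pairing of \<open>e1 - e2\<close> with
  \<open>e2\<close> gives the minus sign.\<close>

lemma T1_act: "T1 (p \<star> x) = p \<star> T1 x + dderiv e1 p \<star> x + (pconst k1 * divdiff e1 p) \<star> wa s1 x
   + (pconst k2 * divdiff (e1 + e2) p) \<star> wa sp x + (pconst k2 * divdiff (e1 - e2) p) \<star> wa sm x"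
proof (induction p arbitrary: x rule: pol_induct)
  case (const c)
  then show ?case by (simp add: T1_const divdiff_const)
next
  case (X1 p)
  have "T1 ((X1 * p) \<star> x) = T1 (X1 \<star> p \<star> x)" by simp
  also have "\<dots> = X1 \<star> T1 (p \<star> x) + p \<star> x + pconst (2 * k1) \<star> wa s1 (p \<star> x)
     + pconst k2 \<star> (wa sp (p \<star> x) + wa sm (p \<star> x))"
    by (rule T1_X1)
  finally show ?case unfolding X1
    by (simp add: divdiff_mult dderiv_mult e_entries pconst_mult pconst_numeral wa_act algebra_simps)
next
  case (X2 p)
  have "T1 ((X2 * p) \<star> x) = T1 (X2 \<star> p \<star> x)" by simp
  also have "\<dots> = X2 \<star> T1 (p \<star> x) + pconst k2 \<star> (wa sp (p \<star> x) - wa sm (p \<star> x))"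
    by (rule T1_X2)
  finally show ?case unfolding X2
    by (simp add: divdiff_mult dderiv_mult e_entries wa_act algebra_simps)
next
  case (add p q)
  then show ?case by (simp add: scale_left_distrib T1_add divdiff_add dderiv_add algebra_simps)
qed

lemma T2_act: "T2 (p \<star> x) = p \<star> T2 x + dderiv e2 p \<star> x + (pconst k1 * divdiff e2 p) \<star> wa s2 x
   + (pconst k2 * divdiff (e1 + e2) p) \<star> wa sp x - (pconst k2 * divdiff (e1 - e2) p) \<star> wa sm x"
proof (induction p arbitrary: x rule: pol_induct)
  case (const c)
  then show ?case by (simp add: T2_const divdiff_const)
next
  case (X1 p)
  have "T2 ((X1 * p) \<star> x) = T2 (X1 \<star> p \<star> x)" by simp
  also have "\<dots> = X1 \<star> T2 (p \<star> x) + pconst k2 \<star> (wa sp (p \<star> x) - wa sm (p \<star> x))"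
    by (rule T2_X1)
  finally show ?case unfolding X1
    by (simp add: divdiff_mult dderiv_mult e_entries wa_act algebra_simps)
next
  case (X2 p)
  have "T2 ((X2 * p) \<star> x) = T2 (X2 \<star> p \<star> x)" by simp
  also have "\<dots> = X2 \<star> T2 (p \<star> x) + p \<star> x + pconst (2 * k1) \<star> wa s2 (p \<star> x)
     + pconst k2 \<star> (wa sp (p \<star> x) + wa sm (p \<star> x))"
    by (rule T2_X2)
  finally show ?case unfolding X2
    by (simp add: divdiff_mult dderiv_mult e_entries pconst_mult pconst_numeral wa_act algebra_simps)
next
  case (add p q)
  have "T2 ((p + q) \<star> x) = T2 (p \<star> x) + T2 (q \<star> x)"
    by (simp add: scale_left_distrib T2_add)
  then show ?case unfolding add by (simp add: divdiff_add dderiv_add algebra_simps)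
qed

text \<open>Conjugation by \<open>W\<close> preserves the span of \<open>T1\<close> and
  \<open>T2\<close>. The coefficients are left unspecified, since reordering only needs that the
  order in the Dunkl operators does not grow.\<close>

lemma T_wa:
  assumes "w \<in> W"
  shows "\<exists>a b c d. \<forall>x. T1 (wa w x) = wa w (pconst a \<star> T1 x + pconst b \<star> T2 x) \<and>
                      T2 (wa w x) = wa w (pconst c \<star> T1 x + pconst d \<star> T2 x)"
  using assms
proof (induction rule: W_induct')
  case one
  have "\<forall>x. T1 (wa (mat 1) x) = wa (mat 1) (pconst 1 \<star> T1 x + pconst 0 \<star> T2 x) \<and>
                      T2 (wa (mat 1) x) = wa (mat 1) (pconst 0 \<star> T1 x + pconst 1 \<star> T2 x)" by simp
  then show ?case by blast
next
  case (s1 w)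
  then obtain a b c d where h: "\<And>x. T1 (wa w x) = wa w (pconst a \<star> T1 x + pconst b \<star> T2 x)"
     "\<And>x. T2 (wa w x) = wa w (pconst c \<star> T1 x + pconst d \<star> T2 x)" by blast
  have "\<forall>x. T1 (wa (s1 ** w) x) = wa (s1 ** w) (pconst (-a) \<star> T1 x + pconst (-b) \<star> T2 x) \<and>
                      T2 (wa (s1 ** w) x) = wa (s1 ** w) (pconst c \<star> T1 x + pconst d \<star> T2 x)"
    using s1(1) by (simp add: wa_wa[symmetric] T_refl h pconst_minus wa_simps(1-4))
  then show ?case by blast
next
  case (s2 w)
  then obtain a b c d where h: "\<And>x. T1 (wa w x) = wa w (pconst a \<star> T1 x + pconst b \<star> T2 x)"
     "\<And>x. T2 (wa w x) = wa w (pconst c \<star> T1 x + pconst d \<star> T2 x)" by blast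
  have "\<forall>x. T1 (wa (s2 ** w) x) = wa (s2 ** w) (pconst a \<star> T1 x + pconst b \<star> T2 x) \<and>
                      T2 (wa (s2 ** w) x) = wa (s2 ** w) (pconst (-c) \<star> T1 x + pconst (-d) \<star> T2 x)"
    using s2(1) by (simp add: wa_wa[symmetric] T_refl h pconst_minus wa_simps(1-4))
  then show ?case by blast
next
  case (sm w)
  then obtain a b c d where h: "\<And>x. T1 (wa w x) = wa w (pconst a \<star> T1 x + pconst b \<star> T2 x)"
     "\<And>x. T2 (wa w x) = wa w (pconst c \<star> T1 x + pconst d \<star> T2 x)" by blast
  have "\<forall>x. T1 (wa (sm ** w) x) = wa (sm ** w) (pconst c \<star> T1 x + pconst d \<star> T2 x) \<and>
                      T2 (wa (sm ** w) x) = wa (sm ** w) (pconst a \<star> T1 x + pconst b \<star> T2 x)"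
    using sm(1) by (simp add: wa_wa[symmetric] T_refl h)
  then show ?case by blast
next
  case (sp w)
  then obtain a b c d where h: "\<And>x. T1 (wa w x) = wa w (pconst a \<star> T1 x + pconst b \<star> T2 x)"
     "\<And>x. T2 (wa w x) = wa w (pconst c \<star> T1 x + pconst d \<star> T2 x)" by blast
  have "\<forall>x. T1 (wa (sp ** w) x) = wa (sp ** w) (pconst (-c) \<star> T1 x + pconst (-d) \<star> T2 x) \<and>
                      T2 (wa (sp ** w) x) = wa (sp ** w) (pconst (-a) \<star> T1 x + pconst (-b) \<star> T2 x)"
    using sp(1) by (simp add: wa_wa[symmetric] T_refl h pconst_minus wa_simps(1-4))
  then show ?case by blast
qed

end

lemma finite_W: "finite W"
proof -
  let ?g = "\<lambda>w::complex^2^2. (w$1$1, w$1$2, w$2$1, w$2$2)"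
  have "?g ` W \<subseteq> {0,1,-1} \<times> {0,1,-1} \<times> {0,1,-1} \<times> {0,1,-1}"
    using W_signed_perm by fastforce
  then have "finite (?g ` W)" by (rule finite_subset) auto
  moreover have "inj_on ?g W" by (auto simp: inj_on_def mat_eq_iff2)
  ultimately show ?thesis by (rule finite_imageD)
qed

context cherednik_module
begin

section \<open>Normally ordered operators\<close>

text \<open>Polynomials stand on the left, then group elements, then Dunkl operators. The index is a
  strict bound on the order in the Dunkl operators, so that \<open>nf 0\<close> contains only the
  zero operator and can start inductions.\<close>

inductive_set nf :: "nat \<Rightarrow> ('m \<Rightarrow> 'm) set" for N where
  nf_zero: "(\<lambda>x. 0) \<in> nf N"
| nf_add: "f \<in> nf N \<Longrightarrow> g \<in> nf N \<Longrightarrow> (\<lambda>x. f x + g x) \<in> nf N"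
| nf_term: "w \<in> W \<Longrightarrow> a + b < N \<Longrightarrow> (\<lambda>x. q \<star> wa w ((T1 ^^ a) ((T2 ^^ b) x))) \<in> nf N"

lemma nf_mono: "f \<in> nf N \<Longrightarrow> N \<le> M \<Longrightarrow> f \<in> nf M"
  by (induction rule: nf.induct) (auto intro: nf.intros)

lemma nf_zero_iff: "f \<in> nf 0 \<longleftrightarrow> f = (\<lambda>x. 0)"
proof
  show "f \<in> nf 0 \<Longrightarrow> f = (\<lambda>x. 0)"
    by (induction rule: nf.induct) auto
qed (auto intro: nf_zero)

lemma nf_sum: "(\<And>i. i \<in> A \<Longrightarrow> f i \<in> nf N) \<Longrightarrow> (\<lambda>x. \<Sum>i\<in>A. f i x) \<in> nf N"
  by (induction A rule: infinite_finite_induct) (auto intro: nf.intros)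

lemma T2_T1_pow: "T2 ((T1 ^^ a) x) = (T1 ^^ a) (T2 x)"
  by (induction a) (simp_all flip: T1_T2)

lemma T_pow_swap: "(T2 ^^ b) ((T1 ^^ a) x) = (T1 ^^ a) ((T2 ^^ b) x)"
  by (induction b) (simp_all add: T2_T1_pow)

lemma T_pow_right: "(T1 ^^ a) (T1 x) = (T1 ^^ Suc a) x" "(T2 ^^ a) (T2 x) = (T2 ^^ Suc a) x"
  by (simp_all add: funpow_swap1)

lemma nf_act: "f \<in> nf N \<Longrightarrow> (\<lambda>x. p \<star> f x) \<in> nf N"
proof (induction rule: nf.induct)
  case (nf_term w a b q)
  then show ?case using nf.nf_term[of w a b N "p * q"] by simp
qed (auto simp: scale_right_distrib intro: nf.intros)

lemma nf_minus: "f \<in> nf N \<Longrightarrow> (\<lambda>x. - f x) \<in> nf N"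
  using nf_act[of f N "- 1"] by simp

lemma nf_diff: "f \<in> nf N \<Longrightarrow> g \<in> nf N \<Longrightarrow> (\<lambda>x. f x - g x) \<in> nf N"
  using nf_add[of f N "\<lambda>x. - g x"] nf_minus[of g N] by simp

lemma nf_wa: "f \<in> nf N \<Longrightarrow> v \<in> W \<Longrightarrow> (\<lambda>x. wa v (f x)) \<in> nf N"
proof (induction rule: nf.induct)
  case (nf_term w a b q)
  then show ?case using nf.nf_term[of "v ** w" a b N "wact v q"] by (simp add: wa_act wa_wa)
qed (auto simp: wa_add intro: nf.intros)

lemma T1_act_nf: "\<exists>r\<in>nf 1. \<forall>x. T1 (p \<star> x) = p \<star> T1 x + r x"
proof
  show "(\<lambda>x. dderiv e1 p \<star> wa (mat 1) ((T1 ^^ 0) ((T2 ^^ 0) x))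
     + ((pconst k1 * divdiff e1 p) \<star> wa s1 ((T1 ^^ 0) ((T2 ^^ 0) x))
      + ((pconst k2 * divdiff (e1 + e2) p) \<star> wa sp ((T1 ^^ 0) ((T2 ^^ 0) x))
      + (pconst k2 * divdiff (e1 - e2) p) \<star> wa sm ((T1 ^^ 0) ((T2 ^^ 0) x))))) \<in> nf 1"
    by (intro nf_add nf_term) auto
qed (simp add: T1_act add.assoc)

lemma T2_act_nf: "\<exists>r\<in>nf 1. \<forall>x. T2 (p \<star> x) = p \<star> T2 x + r x"
proof
  show "(\<lambda>x. dderiv e2 p \<star> wa (mat 1) ((T1 ^^ 0) ((T2 ^^ 0) x))
     + ((pconst k1 * divdiff e2 p) \<star> wa s2 ((T1 ^^ 0) ((T2 ^^ 0) x))
      + ((pconst k2 * divdiff (e1 + e2) p) \<star> wa sp ((T1 ^^ 0) ((T2 ^^ 0) x))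
      - (pconst k2 * divdiff (e1 - e2) p) \<star> wa sm ((T1 ^^ 0) ((T2 ^^ 0) x))))) \<in> nf 1"
    by (intro nf_add nf_diff nf_term) auto
qed (simp add: T2_act add.assoc)

lemma nf_right_T1: "f \<in> nf N \<Longrightarrow> (\<lambda>x. f (T1 x)) \<in> nf (Suc N)"
proof (induction rule: nf.induct)
  case (nf_term w a b q)
  then show ?case using nf.nf_term[of w "Suc a" b "Suc N" q]
    by (simp add: T_pow_swap[of b 1, simplified] T_pow_right del: funpow.simps)
qed (auto intro: nf.intros)

lemma nf_right_T2: "f \<in> nf N \<Longrightarrow> (\<lambda>x. f (T2 x)) \<in> nf (Suc N)"
proof (induction rule: nf.induct)
  case (nf_term w a b q)
  then show ?case using nf.nf_term[of w a "Suc b" "Suc N" q]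
    by (simp add: T_pow_right del: funpow.simps)
qed (auto intro: nf.intros)

lemma nf_right_T1_pow: "f \<in> nf N \<Longrightarrow> (\<lambda>x. f ((T1 ^^ a) x)) \<in> nf (N + a)"
proof (induction a)
  case (Suc a)
  then show ?case using nf_right_T1[of "\<lambda>x. f ((T1 ^^ a) x)" "N + a"]
    by (simp add: T_pow_right)
qed auto

lemma nf_right_T2_pow: "f \<in> nf N \<Longrightarrow> (\<lambda>x. f ((T2 ^^ a) x)) \<in> nf (N + a)"
proof (induction a)
  case (Suc a)
  then show ?case using nf_right_T2[of "\<lambda>x. f ((T2 ^^ a) x)" "N + a"]
    by (simp add: T_pow_right)
qed auto

lemma nf_right_pow: "f \<in> nf N \<Longrightarrow> (\<lambda>x. f ((T1 ^^ a) ((T2 ^^ b) x))) \<in> nf (N + a + b)"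
  using nf_right_T2_pow[OF nf_right_T1_pow] by blast

lemma nf_wa_T1: assumes "w \<in> W" shows "(\<lambda>x. T1 (wa w x)) \<in> nf 2"
proof -
  obtain a b where h: "\<And>x. T1 (wa w x) = wa w (pconst a \<star> T1 x + pconst b \<star> T2 x)"
    using T_wa[OF assms] by blast
  have "(\<lambda>x. pconst a \<star> wa w ((T1 ^^ 1) ((T2 ^^ 0) x)) + pconst b \<star> wa w ((T1 ^^ 0) ((T2 ^^ 1) x))) \<in> nf 2"
    using assms by (intro nf_add nf_term) auto
  then show ?thesis by (simp add: h wa_add wa_const assms)
qed

lemma nf_wa_T2: assumes "w \<in> W" shows "(\<lambda>x. T2 (wa w x)) \<in> nf 2"
proof -
  obtain a b where h: "\<And>x. T2 (wa w x) = wa w (pconst a \<star> T1 x + pconst b \<star> T2 x)"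
    using T_wa[OF assms] by blast
  have "(\<lambda>x. pconst a \<star> wa w ((T1 ^^ 1) ((T2 ^^ 0) x)) + pconst b \<star> wa w ((T1 ^^ 0) ((T2 ^^ 1) x))) \<in> nf 2"
    using assms by (intro nf_add nf_term) auto
  then show ?thesis by (simp add: h wa_add wa_const assms)
qed

text \<open>Restricted to order zero, where no Dunkl operator stands in the way of merging the two
  group elements. The remainders of \<open>T1_act_nf\<close> and \<open>T2_act_nf\<close> are of
  this kind.\<close>

lemma nf_right_wa: "f \<in> nf 1 \<Longrightarrow> v \<in> W \<Longrightarrow> (\<lambda>x. f (wa v x)) \<in> nf 1"
proof (induction rule: nf.induct)
  case (nf_term w a b q)
  then show ?case using nf.nf_term[of "w ** v" 0 0 1 q] by (simp add: wa_wa)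
qed (auto intro: nf.intros)

text \<open>Moving \<open>T1\<close> past the polynomial leaves a remainder of order zero, and
  moving it past the group element keeps order one; after that it merges with the powers on the
  right.\<close>

lemma nf_T1: "f \<in> nf N \<Longrightarrow> (\<lambda>x. T1 (f x)) \<in> nf (Suc N)"
proof (induction rule: nf.induct)
  case (nf_term w a b q)
  obtain r where r: "r \<in> nf 1" "\<And>x. T1 (q \<star> x) = q \<star> T1 x + r x" using T1_act_nf[of q] by blast
  have "(\<lambda>x. q \<star> T1 (wa w ((T1 ^^ a) ((T2 ^^ b) x)))) \<in> nf (2 + a + b)"
    using nf_term(1) by (intro nf_act nf_right_pow[OF nf_wa_T1]) 
  moreover have "(\<lambda>x. r (wa w ((T1 ^^ a) ((T2 ^^ b) x)))) \<in> nf (1 + a + b)"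
    using nf_right_pow[OF nf_right_wa[OF r(1) nf_term(1)]] .
  ultimately have "(\<lambda>x. q \<star> T1 (wa w ((T1 ^^ a) ((T2 ^^ b) x))) + r (wa w ((T1 ^^ a) ((T2 ^^ b) x)))) \<in> nf (Suc N)"
    using nf_term(2) by (intro nf_add) (erule nf_mono, simp)+
  then show ?case by (simp add: r)
qed (auto simp: T1_add intro: nf.intros)

lemma nf_T2: "f \<in> nf N \<Longrightarrow> (\<lambda>x. T2 (f x)) \<in> nf (Suc N)"
proof (induction rule: nf.induct)
  case (nf_term w a b q)
  obtain r where r: "r \<in> nf 1" "\<And>x. T2 (q \<star> x) = q \<star> T2 x + r x" using T2_act_nf[of q] by blast
  have "(\<lambda>x. q \<star> T2 (wa w ((T1 ^^ a) ((T2 ^^ b) x)))) \<in> nf (2 + a + b)"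
    using nf_term(1) by (intro nf_act nf_right_pow[OF nf_wa_T2]) 
  moreover have "(\<lambda>x. r (wa w ((T1 ^^ a) ((T2 ^^ b) x)))) \<in> nf (1 + a + b)"
    using nf_right_pow[OF nf_right_wa[OF r(1) nf_term(1)]] .
  ultimately have "(\<lambda>x. q \<star> T2 (wa w ((T1 ^^ a) ((T2 ^^ b) x))) + r (wa w ((T1 ^^ a) ((T2 ^^ b) x)))) \<in> nf (Suc N)"
    using nf_term(2) by (intro nf_add) (erule nf_mono, simp)+
  then show ?case by (simp add: r)
qed (auto simp: T2_add intro: nf.intros)

inductive_set alg :: "('m \<Rightarrow> 'm) set" where
  alg_act: "(\<lambda>x. p \<star> x) \<in> alg"
| alg_wa: "w \<in> W \<Longrightarrow> wa w \<in> alg"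
| alg_T1: "T1 \<in> alg"
| alg_T2: "T2 \<in> alg"
| alg_add: "f \<in> alg \<Longrightarrow> g \<in> alg \<Longrightarrow> (\<lambda>x. f x + g x) \<in> alg"
| alg_comp: "f \<in> alg \<Longrightarrow> g \<in> alg \<Longrightarrow> f \<circ> g \<in> alg"

lemma alg_nf: assumes "f \<in> alg" shows "\<exists>N. f \<in> nf N"
proof -
  \<comment> \<open>Composition with an arbitrary normally ordered \<open>g\<close> is the statement
    that survives the case of a composition; the claim itself is the case of the identity.\<close>
  have "\<exists>M. (\<lambda>x. f (g x)) \<in> nf M" if "g \<in> nf N" for g N
    using assms that
  proof (induction arbitrary: g N rule: alg.induct)
    case (alg_add f f')
    then obtain M M' where "(\<lambda>x. f (g x)) \<in> nf M" "(\<lambda>x. f' (g x)) \<in> nf M'" by blast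
    then have "(\<lambda>x. f (g x)) \<in> nf (max M M')" "(\<lambda>x. f' (g x)) \<in> nf (max M M')"
      by (auto elim: nf_mono)
    then show ?case using nf_add by blast
  next
    case (alg_comp f f')
    then obtain M where "(\<lambda>x. f' (g x)) \<in> nf M" by blast
    then show ?case using alg_comp.IH(1) by fastforce
  qed (auto intro: nf_act nf_wa nf_T1 nf_T2)
  moreover have "(\<lambda>x. x) \<in> nf 1"
    using nf_term[of "mat 1" 0 0 1 1] by simp
  ultimately show ?thesis by blast
qed

subsection \<open>Uniqueness of normal forms\<close>

definition invariant :: "pol \<Rightarrow> bool" where
  "invariant h \<longleftrightarrow> (\<forall>w\<in>W. wact w h = h)"

text \<open>All divided differences of an invariant vanish, so only the derivative remains.\<close>

lemma T_act_invariant: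
  assumes "invariant h"
  shows "T1 (h \<star> x) = h \<star> T1 x + dderiv e1 h \<star> x" "T2 (h \<star> x) = h \<star> T2 x + dderiv e2 h \<star> x"
  using assms by (simp_all add: T1_act T2_act divdiff_invariant invariant_def)

text \<open>For \<open>a = 0\<close> the truncated exponent \<open>a - 1\<close> does no harm
  because the coefficient is zero.\<close>

lemma nf_lower1: "w \<in> W \<Longrightarrow> (\<lambda>x. (of_nat a * p) \<star> wa w ((T1 ^^ (a - 1)) ((T2 ^^ b) x))) \<in> nf (a + b)"
  by (cases a) (auto intro: nf_zero nf_term)

lemma nf_lower2: "w \<in> W \<Longrightarrow> (\<lambda>x. (of_nat b * p) \<star> wa w ((T1 ^^ a) ((T2 ^^ (b - 1)) x))) \<in> nf (a + b)"
  by (cases b) (auto intro: nf_zero nf_term)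

text \<open>The first two terms of the Leibniz expansion; all further terms have order at most
  \<open>b - 2\<close>, which is what membership in \<open>nf (b - 1)\<close> says.\<close>

lemma T2_pow_act:
  assumes "invariant h"
  shows "\<exists>g\<in>nf (b - 1). \<forall>x. (T2 ^^ b) (h \<star> x) =
     h \<star> (T2 ^^ b) x + (of_nat b * dderiv e2 h) \<star> (T2 ^^ (b - 1)) x + g x"
proof (induction b)
  case 0
  then show ?case by (intro bexI[of _ "\<lambda>x. 0"]) (simp_all add: nf_zero)
next
  case (Suc b)
  then obtain g where g: "g \<in> nf (b - 1)" "\<And>x. (T2 ^^ b) (h \<star> x) =
     h \<star> (T2 ^^ b) x + (of_nat b * dderiv e2 h) \<star> (T2 ^^ (b - 1)) x + g x" by blast
  show ?case
  proof (cases b)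
    case 0
    then show ?thesis using T_act_invariant[OF assms]
      by (intro bexI[of _ "\<lambda>x. 0"]) (simp_all add: nf_zero)
  next
    case (Suc c)
    obtain r where r: "r \<in> nf 1" "\<And>x. T2 ((of_nat b * dderiv e2 h) \<star> x) = (of_nat b * dderiv e2 h) \<star> T2 x + r x"
      using T2_act_nf[of "of_nat b * dderiv e2 h"] by blast
    have "(\<lambda>x. r ((T2 ^^ c) x)) \<in> nf b" using nf_right_T2_pow[OF r(1), of c] Suc by simp
    moreover have "(\<lambda>x. T2 (g x)) \<in> nf b" using nf_T2[OF g(1)] Suc by simp
    ultimately have "(\<lambda>x. r ((T2 ^^ c) x) + T2 (g x)) \<in> nf (Suc b - 1)" using nf_add by simp
    moreover have "(T2 ^^ Suc b) (h \<star> x) = h \<star> (T2 ^^ Suc b) x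
      + (of_nat (Suc b) * dderiv e2 h) \<star> (T2 ^^ (Suc b - 1)) x + (r ((T2 ^^ c) x) + T2 (g x))" for x
    proof -
      have "(T2 ^^ Suc b) (h \<star> x) = T2 (h \<star> (T2 ^^ b) x) + T2 ((of_nat b * dderiv e2 h) \<star> (T2 ^^ c) x) + T2 (g x)"
        using g(2) Suc by (simp add: T2_add)
      also have "\<dots> = h \<star> (T2 ^^ Suc b) x + dderiv e2 h \<star> (T2 ^^ b) x
        + (of_nat b * dderiv e2 h) \<star> (T2 ^^ b) x + r ((T2 ^^ c) x) + T2 (g x)"
        unfolding r T_act_invariant[OF assms] using Suc by (simp add: add.assoc)
      finally show ?thesis by (simp add: algebra_simps)
    qed
    ultimately show ?thesis
      by (intro bexI[of _ "\<lambda>x. r ((T2 ^^ c) x) + T2 (g x)"] allI)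
  qed
qed

lemma T_pow_act:
  assumes "invariant h"
  shows "\<exists>g\<in>nf (a + b - 1). \<forall>x. (T1 ^^ a) ((T2 ^^ b) (h \<star> x)) =
     h \<star> (T1 ^^ a) ((T2 ^^ b) x) + (of_nat a * dderiv e1 h) \<star> (T1 ^^ (a - 1)) ((T2 ^^ b) x)
      + (of_nat b * dderiv e2 h) \<star> (T1 ^^ a) ((T2 ^^ (b - 1)) x) + g x"
proof (induction a)
  case 0
  then show ?case using T2_pow_act[OF assms, of b] by simp
next
  case (Suc a)
  let ?p1 = "of_nat a * dderiv e1 h" and ?p2 = "of_nat b * dderiv e2 h"
  obtain g where g: "g \<in> nf (a + b - 1)" "\<And>x. (T1 ^^ a) ((T2 ^^ b) (h \<star> x)) =
     h \<star> (T1 ^^ a) ((T2 ^^ b) x) + ?p1 \<star> (T1 ^^ (a - 1)) ((T2 ^^ b) x)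
      + ?p2 \<star> (T1 ^^ a) ((T2 ^^ (b - 1)) x) + g x" using Suc by blast
  obtain r1 where r1: "r1 \<in> nf 1" "\<And>x. T1 (?p1 \<star> x) = ?p1 \<star> T1 x + r1 x"
    using T1_act_nf[of ?p1] by blast
  obtain r2 where r2: "r2 \<in> nf 1" "\<And>x. T1 (?p2 \<star> x) = ?p2 \<star> T1 x + r2 x"
    using T1_act_nf[of ?p2] by blast
  \<comment> \<open>For \<open>a = 0\<close> the coefficient \<open>?p1\<close> is zero while the
    truncated power would spoil the order bound, so the remainder is set to zero by hand; the same
    is done for \<open>b\<close> in \<open>g2\<close>.\<close>
  define g1 where "g1 = (\<lambda>x. if a = 0 then 0 else r1 ((T1 ^^ (a - 1)) ((T2 ^^ b) x)))"
  define g2 where "g2 = (\<lambda>x. if b = 0 then 0 else r2 ((T1 ^^ a) ((T2 ^^ (b - 1)) x)))"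
  have g1: "g1 \<in> nf (a + b)"
    using nf_right_pow[OF r1(1), of "a - 1" b] by (cases a) (auto simp: g1_def intro: nf_zero)
  have g2: "g2 \<in> nf (a + b)"
    using nf_right_pow[OF r2(1), of a "b - 1"] by (cases b) (auto simp: g2_def intro: nf_zero)
  have "(\<lambda>x. T1 (g x)) \<in> nf (a + b)"
  proof (cases "a + b")
    case 0
    then show ?thesis using g(1) by (simp add: nf_zero_iff)
  next
    case (Suc n)
    then show ?thesis using nf_T1[OF g(1)] by simp
  qed
  then have "(\<lambda>x. g1 x + (g2 x + T1 (g x))) \<in> nf (Suc a + b - 1)"
    using g1 g2 by (auto intro: nf_add)
  moreover have "(T1 ^^ Suc a) ((T2 ^^ b) (h \<star> x)) =
     h \<star> (T1 ^^ Suc a) ((T2 ^^ b) x) + (of_nat (Suc a) * dderiv e1 h) \<star> (T1 ^^ (Suc a - 1)) ((T2 ^^ b) x)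
      + ?p2 \<star> (T1 ^^ Suc a) ((T2 ^^ (b - 1)) x) + (g1 x + (g2 x + T1 (g x)))" for x
  proof -
    have 1: "T1 (?p1 \<star> (T1 ^^ (a - 1)) ((T2 ^^ b) x)) = ?p1 \<star> (T1 ^^ a) ((T2 ^^ b) x) + g1 x"
      unfolding r1 g1_def using r1(2)[of "(T2 ^^ b) x"] by (cases a) auto
    have 2: "T1 (?p2 \<star> (T1 ^^ a) ((T2 ^^ (b - 1)) x)) = ?p2 \<star> (T1 ^^ Suc a) ((T2 ^^ (b - 1)) x) + g2 x"
      unfolding r2 g2_def using r2(2)[of "(T1 ^^ a) x"] by (cases b) auto
    have "(T1 ^^ Suc a) ((T2 ^^ b) (h \<star> x)) = T1 (h \<star> (T1 ^^ a) ((T2 ^^ b) x))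
       + T1 (?p1 \<star> (T1 ^^ (a - 1)) ((T2 ^^ b) x)) + T1 (?p2 \<star> (T1 ^^ a) ((T2 ^^ (b - 1)) x)) + T1 (g x)"
      by (simp add: g(2) T1_add)
    also have "\<dots> = h \<star> (T1 ^^ Suc a) ((T2 ^^ b) x) + dderiv e1 h \<star> (T1 ^^ a) ((T2 ^^ b) x)
      + (?p1 \<star> (T1 ^^ a) ((T2 ^^ b) x) + g1 x) + (?p2 \<star> (T1 ^^ Suc a) ((T2 ^^ (b - 1)) x) + g2 x) + T1 (g x)"
      unfolding 1 2 T_act_invariant[OF assms] by simp
    finally show ?thesis by (simp add: algebra_simps)
  qed
  ultimately show ?case
    by (intro bexI[of _ "\<lambda>x. g1 x + (g2 x + T1 (g x))"] allI)
qed

text \<open>An invariant commutes with the group and with polynomials, so only its commutator with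
  the Dunkl powers survives, and that loses one order.\<close>

lemma nf_commutator:
  assumes "invariant h"
  shows "f \<in> nf N \<Longrightarrow> (\<lambda>x. f (h \<star> x) - h \<star> f x) \<in> nf (N - 1)"
proof (induction rule: nf.induct)
  case nf_zero
  then show ?case by (simp add: nf.nf_zero)
next
  case (nf_add f g)
  then have "(\<lambda>x. (f (h \<star> x) - h \<star> f x) + (g (h \<star> x) - h \<star> g x)) \<in> nf (N - 1)"
    by (intro nf.nf_add)
  then show ?case by (simp add: scale_right_distrib add_diff_add)
next
  case (nf_term w a b q)
  obtain g where g: "g \<in> nf (a + b - 1)" "\<And>x. (T1 ^^ a) ((T2 ^^ b) (h \<star> x)) =
     h \<star> (T1 ^^ a) ((T2 ^^ b) x) + (of_nat a * dderiv e1 h) \<star> (T1 ^^ (a - 1)) ((T2 ^^ b) x)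
      + (of_nat b * dderiv e2 h) \<star> (T1 ^^ a) ((T2 ^^ (b - 1)) x) + g x"
    using T_pow_act[OF assms, of a b] by blast
  have "(\<lambda>x. q \<star> wa w ((of_nat a * dderiv e1 h) \<star> wa (mat 1) ((T1 ^^ (a - 1)) ((T2 ^^ b) x))
      + ((of_nat b * dderiv e2 h) \<star> wa (mat 1) ((T1 ^^ a) ((T2 ^^ (b - 1)) x)) + g x))) \<in> nf (a + b)"
    using nf_term(1) by (intro nf_act nf_wa nf_add nf_lower1 nf_lower2 nf_mono[OF g(1)]) simp_all
  then have "(\<lambda>x. q \<star> wa w ((of_nat a * dderiv e1 h) \<star> (T1 ^^ (a - 1)) ((T2 ^^ b) x)
      + ((of_nat b * dderiv e2 h) \<star> (T1 ^^ a) ((T2 ^^ (b - 1)) x) + g x))) \<in> nf (N - 1)"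
    using nf_term(2) by (auto elim: nf_mono)
  moreover have "q \<star> wa w (h \<star> x) = h \<star> q \<star> wa w x" for x
    using assms nf_term(1) by (simp add: invariant_def wa_act mult.commute)
  ultimately show ?case
    by (simp add: g(2) wa_add scale_right_distrib add.assoc)
qed

text \<open>The part of exact order \<open>N\<close>, indexed by the group element and the exponent
  of \<open>T1\<close>.\<close>

definition symb :: "nat \<Rightarrow> (complex^2^2 \<Rightarrow> nat \<Rightarrow> pol) \<Rightarrow> 'm \<Rightarrow> 'm" where
  "symb N q x = (\<Sum>w\<in>W. \<Sum>a\<le>N. q w a \<star> wa w ((T1 ^^ a) ((T2 ^^ (N - a)) x)))"

lemma nf_Suc_decomp:
  assumes "f \<in> nf (Suc N)"
  shows "\<exists>q. \<exists>g\<in>nf N. \<forall>x. f x = symb N q x + g x"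
  using assms
proof (induction rule: nf.induct)
  case nf_zero
  have "\<forall>x. 0 = symb N (\<lambda>w a. 0) x + (0 :: 'm)" by (simp add: symb_def)
  then show ?case using nf.nf_zero[of N]
    by (intro exI[of _ "\<lambda>w a. 0"] bexI[of _ "\<lambda>x. 0"])
next
  case (nf_add f f')
  then obtain q g q' g' where h: "g \<in> nf N" "g' \<in> nf N" "\<And>x. f x = symb N q x + g x"
    "\<And>x. f' x = symb N q' x + g' x" by blast
  have "\<forall>x. f x + f' x = symb N (\<lambda>w a. q w a + q' w a) x + (g x + g' x)"
    by (simp add: h symb_def scale_left_distrib sum.distrib algebra_simps)
  then show ?case using nf.nf_add[OF h(1,2)]
    by (intro exI[of _ "\<lambda>w a. q w a + q' w a"] bexI[of _ "\<lambda>x. g x + g' x"])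
next
  case (nf_term w a b q)
  show ?case
  proof (cases "a + b = N")
    case True
    define q' where "q' = (\<lambda>v c. if v = w \<and> c = a then q else 0)"
    have eq: "(if w = v then f else (0 :: 'm)) = (if v = w then f else 0)" for v f by auto
    have "symb N q' x = (\<Sum>v\<in>W. if v = w then q \<star> wa w ((T1 ^^ a) ((T2 ^^ b) x)) else 0)" for x
      unfolding symb_def
    proof (rule sum.cong)
      fix v
      have "(\<Sum>c\<le>N. q' v c \<star> wa v ((T1 ^^ c) ((T2 ^^ (N - c)) x)))
        = (\<Sum>c\<le>N. if c = a then (if v = w then q \<star> wa w ((T1 ^^ a) ((T2 ^^ b) x)) else 0) else 0)"
        using True by (intro sum.cong) (auto simp: q'_def)
      then show "(\<Sum>c\<le>N. q' v c \<star> wa v ((T1 ^^ c) ((T2 ^^ (N - c)) x)))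
        = (if v = w then q \<star> wa w ((T1 ^^ a) ((T2 ^^ b) x)) else 0)"
        using True by simp
    qed simp
    then have "\<forall>x. q \<star> wa w ((T1 ^^ a) ((T2 ^^ b) x)) = symb N q' x + 0"
      using nf_term(1) finite_W by simp
    then show ?thesis using nf.nf_zero[of N]
      by (intro exI[of _ q'] bexI[of _ "\<lambda>x. 0"])
  next
    case False
    then have "(\<lambda>x. q \<star> wa w ((T1 ^^ a) ((T2 ^^ b) x))) \<in> nf N"
      using nf_term by (intro nf.nf_term) auto
    moreover have "\<forall>x. q \<star> wa w ((T1 ^^ a) ((T2 ^^ b) x)) = symb N (\<lambda>w a. 0) x + q \<star> wa w ((T1 ^^ a) ((T2 ^^ b) x))"
      by (simp add: symb_def)
    ultimately show ?thesis
      by (intro exI[of _ "\<lambda>w a. 0"] bexI[of _ "\<lambda>x. q \<star> wa w ((T1 ^^ a) ((T2 ^^ b) x))"])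
  qed
qed

text \<open>On leading parts, the commutator with an invariant is a Poisson bracket: it
  differentiates the symbol in the Dunkl variables and the invariant in the coordinates. The
  coefficient at exponent \<open>a\<close> thus receives contributions from the exponents
  \<open>Suc a\<close> and \<open>a\<close>.\<close>

lemma symb_commutator:
  assumes "invariant h"
  shows "\<exists>g\<in>nf N. \<forall>x. symb (Suc N) q (h \<star> x) - h \<star> symb (Suc N) q x =
    symb N (\<lambda>w a. of_nat (Suc a) * q w (Suc a) * wact w (dderiv e1 h)
      + of_nat (Suc N - a) * q w a * wact w (dderiv e2 h)) x + g x"
proof -
  have "\<exists>g\<in>nf N. \<forall>x. (T1 ^^ a) ((T2 ^^ (Suc N - a)) (h \<star> x)) =
     h \<star> (T1 ^^ a) ((T2 ^^ (Suc N - a)) x) + (of_nat a * dderiv e1 h) \<star> (T1 ^^ (a - 1)) ((T2 ^^ (Suc N - a)) x)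
      + (of_nat (Suc N - a) * dderiv e2 h) \<star> (T1 ^^ a) ((T2 ^^ (Suc N - a - 1)) x) + g x" 
    if "a \<le> Suc N" for a
    using T_pow_act[OF assms, of a "Suc N - a"] that by simp
  then obtain g where g: "\<And>a. a \<le> Suc N \<Longrightarrow> g a \<in> nf N" "\<And>a x. a \<le> Suc N \<Longrightarrow> (T1 ^^ a) ((T2 ^^ (Suc N - a)) (h \<star> x)) =
     h \<star> (T1 ^^ a) ((T2 ^^ (Suc N - a)) x) + (of_nat a * dderiv e1 h) \<star> (T1 ^^ (a - 1)) ((T2 ^^ (Suc N - a)) x)
      + (of_nat (Suc N - a) * dderiv e2 h) \<star> (T1 ^^ a) ((T2 ^^ (Suc N - a - 1)) x) + g a x"
    by metis
  define G where "G = (\<lambda>x. \<Sum>w\<in>W. \<Sum>a\<le>Suc N. q w a \<star> wa w (g a x))"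
  have "G \<in> nf N" unfolding G_def
    by (intro nf_sum nf_act nf_wa g(1)) auto
  moreover have "symb (Suc N) q (h \<star> x) - h \<star> symb (Suc N) q x =
    symb N (\<lambda>w a. of_nat (Suc a) * q w (Suc a) * wact w (dderiv e1 h)
      + of_nat (Suc N - a) * q w a * wact w (dderiv e2 h)) x + G x" for x
  proof -
    let ?A = "\<lambda>w a. (of_nat a * q w a * wact w (dderiv e1 h)) \<star> wa w ((T1 ^^ (a - 1)) ((T2 ^^ (Suc N - a)) x))"
    let ?B = "\<lambda>w a. (of_nat (Suc N - a) * q w a * wact w (dderiv e2 h)) \<star> wa w ((T1 ^^ a) ((T2 ^^ (Suc N - a - 1)) x))"
    have nat: "wact w (of_nat n) = of_nat n" for w n
      by (metis pconst_of_nat wact_const)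
    have inv: "w \<in> W \<Longrightarrow> wact w h = h" for w using assms by (simp add: invariant_def)
    have "symb (Suc N) q (h \<star> x) - h \<star> symb (Suc N) q x = 
       (\<Sum>w\<in>W. \<Sum>a\<le>Suc N. q w a \<star> wa w ((T1 ^^ a) ((T2 ^^ (Suc N - a)) (h \<star> x)))
          - h \<star> q w a \<star> wa w ((T1 ^^ a) ((T2 ^^ (Suc N - a)) x)))"
      unfolding symb_def by (simp only: scale_sum_right sum_subtractf)
    also have "\<dots> = (\<Sum>w\<in>W. \<Sum>a\<le>Suc N. ?A w a + ?B w a + q w a \<star> wa w (g a x))"
      by (intro sum.cong refl)
        (simp add: g(2) wa_add wa_act inv nat scale_right_distrib mult_ac del: of_nat_Suc of_nat_diff)
    also have "\<dots> = (\<Sum>w\<in>W. (\<Sum>a\<le>Suc N. ?A w a) + (\<Sum>a\<le>Suc N. ?B w a)) + G x"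
      by (simp only: sum.distrib G_def)
    also have "(\<Sum>w\<in>W. (\<Sum>a\<le>Suc N. ?A w a) + (\<Sum>a\<le>Suc N. ?B w a)) = 
      symb N (\<lambda>w a. of_nat (Suc a) * q w (Suc a) * wact w (dderiv e1 h)
      + of_nat (Suc N - a) * q w a * wact w (dderiv e2 h)) x"
      unfolding symb_def
    proof (intro sum.cong refl)
      fix w
      have "(\<Sum>a\<le>Suc N. ?A w a) = (\<Sum>a\<le>N. ?A w (Suc a))"
        by (subst sum.atMost_Suc_shift) simp
      moreover have "(\<Sum>a\<le>Suc N. ?B w a) = (\<Sum>a\<le>N. ?B w a)" by simp
      ultimately show "(\<Sum>a\<le>Suc N. ?A w a) + (\<Sum>a\<le>Suc N. ?B w a) = (\<Sum>a\<le>N.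
        (of_nat (Suc a) * q w (Suc a) * wact w (dderiv e1 h)
         + of_nat (Suc N - a) * q w a * wact w (dderiv e2 h)) \<star> wa w ((T1 ^^ a) ((T2 ^^ (N - a)) x)))"
        by (simp only: sum.distrib[symmetric] scale_left_distrib) (simp add: diff_commute)
    qed
    finally show ?thesis .
  qed
  ultimately show ?thesis by blast
qed

text \<open>The basic invariants of type B2; their gradients are linearly independent over the
  polynomials, which is used in \<open>pbw\<close>.\<close>

lemma invariant_quadratic: "invariant (X1\<^sup>2 + X2\<^sup>2)"
  and invariant_quartic: "invariant (X1\<^sup>2 * X2\<^sup>2)"
proof -
  have "wact w (X1\<^sup>2 + X2\<^sup>2) = X1\<^sup>2 + X2\<^sup>2 \<and> wact w (X1\<^sup>2 * X2\<^sup>2) = X1\<^sup>2 * X2\<^sup>2" if "w \<in> W" for w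
    using that
  proof (induction rule: W_induct')
    case one
    then show ?case by (simp add: wact_one)
  qed (simp_all only: wact_comp[symmetric] basic_refl_in_W, simp_all add: add.commute mult.commute)
  then show "invariant (X1\<^sup>2 + X2\<^sup>2)" "invariant (X1\<^sup>2 * X2\<^sup>2)"
    by (auto simp: invariant_def)
qed

text \<open>Induction on the order. Commuting a vanishing operator with an invariant gives a
  vanishing operator of lower order, hence a linear relation between neighbouring leading
  coefficients. Two invariants give two relations with nonzero determinant. Order zero is the linear
  independence of the group elements over the polynomials, which depends on the module and is
  therefore an assumption.\<close>

lemma pbw:
  assumes dedekind: "\<And>q. (\<And>x. (\<Sum>w\<in>W. q w \<star> wa w x) = 0) \<Longrightarrow> \<forall>w\<in>W. q w = 0"
  shows "f \<in> nf N \<Longrightarrow> (\<And>x. symb N q x + f x = 0) \<Longrightarrow> \<forall>w\<in>W. \<forall>a\<le>N. q w a = 0"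
proof (induction N arbitrary: f q)
  case 0
  then have "(\<Sum>w\<in>W. q w 0 \<star> wa w x) = 0" for x
    using 0(2)[of x] by (simp add: nf_zero_iff symb_def)
  then show ?case using dedekind[of "\<lambda>w. q w 0"] by simp
next
  case (Suc N)
  have rel: "of_nat (Suc a) * q w (Suc a) * wact w (dderiv e1 h)
      + of_nat (Suc N - a) * q w a * wact w (dderiv e2 h) = 0" 
    if inv: "invariant h" and wa: "w \<in> W" "a \<le> N" for h w a
  proof -
    obtain g where g: "g \<in> nf N" "\<And>x. symb (Suc N) q (h \<star> x) - h \<star> symb (Suc N) q x =
      symb N (\<lambda>w a. of_nat (Suc a) * q w (Suc a) * wact w (dderiv e1 h)
      + of_nat (Suc N - a) * q w a * wact w (dderiv e2 h)) x + g x"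
      using symb_commutator[OF inv, of N q] by (elim bexE) simp
    have "(\<lambda>x. g x + (f (h \<star> x) - h \<star> f x)) \<in> nf N"
      using g(1) nf_commutator[OF inv Suc.prems(1)] by (intro nf_add) simp_all
    moreover have "symb N (\<lambda>w a. of_nat (Suc a) * q w (Suc a) * wact w (dderiv e1 h)
      + of_nat (Suc N - a) * q w a * wact w (dderiv e2 h)) x + (g x + (f (h \<star> x) - h \<star> f x)) = 0" for x
    proof -
      have "symb (Suc N) q y = - f y" for y using Suc.prems(2)[of y] by (simp add: eq_neg_iff_add_eq_0)
      then show ?thesis using g(2)[of x] by (simp add: algebra_simps)
    qed
    ultimately show ?thesis using Suc.IH wa by blast
  qed
  have pair: "q w (Suc a) = 0 \<and> q w a = 0" if "w \<in> W" "a \<le> N" for w a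
  proof -
    define x where "x = wact w X1"
    define y where "y = wact w X2"
    define A where "A = of_nat (Suc a) * q w (Suc a)"
    define B where "B = of_nat (Suc N - a) * q w a"
    have two: "wact w 2 = 2" by (metis pconst_numeral wact_const)
    have inj: "wact w p = 0 \<Longrightarrow> p = 0" for p
      using wact_comp[OF transpose_in_W[OF that(1)] that(1), of p] W_orthogonal[OF that(1)]
      by (simp add: wact_one)
    \<comment> \<open>Up to a constant this product of the positive roots is the Jacobian of the two
      invariants; it stays nonzero after applying the automorphism \<open>w\<close>.\<close>
    have "X1 * X2 * (X1 - X2) * (X1 + X2) \<noteq> 0"
      using X_indep[of 1 1] X_indep[of 1 "-1"] by (simp add: pconst_minus)
    then have nz: "x * y * (x - y) * (x + y) \<noteq> 0"
      using inj[of "X1 * X2 * (X1 - X2) * (X1 + X2)"] by (auto simp: x_def y_def)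
    have "A * (2 * x) + B * (2 * y) = 0"
      using rel[OF invariant_quadratic that] 
      by (simp add: A_def B_def x_def y_def dderiv_add dderiv_mult power2_eq_square e_entries mult_2[symmetric] two
           del: of_nat_Suc of_nat_diff)
    then have 1: "A * x + B * y = 0"
      by (metis (no_types, opaque_lifting) distrib_left mult.left_commute mult_eq_0_iff zero_neq_numeral)
    have "A * (2 * x * y\<^sup>2) + B * (2 * y * x\<^sup>2) = 0"
      using rel[OF invariant_quartic that] 
      by (simp add: A_def B_def x_def y_def dderiv_mult power2_eq_square e_entries mult_2[symmetric] two mult_ac
           del: of_nat_Suc of_nat_diff)
    then have "2 * (A * x * y\<^sup>2 + B * y * x\<^sup>2) = 0"
      by (simp add: algebra_simps)
    then have 2: "A * x * y\<^sup>2 + B * y * x\<^sup>2 = 0" by (simp only: mult_eq_0_iff zero_neq_numeral[symmetric]) simp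
    \<comment> \<open>Subtracting \<open>y^2\<close> times the first relation eliminates
      \<open>A\<close>.\<close>
    have "B * (y * (x - y) * (x + y)) = (A * x * y\<^sup>2 + B * y * x\<^sup>2) - y\<^sup>2 * (A * x + B * y)"
      by (simp add: algebra_simps power2_eq_square)
    then have B: "B = 0" unfolding 1 2 using nz by simp
    then have "A = 0" using 1 nz by simp
    then show ?thesis using B that(2) unfolding A_def B_def by (simp del: of_nat_Suc of_nat_diff)
  qed
  show ?case
  proof (intro ballI allI impI)
    fix w a assume "w \<in> W" "a \<le> Suc N"
    \<comment> \<open>The top exponent \<open>Suc N\<close> is reached as the successor in the pair
      at \<open>N\<close>.\<close>
    then show "q w a = 0" using pair[of w a] pair[of w "a - 1"] by (cases "a \<le> N") (auto simp: le_Suc_eq)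
  qed
qed

end

section \<open>Standard modules\<close>

definition vconst :: "complex^'n \<Rightarrow> pol^'n" where
  "vconst v = (\<chi> i. pconst (v $ i))"

lemma vconst_nth [simp]: "vconst v $ i = pconst (v $ i)"
  by (simp add: vconst_def)

lemma vconst_eq_iff [simp]: "vconst v = vconst u \<longleftrightarrow> v = u"
  by (simp add: vec_eq_iff)

lemma vconst_add: "vconst (u + v) = vconst u + vconst v"
  and vconst_0 [simp]: "vconst 0 = 0"
  and vconst_scale: "pconst c *s vconst v = vconst (c *s v)"
  by (simp_all add: vec_eq_iff pconst_add pconst_mult)

text \<open>The diagonal action on polynomials tensored with the space of
  \<open>\<rho>\<close>.\<close>

definition wact_vec :: "(complex^2^2 \<Rightarrow> complex^'n^'n) \<Rightarrow> complex^2^2 \<Rightarrow> pol^'n \<Rightarrow> pol^'n" where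
  "wact_vec \<rho> w F = (\<chi> i. \<Sum>j\<in>UNIV. pconst (\<rho> w $ i $ j) * wact w (F $ j))"

text \<open>The formula forced by the relations: moving a Dunkl operator past \<open>p\<close> in
  the tensor of \<open>p\<close> and \<open>v\<close>, where it kills \<open>v\<close>, leaves the
  derivative of \<open>p\<close> and divided differences whose reflections act on \<open>v\<close>
  through \<open>\<rho>\<close>.\<close>

definition dunkl_vec ::
    "(complex^2 \<Rightarrow> complex) \<Rightarrow> (complex^2^2 \<Rightarrow> complex^'n^'n) \<Rightarrow> complex^2 \<Rightarrow> pol^'n \<Rightarrow> pol^'n" where
  "dunkl_vec k \<rho> y F = (\<chi> i. dderiv y (F $ i) + (\<Sum>\<alpha>\<in>pos_roots. pconst (k \<alpha> * pairing \<alpha> y) *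
      (\<Sum>j\<in>UNIV. pconst (\<rho> (reflection \<alpha>) $ i $ j) * divdiff \<alpha> (F $ j))))"

locale dunkl_multiplicity =
  fixes k :: "complex^2 \<Rightarrow> complex" and k1 k2 :: complex
  assumes k_values: "k e1 = k1" "k e2 = k1" "k (e1 + e2) = k2" "k (e1 - e2) = k2"

locale dunkl_rep = dunkl_multiplicity +
  fixes \<rho> :: "complex^2^2 \<Rightarrow> complex^'n^'n"
  assumes rep_one: "\<rho> (mat 1) = mat 1"
    and rep_mult: "u \<in> W \<Longrightarrow> w \<in> W \<Longrightarrow> \<rho> (u ** w) = \<rho> u ** \<rho> w"

lemma (in dunkl_multiplicity) pol_cherednik_module:
  "cherednik_module (*) k1 k2 wact (dunkl k e1) (dunkl k e2) (range pconst)"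
proof
  fix P :: "pol \<Rightarrow> bool" and x
  assume "\<And>v. v \<in> range pconst \<Longrightarrow> P v" "\<And>x. P x \<Longrightarrow> P (X1 * x)" "\<And>x. P x \<Longrightarrow> P (X2 * x)"
    "\<And>x y. P x \<Longrightarrow> P y \<Longrightarrow> P (x + y)"
  then show "P x" by (induction x rule: pol_induct) auto
next
  fix v c assume "v \<in> range pconst"
  then show "pconst c * v \<in> range pconst" by (auto simp flip: pconst_mult)
next
  show "0 \<in> range pconst" by (rule range_eqI[of _ _ 0]) simp
next
  fix v assume "v \<in> range pconst"
  then have "dunkl k y v = 0" for y
    by (auto simp: dunkl_eq divdiff_const)
  then show "dunkl k e1 v = 0" "dunkl k e2 v = 0" by blast+
next
  fix x show "dunkl k e1 (X1 * x) = X1 * dunkl k e1 x + x + pconst (2 * k1) * wact s1 x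
      + pconst k2 * (wact sp x + wact sm x)"
    by (simp add: dunkl_eq dderiv_mult sum_pos_roots divdiff_mult k_values e_entries pconst_mult pconst_numeral)
      (simp add: algebra_simps)
next
  fix x show "dunkl k e1 (X2 * x) = X2 * dunkl k e1 x + pconst k2 * (wact sp x - wact sm x)"
    by (simp add: dunkl_eq dderiv_mult sum_pos_roots divdiff_mult k_values e_entries pconst_mult pconst_numeral)
      (simp add: algebra_simps)
next
  fix x show "dunkl k e2 (X1 * x) = X1 * dunkl k e2 x + pconst k2 * (wact sp x - wact sm x)"
    by (simp add: dunkl_eq dderiv_mult sum_pos_roots divdiff_mult k_values e_entries pconst_mult pconst_minus pconst_numeral)
      (simp add: algebra_simps)
next
  fix x show "dunkl k e2 (X2 * x) = X2 * dunkl k e2 x + x + pconst (2 * k1) * wact s2 x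
      + pconst k2 * (wact sp x + wact sm x)"
    by (simp add: dunkl_eq dderiv_mult sum_pos_roots divdiff_mult k_values e_entries pconst_mult pconst_minus pconst_numeral)
      (simp add: algebra_simps)
next
  fix x y
  have "dunkl k z (x + y) = dunkl k z x + dunkl k z y" for z
    by (simp add: dunkl_eq dderiv_add divdiff_add distrib_left sum.distrib)
  then show "dunkl k e1 (x + y) = dunkl k e1 x + dunkl k e1 y" "dunkl k e2 (x + y) = dunkl k e2 x + dunkl k e2 y"
    by blast+
next
  fix w v assume "v \<in> range pconst"
  then show "wact w v \<in> range pconst" by auto
qed (simp_all add: wact_comp wact_one algebra_simps)

lemma (in dunkl_rep) vec_cherednik_module:
  "cherednik_module (*s) k1 k2 (wact_vec \<rho>) (dunkl_vec k \<rho> e1) (dunkl_vec k \<rho> e2) (range vconst)"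
proof
  fix P :: "pol^'n \<Rightarrow> bool" and F
  assume base: "\<And>v. v \<in> range vconst \<Longrightarrow> P v" and hX1: "\<And>x. P x \<Longrightarrow> P (X1 *s x)"
    and hX2: "\<And>x. P x \<Longrightarrow> P (X2 *s x)" and hadd: "\<And>x y. P x \<Longrightarrow> P y \<Longrightarrow> P (x + y)"
  have "P (p *s vconst v)" for p v
  proof (induction p rule: pol_induct)
    case (const c)
    then show ?case by (simp add: vconst_scale base)
  next
    case (X1 p)
    then show ?case using hX1[of "p *s vconst v"] X1 by (simp add: vector_smult_assoc)
  next
    case (X2 p)
    then show ?case using hX2[of "p *s vconst v"] X2 by (simp add: vector_smult_assoc)
  next
    case (add p q)
    then show ?case using hadd by (simp add: vector_sadd_rdistrib)
  qed
  then have *: "P (F $ j *s vconst (axis j 1))" for j by blast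
  have "P (\<Sum>j\<in>A. F $ j *s vconst (axis j 1))" for A :: "'n set"
  proof (induction A rule: infinite_finite_induct)
    case (insert j A)
    then show ?case using * hadd by simp
  qed (use base[OF rangeI[of vconst 0]] in simp_all)
  moreover have "(\<Sum>j\<in>UNIV. F $ j *s vconst (axis j 1)) = F"
    by (simp add: vec_eq_iff axis_def if_distrib cong: if_cong)
  ultimately show "P F" by metis
next
  fix u w :: "complex^2^2" and F assume uw: "u \<in> W" "w \<in> W"
  show "wact_vec \<rho> u (wact_vec \<rho> w F) = wact_vec \<rho> (u ** w) F"
  proof (rule iffD2[OF vec_eq_iff], rule allI)
    fix i
    have "wact_vec \<rho> u (wact_vec \<rho> w F) $ i
      = (\<Sum>j\<in>UNIV. \<Sum>l\<in>UNIV. pconst (\<rho> u $ i $ j * \<rho> w $ j $ l) * wact (u ** w) (F $ l))"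
      by (simp add: wact_vec_def wact_sum sum_distrib_left wact_comp uw pconst_mult mult.assoc)
    also have "\<dots> = (\<Sum>l\<in>UNIV. \<Sum>j\<in>UNIV. pconst (\<rho> u $ i $ j * \<rho> w $ j $ l) * wact (u ** w) (F $ l))"
      by (rule sum.swap)
    also have "\<dots> = (\<Sum>l\<in>UNIV. pconst (\<rho> (u ** w) $ i $ l) * wact (u ** w) (F $ l))"
      unfolding rep_mult[OF uw] by (simp add: matrix_matrix_mult_def[of "\<rho> u"] pconst_sum sum_distrib_right)
    also have "\<dots> = wact_vec \<rho> (u ** w) F $ i"
      by (simp add: wact_vec_def)
    finally show "wact_vec \<rho> u (wact_vec \<rho> w F) $ i = wact_vec \<rho> (u ** w) F $ i" .
  qed
next
  fix v w assume "v \<in> range (vconst :: complex^'n \<Rightarrow> _)"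
  then obtain u :: "complex^'n" where v: "v = vconst u" by blast
  have "wact_vec \<rho> w v = vconst (\<rho> w *v u)"
    by (simp add: v vec_eq_iff wact_vec_def matrix_vector_mult_def pconst_sum pconst_mult)
  then show "wact_vec \<rho> w v \<in> range vconst" by simp
next
  fix F show "wact_vec \<rho> (mat 1) F = F"
    by (simp add: vec_eq_iff wact_vec_def rep_one wact_one)
      (simp add: mat_def if_distrib[of pconst] if_distrib[of "\<lambda>x. x * _"] cong: if_cong)
next
  fix F show "dunkl_vec k \<rho> e1 (X1 *s F) = X1 *s dunkl_vec k \<rho> e1 F + F
     + pconst (2 * k1) *s wact_vec \<rho> s1 F + pconst k2 *s (wact_vec \<rho> sp F + wact_vec \<rho> sm F)"
    by (simp add: vec_eq_iff wact_vec_def dunkl_vec_def dderiv_mult sum_pos_roots divdiff_mult k_values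
       e_entries pconst_mult pconst_numeral distrib_left sum.distrib sum_distrib_left) (simp add: mult_ac add_ac)
next
  fix F show "dunkl_vec k \<rho> e1 (X2 *s F) = X2 *s dunkl_vec k \<rho> e1 F
     + pconst k2 *s (wact_vec \<rho> sp F - wact_vec \<rho> sm F)"
    by (simp add: vec_eq_iff wact_vec_def dunkl_vec_def dderiv_mult sum_pos_roots divdiff_mult k_values
       e_entries pconst_mult pconst_numeral distrib_left right_diff_distrib sum.distrib sum_subtractf sum_negf
       sum_distrib_left) (simp add: mult_ac add_ac)
next
  fix F show "dunkl_vec k \<rho> e2 (X1 *s F) = X1 *s dunkl_vec k \<rho> e2 F
     + pconst k2 *s (wact_vec \<rho> sp F - wact_vec \<rho> sm F)"
    by (simp add: vec_eq_iff wact_vec_def dunkl_vec_def dderiv_mult sum_pos_roots divdiff_mult k_values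
       e_entries pconst_mult pconst_numeral pconst_minus distrib_left right_diff_distrib sum.distrib sum_subtractf sum_negf
       sum_distrib_left) (simp add: mult_ac add_ac)
next
  fix F show "dunkl_vec k \<rho> e2 (X2 *s F) = X2 *s dunkl_vec k \<rho> e2 F + F
     + pconst (2 * k1) *s wact_vec \<rho> s2 F + pconst k2 *s (wact_vec \<rho> sp F + wact_vec \<rho> sm F)"
    by (simp add: vec_eq_iff wact_vec_def dunkl_vec_def dderiv_mult sum_pos_roots divdiff_mult k_values
       e_entries pconst_mult pconst_numeral pconst_minus distrib_left right_diff_distrib sum.distrib sum_subtractf sum_negf
       sum_distrib_left) (simp add: mult_ac add_ac)
next
  fix w p F assume "w \<in> W"
  show "wact_vec \<rho> w (p *s F) = wact w p *s wact_vec \<rho> w F"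
    by (simp add: vec_eq_iff wact_vec_def sum_distrib_left mult.left_commute)
next
  fix w F G show "wact_vec \<rho> w (F + G) = wact_vec \<rho> w F + wact_vec \<rho> w G"
    by (simp add: vec_eq_iff wact_vec_def distrib_left sum.distrib)
next
  fix F G
  have "dunkl_vec k \<rho> y (F + G) = dunkl_vec k \<rho> y F + dunkl_vec k \<rho> y G" for y
    by (simp add: vec_eq_iff dunkl_vec_def dderiv_add divdiff_add distrib_left sum.distrib)
  then show "dunkl_vec k \<rho> e1 (F + G) = dunkl_vec k \<rho> e1 F + dunkl_vec k \<rho> e1 G"
    "dunkl_vec k \<rho> e2 (F + G) = dunkl_vec k \<rho> e2 F + dunkl_vec k \<rho> e2 G" by blast+
next
  fix v assume "v \<in> range (vconst :: complex^'n \<Rightarrow> _)"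
  then have "dunkl_vec k \<rho> y v = 0" for y
    by (auto simp: vec_eq_iff dunkl_vec_def divdiff_const)
  then show "dunkl_vec k \<rho> e1 v = 0" "dunkl_vec k \<rho> e2 v = 0" by blast+
next
  show "0 \<in> range vconst" by (rule range_eqI[of _ _ 0]) simp
next
  fix v c assume "v \<in> range (vconst :: complex^'n \<Rightarrow> _)"
  then show "pconst c *s v \<in> range vconst" by (auto simp: vconst_scale)
qed (simp_all add: vec_eq_iff algebra_simps)

text \<open>A single operator on the product records how one expression in the generators acts on
  both factors, so its action on the first can be compared with its action on the second.\<close>

lemma cherednik_module_prod:
  assumes "cherednik_module a k1 k2 wa T1 T2 V" "cherednik_module a' k1 k2 wa' T1' T2' V'"
  shows "cherednik_module (\<lambda>p. map_prod (a p) (a' p)) k1 k2 (\<lambda>w. map_prod (wa w) (wa' w))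
    (map_prod T1 T1') (map_prod T2 T2') (V \<times> V')"
proof -
  interpret A: cherednik_module a k1 k2 wa T1 T2 V by fact
  interpret B: cherednik_module a' k1 k2 wa' T1' T2' V' by fact
  show ?thesis
  proof
    fix P and x :: "'a \<times> 'b"
    assume base: "\<And>v. v \<in> V \<times> V' \<Longrightarrow> P v" and X1: "\<And>x. P x \<Longrightarrow> P (map_prod (a X1) (a' X1) x)"
      and X2: "\<And>x. P x \<Longrightarrow> P (map_prod (a X2) (a' X2) x)" and add: "\<And>x y. P x \<Longrightarrow> P y \<Longrightarrow> P (x + y)"
    have "P (y, 0)" for y
    proof (induction y rule: A.m_induct)
      case (X1 y)
      then show ?case using \<open>P (y, 0) \<Longrightarrow> P (map_prod (a X1) (a' X1) (y, 0))\<close> by simp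
    next
      case (X2 y)
      then show ?case using \<open>P (y, 0) \<Longrightarrow> P (map_prod (a X2) (a' X2) (y, 0))\<close> by simp
    next
      case (add y z)
      then show ?case using \<open>P (y, 0) \<Longrightarrow> P (z, 0) \<Longrightarrow> P ((y, 0) + (z, 0))\<close> by simp
    qed (simp add: base B.V0_zero)
    moreover have "P (0, y)" for y
    proof (induction y rule: B.m_induct)
      case (X1 y)
      then show ?case using \<open>P (0, y) \<Longrightarrow> P (map_prod (a X1) (a' X1) (0, y))\<close> by simp
    next
      case (X2 y)
      then show ?case using \<open>P (0, y) \<Longrightarrow> P (map_prod (a X2) (a' X2) (0, y))\<close> by simp
    next
      case (add y z)
      then show ?case using \<open>P (0, y) \<Longrightarrow> P (0, z) \<Longrightarrow> P ((0, y) + (0, z))\<close> by simp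
    qed (simp add: base A.V0_zero)
    ultimately have "P ((fst x, 0) + (0, snd x))" using add by blast
    then show "P x" by simp
  qed (simp_all add: split_paired_all A.scale_right_distrib A.scale_left_distrib B.scale_right_distrib B.scale_left_distrib
     A.wa_add B.wa_add A.wa_act B.wa_act A.wa_wa B.wa_wa A.T1_add A.T2_add B.T1_add B.T2_add
     A.T1_X1 B.T1_X1 A.T1_X2 B.T1_X2 A.T2_X1 B.T2_X1 A.T2_X2 B.T2_X2 A.T_V0 B.T_V0 A.V0_zero B.V0_zero
     A.V0_wa B.V0_wa A.V0_const B.V0_const zero_prod_def)
qed

text \<open>Dedekind's independence of automorphisms: substituting \<open>p * x\<close> and
  subtracting \<open>wact u p\<close> times the relation removes the term of
  \<open>u\<close>.\<close>

lemma dedekind_wact: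
  assumes "finite A" "A \<subseteq> W" "\<And>x. (\<Sum>w\<in>A. q w * wact w x) = 0"
  shows "\<forall>w\<in>A. q w = 0"
  using assms
proof (induction A arbitrary: q rule: finite_induct)
  case (insert u B)
  have B: "q v = 0" if v: "v \<in> B" for v
  proof -
    have "v \<noteq> u" "v \<in> W" "u \<in> W" using v insert by auto
    \<comment> \<open>Distinct matrices already differ on \<open>X1\<close> or
      \<open>X2\<close>.\<close>
    have "\<exists>p. wact v p \<noteq> wact u p"
    proof (rule ccontr)
      assume "\<not> ?thesis"
      then have "wact v X1 - wact u X1 = 0" "wact v X2 - wact u X2 = 0" by simp_all
      moreover have "wact v X1 - wact u X1 = pconst (v$1$1 - u$1$1) * X1 + pconst (v$2$1 - u$2$1) * X2"
        "wact v X2 - wact u X2 = pconst (v$1$2 - u$1$2) * X1 + pconst (v$2$2 - u$2$2) * X2"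
        using \<open>v \<in> W\<close> \<open>u \<in> W\<close> by (simp_all add: wact_X1 wact_X2 pconst_diff algebra_simps)
      ultimately have "v = u" by (simp add: X_indep mat_eq_iff2)
      with \<open>v \<noteq> u\<close> show False by simp
    qed
    then obtain p where p: "wact v p \<noteq> wact u p" by blast
    have "(\<Sum>w\<in>B. q w * (wact w p - wact u p) * wact w x) = 0" for x
    proof -
      have "0 = (\<Sum>w\<in>insert u B. q w * wact w (p * x)) - wact u p * (\<Sum>w\<in>insert u B. q w * wact w x)"
        by (simp only: insert.prems) simp
      also have "\<dots> = (\<Sum>w\<in>insert u B. q w * (wact w p - wact u p) * wact w x)"
        by (simp only: sum_distrib_left sum_subtractf[symmetric]) (simp add: algebra_simps)
      finally show ?thesis using insert.hyps by simp
    qed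
    then have "q v * (wact v p - wact u p) = 0"
      using insert.IH[of "\<lambda>w. q w * (wact w p - wact u p)"] insert.prems(1) v by auto
    then show ?thesis using p by simp
  qed
  then have "q u = 0" using insert.prems(2)[of 1] insert.hyps by simp
  then show ?case using B by simp
qed simp

section \<open>Transfer of operator identities from polynomials to standard modules\<close>

lemma map_prod_pow:
  fixes f :: "'a \<Rightarrow> 'a" and g :: "'b \<Rightarrow> 'b"
  shows "(map_prod f g ^^ n) (x, y) = ((f ^^ n) x, (g ^^ n) y)"
  by (induction n) simp_all

context dunkl_rep
begin

sublocale P: cherednik_module "(*)" k1 k2 wact "dunkl k e1" "dunkl k e2" "range pconst"
  by (rule pol_cherednik_module)

sublocale V: cherednik_module "(*s)" k1 k2 "wact_vec \<rho>" "dunkl_vec k \<rho> e1" "dunkl_vec k \<rho> e2" "range vconst"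
  by (rule vec_cherednik_module)

sublocale PV: cherednik_module "\<lambda>p. map_prod ((*) p) ((*s) p)" k1 k2 "\<lambda>w. map_prod (wact w) (wact_vec \<rho> w)"
  "map_prod (dunkl k e1) (dunkl_vec k \<rho> e1)" "map_prod (dunkl k e2) (dunkl_vec k \<rho> e2)" "range pconst \<times> range vconst"
  by (rule cherednik_module_prod) unfold_locales

lemma PV_nf_fst: "h \<in> PV.nf N \<Longrightarrow> \<exists>f\<in>P.nf N. \<forall>x y. fst (h (x, y)) = f x"
proof (induction rule: PV.nf.induct)
  case nf_zero
  then show ?case by (auto intro!: bexI[of _ "\<lambda>x. 0"] P.nf_zero)
next
  case (nf_add f g)
  then obtain f' g' where "f' \<in> P.nf N" "g' \<in> P.nf N" "\<forall>x y. fst (f (x, y)) = f' x" "\<forall>x y. fst (g (x, y)) = g' x"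
    by blast
  then show ?case using P.nf_add[of f' N g'] by (intro bexI[of _ "\<lambda>x. f' x + g' x"]) auto
next
  case (nf_term w a b q)
  then show ?case using P.nf_term[of w a b N q]
    by (intro bexI[of _ "\<lambda>x. q * wact w ((dunkl k e1 ^^ a) ((dunkl k e2 ^^ b) x))"]) (auto simp: map_prod_pow)
qed

lemma PV_symb_fst: "fst (PV.symb N q (x, y)) = P.symb N q x"
  by (simp add: PV.symb_def P.symb_def fst_sum map_prod_pow)

text \<open>An operator of the Cherednik algebra that vanishes on polynomials also vanishes on every
  standard module, since the coefficients of its normal form vanish.\<close>

lemma PV_faithful:
  assumes "h \<in> PV.alg" "\<And>x y. fst (h (x, y)) = 0"
  shows "h z = 0"
proof -
  obtain N where "h \<in> PV.nf N" using PV.alg_nf[OF assms(1)] by blast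
  then show ?thesis using assms(2)
  proof (induction N arbitrary: h)
    case 0
    then show ?case by (simp add: PV.nf_zero_iff)
  next
    case (Suc N)
    obtain q g where g: "g \<in> PV.nf N" "\<forall>x. h x = PV.symb N q x + g x"
      using PV.nf_Suc_decomp[OF Suc.prems(1)] by blast
    obtain f where f: "f \<in> P.nf N" "\<And>x y. fst (g (x, y)) = f x" using PV_nf_fst[OF g(1)] by blast
    have zero: "P.symb N q x + f x = 0" for x
      using Suc.prems(2)[of x 0] g(2) f(2)[of x 0] PV_symb_fst[of N q x 0] by simp
    have "\<forall>w\<in>W. \<forall>a\<le>N. q w a = 0"
      by (rule P.pbw[OF _ f(1) zero]) (rule dedekind_wact[OF finite_W subset_refl])
    then have "PV.symb N q x = 0" for x by (simp add: PV.symb_def)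
    then have "h = g" using g(2) by auto
    then show ?case using Suc.IH Suc.prems(2) g(1) by blast
  qed
qed

text \<open>The graph of the action on the standard module: \<open>f\<close> and \<open>g\<close>
  are the components of one operator generated on pairs. It is introduced as a relation because only
  \<open>corr_unique\<close> makes \<open>g\<close> depend on \<open>f\<close> alone.\<close>

definition corr :: "(pol \<Rightarrow> pol) \<Rightarrow> (pol^'n \<Rightarrow> pol^'n) \<Rightarrow> bool" where
  "corr f g \<longleftrightarrow> map_prod f g \<in> PV.alg"

lemma corr_unique: assumes "corr f g" "corr f g'" shows "g = g'"
proof
  fix F
  have "(\<lambda>z. map_prod f g z + (map_prod ((*) (- 1)) ((*s) (- 1)) \<circ> map_prod f g') z) \<in> PV.alg"
    using assms by (intro PV.alg.intros) (auto simp: corr_def)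
  from PV_faithful[OF this, of "(0, F)"] show "g F = g' F"
    by (simp add: zero_prod_def)
qed

lemma corr_add: "corr f g \<Longrightarrow> corr f' g' \<Longrightarrow> corr (\<lambda>p. f p + f' p) (\<lambda>F. g F + g' F)"
proof -
  have "map_prod (\<lambda>p. f p + f' p) (\<lambda>F. g F + g' F) = (\<lambda>z. map_prod f g z + map_prod f' g' z)" by auto
  then show "corr f g \<Longrightarrow> corr f' g' \<Longrightarrow> corr (\<lambda>p. f p + f' p) (\<lambda>F. g F + g' F)"
    by (simp add: corr_def PV.alg_add)
qed

lemma corr_comp: "corr f g \<Longrightarrow> corr f' g' \<Longrightarrow> corr (f \<circ> f') (g \<circ> g')"
  using PV.alg_comp[of "map_prod f g" "map_prod f' g'"] by (simp add: corr_def map_prod_compose)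

lemma corr_mult: "corr ((*) p) ((*s) p)"
  using PV.alg_act[of p] by (simp add: corr_def map_prod_def)

lemma corr_scal: "corr (scal c) ((*s) (pconst c))"
  using corr_mult[of "pconst c"] by (simp add: scal_eq[abs_def])

lemma corr_wact: "w \<in> W \<Longrightarrow> corr (wact w) (wact_vec \<rho> w)"
  using PV.alg_wa[of w] by (simp add: corr_def)

lemma dunkl_e: "dunkl k y p = pconst (y $ 1) * dunkl k e1 p + pconst (y $ 2) * dunkl k e2 p"
  unfolding dunkl_eq sum_pos_roots pairing_values dderiv_e[of y p] k_values e_entries
  by (simp add: pconst_add pconst_diff pconst_minus pconst_mult distrib_left ring_distribs)

lemma corr_dunkl: "corr (dunkl k y) (\<lambda>F. pconst (y $ 1) *s dunkl_vec k \<rho> e1 F + pconst (y $ 2) *s dunkl_vec k \<rho> e2 F)"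
proof -
  have "corr (dunkl k e1) (dunkl_vec k \<rho> e1)" "corr (dunkl k e2) (dunkl_vec k \<rho> e2)"
    by (simp_all add: corr_def PV.alg.intros)
  then have "corr (\<lambda>p. ((*) (pconst (y $ 1)) \<circ> dunkl k e1) p + ((*) (pconst (y $ 2)) \<circ> dunkl k e2) p)
    (\<lambda>F. ((*s) (pconst (y $ 1)) \<circ> dunkl_vec k \<rho> e1) F + ((*s) (pconst (y $ 2)) \<circ> dunkl_vec k \<rho> e2) F)"
    by (intro corr_add corr_comp corr_mult)
  then show ?thesis by (simp only: o_def dunkl_e[of y, symmetric])
qed

end

section \<open>Stable subspaces and the grading\<close>

lemma sum_lessThan_add: "sum f {..<m + n} = sum f {..<m} + (\<Sum>i<n. f (m + i))"
  for f :: "nat \<Rightarrow> 'a::comm_monoid_add"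
  by (induction n) (simp_all add: add.assoc)

text \<open>Elimination of one coordinate at a time: the induction hypothesis is applied to two
  disjoint blocks of indices, and the two dependences are combined so that the new coordinate
  cancels. Cross-multiplication avoids division.\<close>

lemma linear_dependence:
  assumes "finite S"
  shows "\<exists>(n::nat) a. (\<exists>m<n. a m \<noteq> 0) \<and> (\<forall>s\<in>S. (\<Sum>m<n. a m * c m s) = (0 :: 'a::idom))"
  using assms
proof (induction S arbitrary: c rule: finite_induct)
  case empty
  show ?case by (intro exI[of _ "1 :: nat"] exI[of _ "\<lambda>_::nat. 1::'a"]) auto
next
  case (insert s S)
  obtain n a where a: "\<exists>m<n. a m \<noteq> 0" "\<forall>s\<in>S. (\<Sum>m<n. a m * c m s) = 0"
    using insert.IH by blast
  obtain n' a' where a': "\<exists>m<n'. a' m \<noteq> 0" "\<forall>s\<in>S. (\<Sum>m<n'. a' m * c (n + m) s) = 0"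
    using insert.IH[of "\<lambda>m. c (n + m)"] by blast
  define \<alpha> where "\<alpha> = (\<Sum>m<n. a m * c m s)"
  define \<alpha>' where "\<alpha>' = (\<Sum>m<n'. a' m * c (n + m) s)"
  show ?case
  proof (cases "\<alpha> = 0")
    case True
    then show ?thesis using a by (auto simp: \<alpha>_def)
  next
    case False
    \<comment> \<open>The second block enters with factor \<open>- \<alpha>\<close>, which is
      nonzero here, so the combination remains nontrivial.\<close>
    define b where "b = (\<lambda>m. if m < n then \<alpha>' * a m else - \<alpha> * a' (m - n))"
    have sum_b: "(\<Sum>m<n + n'. b m * c m t) = \<alpha>' * (\<Sum>m<n. a m * c m t) - \<alpha> * (\<Sum>m<n'. a' m * c (n + m) t)" for t
      unfolding sum_lessThan_add by (simp add: b_def sum_distrib_left sum_negf mult.assoc)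
    obtain m where "m < n'" "a' m \<noteq> 0" using a' by blast
    then have "n + m < n + n'" "b (n + m) \<noteq> 0" using False by (simp_all add: b_def)
    moreover have "\<forall>t\<in>insert s S. (\<Sum>m<n + n'. b m * c m t) = 0"
      using a(2) a'(2) by (auto simp: sum_b simp flip: \<alpha>_def \<alpha>'_def)
    ultimately show ?thesis by blast
  qed
qed

context cherednik_module
begin

definition stable :: "'m set \<Rightarrow> bool" where
  "stable N \<longleftrightarrow> 0 \<in> N \<and> (\<forall>x\<in>N. \<forall>y\<in>N. x + y \<in> N) \<and> (\<forall>p. \<forall>x\<in>N. p \<star> x \<in> N) \<and>
     (\<forall>w\<in>W. \<forall>x\<in>N. wa w x \<in> N) \<and> (\<forall>x\<in>N. T1 x \<in> N \<and> T2 x \<in> N)"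

lemma stableD:
  assumes "stable N"
  shows "0 \<in> N" "x \<in> N \<Longrightarrow> y \<in> N \<Longrightarrow> x + y \<in> N" "x \<in> N \<Longrightarrow> p \<star> x \<in> N"
    "w \<in> W \<Longrightarrow> x \<in> N \<Longrightarrow> wa w x \<in> N" "x \<in> N \<Longrightarrow> T1 x \<in> N" "x \<in> N \<Longrightarrow> T2 x \<in> N"
  using assms by (auto simp: stable_def)

lemma stable_minus: "stable N \<Longrightarrow> x \<in> N \<Longrightarrow> - x \<in> N"
  using stableD(3)[of N x "- 1"] by simp

lemma stable_diff: "stable N \<Longrightarrow> x \<in> N \<Longrightarrow> y \<in> N \<Longrightarrow> x - y \<in> N"
  using stableD(2)[of N x "- y"] stable_minus[of N y] by simp

lemma stable_sum: "stable N \<Longrightarrow> (\<And>i. i \<in> A \<Longrightarrow> f i \<in> N) \<Longrightarrow> sum f A \<in> N"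
  by (induction A rule: infinite_finite_induct) (auto simp: stableD)

lemma stable_zero: "stable {0}"
  by (simp add: stable_def)

text \<open>Finite spanning modulo \<open>N\<close> is the form in which \<open>finite_dim\<close>
  of a quotient appears after lifting.\<close>

definition finite_codim :: "'m set \<Rightarrow> bool" where
  "finite_codim N \<longleftrightarrow> (\<exists>S. finite S \<and> (\<forall>x. \<exists>c. x - (\<Sum>s\<in>S. pconst (c s) \<star> s) \<in> N))"

lemma finite_codim_mono:
  assumes "finite_codim N" "N \<subseteq> N'"
  shows "finite_codim N'"
proof -
  obtain S where S: "finite S" "\<forall>x. \<exists>c. x - (\<Sum>s\<in>S. pconst (c s) \<star> s) \<in> N"
    using assms(1) unfolding finite_codim_def by (elim exE conjE)
  have "\<exists>c. x - (\<Sum>s\<in>S. pconst (c s) \<star> s) \<in> N'" for x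
    using S(2)[rule_format, of x] assms(2) by (elim exE) (rule exI, erule subsetD)
  with S(1) show ?thesis unfolding finite_codim_def by (intro exI[of _ S] conjI allI)
qed

lemma finite_codim_dependence:
  fixes F :: "nat \<Rightarrow> 'm"
  assumes "stable N" "finite_codim N"
  shows "\<exists>n a. (\<exists>m<n. a m \<noteq> 0) \<and> (\<Sum>m<n. pconst (a m) \<star> F m) \<in> N"
proof -
  obtain S where S: "finite S" "\<And>x. \<exists>c. x - (\<Sum>s\<in>S. pconst (c s) \<star> s) \<in> N"
    using assms(2) unfolding finite_codim_def by blast
  have "\<forall>m. \<exists>c. F m - (\<Sum>s\<in>S. pconst (c s) \<star> s) \<in> N" using S(2) by simp
  from choice[OF this] obtain c where c: "\<And>m. F m - (\<Sum>s\<in>S. pconst (c m s) \<star> s) \<in> N" by blast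
  obtain n a where a: "\<exists>m<n. a m \<noteq> 0" "\<forall>s\<in>S. (\<Sum>m<n. a m * c m s) = 0"
    using linear_dependence[OF S(1), of c] by blast
  have "(\<Sum>m<n. pconst (a m) \<star> (\<Sum>s\<in>S. pconst (c m s) \<star> s)) = (\<Sum>m<n. \<Sum>s\<in>S. pconst (a m * c m s) \<star> s)"
    by (simp add: scale_sum_right pconst_mult)
  also have "\<dots> = (\<Sum>s\<in>S. \<Sum>m<n. pconst (a m * c m s) \<star> s)" by (rule sum.swap)
  also have "\<dots> = (\<Sum>s\<in>S. pconst (\<Sum>m<n. a m * c m s) \<star> s)"
    by (simp add: pconst_sum scale_sum_left)
  also have "\<dots> = 0" using a(2) by simp
  finally have "(\<Sum>m<n. pconst (a m) \<star> (F m - (\<Sum>s\<in>S. pconst (c m s) \<star> s))) = (\<Sum>m<n. pconst (a m) \<star> F m)"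
    by (simp add: scale_right_diff_distrib sum_subtractf)
  moreover have "(\<Sum>m<n. pconst (a m) \<star> (F m - (\<Sum>s\<in>S. pconst (c m s) \<star> s))) \<in> N"
    by (intro stable_sum stableD(3) assms(1) c)
  ultimately have "(\<Sum>m<n. pconst (a m) \<star> F m) \<in> N" by (simp only:)
  then show ?thesis using a(1) by blast
qed

end

text \<open>The scalar \<open>c\<close> is the value on \<open>V0\<close> of the sum of all
  reflections weighted by the multiplicities, a central element of the group algebra;
  \<open>c0\<close> is the projection to degree zero. Irreducibility is phrased by closure
  properties, so that it can be applied directly to a stable subspace.\<close>

locale graded_cherednik_module = cherednik_module act k1 k2 wa T1 T2 V0
  for act :: "pol \<Rightarrow> 'm::ab_group_add \<Rightarrow> 'm" (infixr \<open>\<star>\<close> 75) and k1 k2 wa T1 T2 and V0 :: "'m set" +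
  fixes c :: complex and c0 :: "'m \<Rightarrow> 'm"
  assumes central_scalar: "v \<in> V0 \<Longrightarrow>
      pconst k1 \<star> (wa s1 v + wa s2 v) + pconst k2 \<star> (wa sp v + wa sm v) = pconst c \<star> v"
    and V0_add: "u \<in> V0 \<Longrightarrow> v \<in> V0 \<Longrightarrow> u + v \<in> V0"
    and c0_add: "c0 (x + y) = c0 x + c0 y"
    and c0_V0: "v \<in> V0 \<Longrightarrow> c0 v = v"
    and c0_X1: "c0 (X1 \<star> x) = 0" and c0_X2: "c0 (X2 \<star> x) = 0"
    and V0_irreducible: "\<And>v N. v \<in> V0 \<Longrightarrow> v \<noteq> 0 \<Longrightarrow> v \<in> N \<Longrightarrow> (\<And>x y. x \<in> N \<Longrightarrow> y \<in> N \<Longrightarrow> x + y \<in> N) \<Longrightarrow>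
      (\<And>a x. x \<in> N \<Longrightarrow> pconst a \<star> x \<in> N) \<Longrightarrow> (\<And>w x. w \<in> W \<Longrightarrow> x \<in> N \<Longrightarrow> wa w x \<in> N) \<Longrightarrow> V0 \<subseteq> N"
    and V0_nontrivial: "\<exists>v\<in>V0. v \<noteq> 0"
begin

text \<open>The Euler element of the Cherednik algebra, shifted by \<open>c\<close> so that it
  vanishes on \<open>V0\<close>. It acts as the degree although its formula uses only operators
  preserving stable subspaces.\<close>

definition euler :: "'m \<Rightarrow> 'm" where
  "euler x = X1 \<star> T1 x + X2 \<star> T2 x + pconst k1 \<star> (wa s1 x + wa s2 x) + pconst k2 \<star> (wa sp x + wa sm x)
     - pconst c \<star> x"

lemma euler_add: "euler (x + y) = euler x + euler y"
  unfolding euler_def T1_add T2_add wa_add scale_right_distrib by (simp add: algebra_simps)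

lemma euler_V0: assumes "v \<in> V0" shows "euler v = 0"
proof -
  have "euler v = (pconst k1 \<star> (wa s1 v + wa s2 v) + pconst k2 \<star> (wa sp v + wa sm v)) - pconst c \<star> v"
    unfolding euler_def T_V0(1)[OF assms] T_V0(2)[OF assms] scale_zero_right add_0_left by (rule refl)
  then show ?thesis unfolding central_scalar[OF assms] diff_self .
qed

lemma double_scale: "pconst (2 * a) \<star> x = pconst a \<star> x + pconst a \<star> x"
  "pconst (a * 2) \<star> x = pconst a \<star> x + pconst a \<star> x"
  unfolding mult_2 mult_2_right pconst_add scale_left_distrib by (rule refl)+

lemma euler_X1: "euler (X1 \<star> x) = X1 \<star> euler x + X1 \<star> x"
  by (simp add: euler_def T_simps wa_simps double_scale algebra_simps)

lemma euler_X2: "euler (X2 \<star> x) = X2 \<star> euler x + X2 \<star> x"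
  by (simp add: euler_def T_simps wa_simps double_scale algebra_simps)

lemma euler_const: "euler (pconst a \<star> x) = pconst a \<star> euler x"
  by (simp add: euler_def T1_const T2_const wa_const scale_right_distrib scale_right_diff_distrib mult_ac)

lemma euler_0 [simp]: "euler 0 = 0"
  by (rule euler_V0[OF V0_zero])

lemma euler_sum: "euler (sum f A) = (\<Sum>i\<in>A. euler (f i))"
  by (induction A rule: infinite_finite_induct) (simp_all add: euler_add)

lemma euler_quadratic: "euler ((X1\<^sup>2 + X2\<^sup>2) \<star> x) = (X1\<^sup>2 + X2\<^sup>2) \<star> euler x + 2 \<star> (X1\<^sup>2 + X2\<^sup>2) \<star> x"
proof -
  have u: "(X1\<^sup>2 + X2\<^sup>2) \<star> y = X1 \<star> X1 \<star> y + X2 \<star> X2 \<star> y" for y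
    by (simp add: scale_left_distrib power2_eq_square)
  have two: "2 \<star> y = y + y" for y using scale_left_distrib[of 1 1 y] by simp
  have "euler ((X1\<^sup>2 + X2\<^sup>2) \<star> x) = X1 \<star> X1 \<star> euler x + X1 \<star> X1 \<star> x + X1 \<star> X1 \<star> x
      + (X2 \<star> X2 \<star> euler x + X2 \<star> X2 \<star> x + X2 \<star> X2 \<star> x)"
    by (simp only: u euler_add euler_X1 euler_X2 scale_right_distrib)
  then show ?thesis by (simp only: u two add_ac)
qed

lemma euler_quadratic_pow:
  assumes "v \<in> V0"
  shows "euler ((X1\<^sup>2 + X2\<^sup>2) ^ m \<star> v) = pconst (2 * of_nat m) \<star> (X1\<^sup>2 + X2\<^sup>2) ^ m \<star> v"
proof (induction m)
  case 0
  then show ?case by (simp add: euler_V0 assms)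
next
  case (Suc m)
  let ?u = "X1\<^sup>2 + X2\<^sup>2"
  have "?u ^ Suc m \<star> v = ?u \<star> ?u ^ m \<star> v" by simp
  then have "euler (?u ^ Suc m \<star> v) = ?u \<star> pconst (2 * of_nat m) \<star> ?u ^ m \<star> v + 2 \<star> ?u \<star> ?u ^ m \<star> v"
    by (simp only: euler_quadratic Suc)
  also have "\<dots> = (pconst (2 * of_nat (Suc m)) * ?u ^ Suc m) \<star> v"
    unfolding scale_scale scale_left_distrib[symmetric]
    by (rule arg_cong[where f = "\<lambda>p. p \<star> v"]) (simp add: pconst_add pconst_mult pconst_numeral algebra_simps)
  finally show ?case by simp
qed

lemma stable_euler: "stable N \<Longrightarrow> x \<in> N \<Longrightarrow> euler x \<in> N"
  unfolding euler_def by (intro stable_diff stableD(2) stableD(3)) (auto intro: stableD)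

lemma c0_const: "c0 (pconst a \<star> x) = pconst a \<star> c0 x"
proof (induction x rule: m_induct)
  case (base v)
  then show ?case by (simp add: c0_V0 V0_const)
next
  case (X1 x)
  have *: "pconst a \<star> X1 \<star> x = X1 \<star> pconst a \<star> x" by (simp add: mult.commute)
  show ?case unfolding * c0_X1 by simp
next
  case (X2 x)
  have *: "pconst a \<star> X2 \<star> x = X2 \<star> pconst a \<star> x" by (simp add: mult.commute)
  show ?case unfolding * c0_X2 by simp
next
  case (add x y)
  then show ?case by (simp add: c0_add scale_right_distrib)
qed

lemma c0_0 [simp]: "c0 0 = 0"
  using c0_V0[OF V0_zero] .

lemma c0_minus: "c0 (- x) = - c0 x"
  using c0_add[of "- x" x] by (simp add: eq_neg_iff_add_eq_0)

lemma c0_diff: "c0 (x - y) = c0 x - c0 y"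
  by (simp only: diff_conv_add_uminus c0_add c0_minus)

lemma c0_in_V0: "c0 x \<in> V0"
  by (induction x rule: m_induct) (simp_all add: c0_V0 c0_X1 c0_X2 c0_add V0_zero V0_add)

lemma c0_euler: "c0 (euler x) = 0"
  by (induction x rule: m_induct) (simp_all add: euler_V0 euler_X1 euler_X2 euler_add c0_add c0_X1 c0_X2)

text \<open>A filtration by degree built from the generators alone, since the abstract module
  carries no grading of its own.\<close>

primrec deg_le :: "nat \<Rightarrow> 'm set" where
  "deg_le 0 = V0"
| "deg_le (Suc d) = {v + X1 \<star> y + X2 \<star> z | v y z. v \<in> V0 \<and> y \<in> deg_le d \<and> z \<in> deg_le d}"

lemma deg_leI: "v \<in> V0 \<Longrightarrow> y \<in> deg_le d \<Longrightarrow> z \<in> deg_le d \<Longrightarrow> v + X1 \<star> y + X2 \<star> z \<in> deg_le (Suc d)"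
  by auto

lemma zero_deg_le: "0 \<in> deg_le d"
proof (induction d)
  case (Suc d)
  then show ?case using deg_leI[OF V0_zero Suc Suc] by (simp del: deg_le.simps)
qed (simp add: V0_zero)

lemma deg_le_Suc: "x \<in> deg_le d \<Longrightarrow> x \<in> deg_le (Suc d)"
proof (induction d arbitrary: x)
  case 0
  then show ?case using deg_leI[of x 0 0 0] V0_zero by (simp del: deg_le.simps(2))
next
  case (Suc d)
  from Suc.prems obtain v y z where "x = v + X1 \<star> y + X2 \<star> z" "v \<in> V0" "y \<in> deg_le d" "z \<in> deg_le d" by auto
  then show ?case using deg_leI Suc.IH by metis
qed

lemma deg_le_mono: "x \<in> deg_le d \<Longrightarrow> d \<le> e \<Longrightarrow> x \<in> deg_le e"
proof (induction e)
  case (Suc e)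
  then show ?case using deg_le_Suc[of x e] by (cases "d = Suc e") auto
qed auto

lemma deg_le_add: "x \<in> deg_le d \<Longrightarrow> y \<in> deg_le d \<Longrightarrow> x + y \<in> deg_le d"
proof (induction d arbitrary: x y)
  case 0
  then show ?case by (simp add: V0_add)
next
  case (Suc d)
  from Suc.prems obtain v p q v' p' q' where "x = v + X1 \<star> p + X2 \<star> q" "v \<in> V0" "p \<in> deg_le d" "q \<in> deg_le d"
     "y = v' + X1 \<star> p' + X2 \<star> q'" "v' \<in> V0" "p' \<in> deg_le d" "q' \<in> deg_le d" by auto
  then show ?case using deg_leI[of "v + v'" "p + p'" d "q + q'"] Suc.IH
    by (simp add: V0_add scale_right_distrib add_ac del: deg_le.simps)
qed

lemma in_deg_le: "\<exists>d. x \<in> deg_le d"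
proof (induction x rule: m_induct)
  case (base v)
  then show ?case by (auto intro: exI[of _ 0])
next
  case (X1 x)
  then obtain d where "x \<in> deg_le d" by blast
  then show ?case using deg_leI[OF V0_zero, of x d 0] zero_deg_le by (auto intro: exI[of _ "Suc d"] simp del: deg_le.simps)
next
  case (X2 x)
  then obtain d where "x \<in> deg_le d" by blast
  then show ?case using deg_leI[OF V0_zero, of 0 d x] zero_deg_le by (auto intro: exI[of _ "Suc d"] simp del: deg_le.simps)
next
  case (add x y)
  then obtain d e where "x \<in> deg_le d" "y \<in> deg_le e" by blast
  then have "x \<in> deg_le (max d e)" "y \<in> deg_le (max d e)" by (auto elim: deg_le_mono)
  then show ?case using deg_le_add by blast
qed

lemma euler_deg_le: "x \<in> deg_le (Suc d) \<Longrightarrow> euler x - pconst (of_nat (Suc d)) \<star> x \<in> deg_le d"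
proof (induction d arbitrary: x)
  case 0
  then obtain v y z where "x = v + X1 \<star> y + X2 \<star> z" "v \<in> V0" "y \<in> V0" "z \<in> V0" by auto
  then show ?case using V0_const[of v "- 1"]
    by (simp add: euler_add euler_V0 euler_X1 euler_X2 pconst_minus)
next
  case (Suc d)
  obtain v y z where x: "x = v + X1 \<star> y + X2 \<star> z" "v \<in> V0" "y \<in> deg_le (Suc d)" "z \<in> deg_le (Suc d)"
    using Suc.prems unfolding deg_le.simps(2)[of "Suc d"] by blast
  define t where "t = pconst (of_nat (Suc d))"
  have t: "pconst (of_nat (Suc (Suc d))) = t + 1" "pconst (- of_nat (Suc (Suc d))) = - (t + 1)"
    by (simp_all add: t_def pconst_minus pconst_add pconst_diff pconst_numeral)
  \<comment> \<open>Passing \<open>X1\<close> or \<open>X2\<close> raises the Euler eigenvalue by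
    one, so subtracting \<open>t + 1\<close> outside amounts to subtracting \<open>t\<close>
    inside.\<close>
  have "- (t + 1) \<star> v + X1 \<star> (euler y - t \<star> y) + X2 \<star> (euler z - t \<star> z) \<in> deg_le (Suc d)"
  proof (rule deg_leI)
    show "- (t + 1) \<star> v \<in> V0" unfolding t(2)[symmetric] by (rule V0_const[OF x(2)])
    show "euler y - t \<star> y \<in> deg_le d" "euler z - t \<star> z \<in> deg_le d"
      unfolding t_def by (rule Suc.IH[OF x(3)], rule Suc.IH[OF x(4)])
  qed
  also have "- (t + 1) \<star> v + X1 \<star> (euler y - t \<star> y) + X2 \<star> (euler z - t \<star> z)
      = euler x - (t + 1) \<star> x"
    unfolding x(1) euler_add euler_X1 euler_X2 euler_V0[OF x(2)]
    by (simp add: scale_left_distrib scale_left_diff_distrib scale_right_distrib scale_right_diff_distrib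
        scale_minus_left distrib_left mult_ac)
  finally show ?case unfolding t .
qed

text \<open>Applying \<open>euler - d\<close>, ..., \<open>euler - 1\<close> in turn strips off all
  positive degrees and multiplies the degree-zero part by a nonzero integer; each step is divided
  out at once.\<close>

lemma stable_c0:
  assumes "stable N"
  shows "x \<in> deg_le d \<Longrightarrow> x \<in> N \<Longrightarrow> c0 x \<in> N"
proof (induction d arbitrary: x)
  case 0
  then show ?case by (simp add: c0_V0)
next
  case (Suc d)
  let ?y = "euler x - pconst (of_nat (Suc d)) \<star> x"
  have "c0 ?y \<in> N"
    using Suc by (intro Suc.IH euler_deg_le stable_diff stable_euler stableD(3) assms) auto
  then have "pconst (- inverse (of_nat (Suc d))) \<star> c0 ?y \<in> N" by (rule stableD(3)[OF assms])
  also have "pconst (- inverse (of_nat (Suc d))) \<star> c0 ?y = (pconst (inverse (of_nat (Suc d))) * pconst (of_nat (Suc d))) \<star> c0 x"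
    by (simp add: c0_diff c0_euler c0_const pconst_minus del: of_nat_Suc)
  also have "\<dots> = c0 x" by (simp flip: pconst_mult del: of_nat_Suc)
  finally show ?case .
qed

text \<open>A nonzero component in degree zero would belong to the subspace, hence so would all of
  \<open>V0\<close> by irreducibility, and \<open>V0\<close> generates. Together with
  \<open>c0_proper\<close> this characterises properness by a condition that passes to sums.\<close>

lemma proper_c0:
  assumes "stable N" "N \<noteq> UNIV" "x \<in> N"
  shows "c0 x = 0"
proof (rule ccontr)
  assume nz: "c0 x \<noteq> 0"
  have "c0 x \<in> N" using stable_c0[OF assms(1) _ assms(3)] in_deg_le by blast
  then have V0: "V0 \<subseteq> N"
    by (rule V0_irreducible[OF c0_in_V0 nz]) (auto intro: stableD[OF assms(1)])
  have "y \<in> N" for y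
    by (induction y rule: m_induct) (use V0 in \<open>auto intro: stableD[OF assms(1)]\<close>)
  then show False using assms(2) by blast
qed

lemma c0_proper:
  assumes "\<And>x. x \<in> N \<Longrightarrow> c0 x = 0"
  shows "N \<noteq> UNIV"
proof
  assume "N = UNIV"
  obtain v where v: "v \<in> V0" "v \<noteq> 0" using V0_nontrivial by (elim bexE)
  then show False using assms[of v] c0_V0[OF v(1)] \<open>N = UNIV\<close> by simp
qed

section \<open>The largest proper stable subspace\<close>

definition max_stable :: "'m set" where
  "max_stable = \<Union>{N. stable N \<and> N \<noteq> UNIV}"

lemma max_stable_ge: "stable N \<Longrightarrow> N \<noteq> UNIV \<Longrightarrow> N \<subseteq> max_stable"
  by (auto simp: max_stable_def)

lemma max_stable_proper: "max_stable \<noteq> UNIV"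
  by (rule c0_proper) (auto simp: max_stable_def intro: proper_c0)

text \<open>The union is closed under addition because the sum of two proper stable subspaces is
  again killed by \<open>c0\<close> and hence proper.\<close>

lemma stable_max_stable: "stable max_stable"
proof -
  have add: "x + y \<in> max_stable" if xy: "x \<in> max_stable" "y \<in> max_stable" for x y
  proof -
    obtain N M where NM: "stable N" "N \<noteq> UNIV" "x \<in> N" "stable M" "M \<noteq> UNIV" "y \<in> M"
      using xy unfolding max_stable_def by blast
    define K where "K = {a + b | a b. a \<in> N \<and> b \<in> M}"
    have KI: "a + b \<in> K" if "a \<in> N" "b \<in> M" for a b using that by (auto simp: K_def)
    have closed: "f x \<in> K" if x: "x \<in> K" and f: "\<And>a b. f (a + b) = f a + f b"
        "\<And>a. a \<in> N \<Longrightarrow> f a \<in> N" "\<And>b. b \<in> M \<Longrightarrow> f b \<in> M" for f x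
    proof -
      obtain a b where "x = a + b" "a \<in> N" "b \<in> M" using x unfolding K_def by blast
      then show ?thesis using f KI by metis
    qed
    have "0 \<in> K" using KI[of 0 0] NM stableD(1) by simp
    moreover have "x + y \<in> K" if xy: "x \<in> K" "y \<in> K" for x y
    proof -
      obtain a b a' b' where "x = a + b" "y = a' + b'" "a \<in> N" "a' \<in> N" "b \<in> M" "b' \<in> M" 
        using xy unfolding K_def by blast
      then show ?thesis using KI[of "a + a'" "b + b'"] NM(1,4) stableD(2) by (simp add: add_ac)
    qed
    ultimately have "stable K" unfolding stable_def
      by (intro conjI ballI allI) (blast, blast, (erule closed;
        use NM(1,4) in \<open>simp add: stableD scale_right_distrib wa_add T1_add T2_add\<close>)+)
    moreover have "K \<noteq> UNIV"
    proof (rule c0_proper)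
      fix x assume "x \<in> K"
      then obtain a b where "x = a + b" "a \<in> N" "b \<in> M" unfolding K_def by blast
      then show "c0 x = 0" using NM proper_c0 by (simp add: c0_add)
    qed
    ultimately show ?thesis using KI[of x y] NM max_stable_ge by blast
  qed
  have "{0} \<subseteq> max_stable"
    by (rule max_stable_ge[OF stable_zero]) (rule c0_proper, simp)
  then have zero: "0 \<in> max_stable" by simp
  have closed: "f x \<in> max_stable" if x: "x \<in> max_stable" and f: "\<And>N. stable N \<Longrightarrow> x \<in> N \<Longrightarrow> f x \<in> N" for f x
    using x f unfolding max_stable_def by blast
  show ?thesis
    unfolding stable_def using add zero
    by (intro conjI ballI allI) (blast, blast, (erule closed; simp add: stableD)+)
qed

section \<open>Powers of the quadratic invariant in subspaces of finite codimension\<close>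

lemma scale_commutator: "pconst a \<star> pconst b \<star> y - pconst d \<star> pconst a \<star> y = pconst (a * (b - d)) \<star> y"
  unfolding scale_scale scale_left_diff_distrib[symmetric]
  by (rule arg_cong[where f = "\<lambda>p. p \<star> y"]) (simp add: pconst_mult pconst_diff algebra_simps)

text \<open>The summands are Euler eigenvectors with the distinct eigenvalues \<open>2 * m\<close>.
  Applying \<open>euler - 2 * n\<close> removes the last one and multiplies the others by nonzero
  numbers.\<close>

lemma eigen_separation:
  assumes "stable N" "v \<in> V0"
  shows "(\<Sum>m<n. pconst (a m) \<star> (X1\<^sup>2 + X2\<^sup>2) ^ m \<star> v) \<in> N \<Longrightarrow>
    \<forall>m<n. pconst (a m) \<star> (X1\<^sup>2 + X2\<^sup>2) ^ m \<star> v \<in> N"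
proof (induction n arbitrary: a)
  case (Suc n)
  let ?F = "\<lambda>m. (X1\<^sup>2 + X2\<^sup>2) ^ m \<star> v"
  let ?x = "\<Sum>m<Suc n. pconst (a m) \<star> ?F m"
  let ?b = "\<lambda>m. a m * (2 * of_nat m - 2 * of_nat n)"
  have "euler ?x - pconst (2 * of_nat n) \<star> ?x \<in> N"
    using assms(1) Suc.prems by (intro stable_diff stable_euler stableD(3))
  also have "euler ?x - pconst (2 * of_nat n) \<star> ?x = (\<Sum>m<Suc n. pconst (?b m) \<star> ?F m)"
    unfolding euler_sum scale_sum_right sum_subtractf[symmetric]
    by (intro sum.cong refl) (simp only: euler_const euler_quadratic_pow[OF assms(2)] scale_commutator)
  finally have "(\<Sum>m<n. pconst (?b m) \<star> ?F m) \<in> N" by simp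
  then have b: "pconst (?b m) \<star> ?F m \<in> N" if "m < n" for m using Suc.IH[of ?b] that by blast
  have lt: "pconst (a m) \<star> ?F m \<in> N" if "m < n" for m
  proof -
    define e where "e = 2 * of_nat m - 2 * (of_nat n :: complex)"
    have "pconst (1 / e) \<star> pconst (a m * e) \<star> ?F m \<in> N"
      using b[OF that] unfolding e_def by (rule stableD(3)[OF assms(1)])
    also have "pconst (1 / e) \<star> pconst (a m * e) \<star> ?F m = pconst (a m) \<star> ?F m"
      using that unfolding scale_scale[of "pconst (1 / e)" "pconst (a m * e)"] pconst_mult[symmetric]
      by (simp add: e_def)
    finally show ?thesis .
  qed
  have "?x - (\<Sum>m<n. pconst (a m) \<star> ?F m) \<in> N"
    using lt by (intro stable_diff[OF assms(1) Suc.prems] stable_sum[OF assms(1)]) simp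
  also have "?x - (\<Sum>m<n. pconst (a m) \<star> ?F m) = pconst (a n) \<star> ?F n"
    by (simp only: sum.lessThan_Suc add_diff_cancel_left')
  finally have "pconst (a n) \<star> ?F n \<in> N" .
  then show ?case using lt by (auto simp only: less_Suc_eq)
qed simp

text \<open>Finite codimension forces a nontrivial combination of the powers into \<open>N\<close>,
  and the Euler eigenvalues isolate one of them.\<close>

lemma finite_codim_quadratic_pow:
  assumes "stable N" "finite_codim N" "v \<in> V0"
  shows "\<exists>m. (X1\<^sup>2 + X2\<^sup>2) ^ m \<star> v \<in> N"
proof -
  obtain n a where "\<exists>m<n. a m \<noteq> 0" and sum: "(\<Sum>m<n. pconst (a m) \<star> (X1\<^sup>2 + X2\<^sup>2) ^ m \<star> v) \<in> N"
    using finite_codim_dependence[OF assms(1,2), of "\<lambda>m. (X1\<^sup>2 + X2\<^sup>2) ^ m \<star> v"] by blast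
  then obtain m where "m < n" "a m \<noteq> 0" by blast
  then have "pconst (a m) \<star> (X1\<^sup>2 + X2\<^sup>2) ^ m \<star> v \<in> N"
    using eigen_separation[OF assms(1,3) sum] by blast
  then have "pconst (1 / a m) \<star> pconst (a m) \<star> (X1\<^sup>2 + X2\<^sup>2) ^ m \<star> v \<in> N"
    by (rule stableD(3)[OF assms(1)])
  also have "pconst (1 / a m) \<star> pconst (a m) \<star> (X1\<^sup>2 + X2\<^sup>2) ^ m \<star> v = (X1\<^sup>2 + X2\<^sup>2) ^ m \<star> v"
    using \<open>a m \<noteq> 0\<close> unfolding scale_scale[of "pconst (1 / a m)" "pconst (a m)"] pconst_mult[symmetric] by simp
  finally show ?thesis by (rule exI)
qed

end

section \<open>Presentations of modules\<close>

text \<open>\<open>presents M C act Z \<pi>\<close>: the module \<open>M\<close>, with scalars from \<open>C\<close>, is the quotient of a type by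
  the subgroup \<open>Z\<close>. In this form iterated quotients by \<open>quot_module\<close> remain quotients of one and
  the same type.\<close>

definition presents ::
    "('r, 'm) module \<Rightarrow> 'r set \<Rightarrow> ('r \<Rightarrow> 'v \<Rightarrow> 'v) \<Rightarrow> 'v set \<Rightarrow> ('v::ab_group_add \<Rightarrow> 'm) \<Rightarrow> bool" where
  "presents M C act Z \<pi> \<longleftrightarrow> carrier M = range \<pi> \<and> (\<forall>x y. \<pi> x = \<pi> y \<longleftrightarrow> x - y \<in> Z) \<and>
     (\<forall>x y. \<pi> x \<oplus>\<^bsub>M\<^esub> \<pi> y = \<pi> (x + y)) \<and> \<zero>\<^bsub>M\<^esub> = \<pi> 0 \<and> (\<forall>r\<in>C. \<forall>x. r \<odot>\<^bsub>M\<^esub> \<pi> x = \<pi> (act r x))"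

definition closed_subgroup :: "'r set \<Rightarrow> ('r \<Rightarrow> 'v \<Rightarrow> 'v) \<Rightarrow> 'v::ab_group_add set \<Rightarrow> bool" where
  "closed_subgroup C act N \<longleftrightarrow>
     0 \<in> N \<and> (\<forall>x\<in>N. \<forall>y\<in>N. x - y \<in> N) \<and> (\<forall>r\<in>C. \<forall>x\<in>N. act r x \<in> N)"

lemma closed_subgroupD:
  assumes "closed_subgroup C act N"
  shows "0 \<in> N" "x \<in> N \<Longrightarrow> y \<in> N \<Longrightarrow> x - y \<in> N" "r \<in> C \<Longrightarrow> x \<in> N \<Longrightarrow> act r x \<in> N"
    "x \<in> N \<Longrightarrow> - x \<in> N" "x \<in> N \<Longrightarrow> y \<in> N \<Longrightarrow> x + y \<in> N"
proof -
  show 0: "0 \<in> N" and diff: "x \<in> N \<Longrightarrow> y \<in> N \<Longrightarrow> x - y \<in> N" for x y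
    using assms by (auto simp: closed_subgroup_def)
  show "r \<in> C \<Longrightarrow> x \<in> N \<Longrightarrow> act r x \<in> N" using assms by (auto simp: closed_subgroup_def)
  show minus: "x \<in> N \<Longrightarrow> - x \<in> N" for x using diff[OF 0, of x] by simp
  show "x \<in> N \<Longrightarrow> y \<in> N \<Longrightarrow> x + y \<in> N" using diff[of x "- y"] minus[of y] by simp
qed

context
  fixes M :: "('r, 'm) module" and C :: "'r set" and act :: "'r \<Rightarrow> 'v::ab_group_add \<Rightarrow> 'v"
    and Z :: "'v set" and \<pi> :: "'v \<Rightarrow> 'm"
  assumes presents: "presents M C act Z \<pi>"
begin

lemma presents_simps:
  "carrier M = range \<pi>" "\<pi> x = \<pi> y \<longleftrightarrow> x - y \<in> Z" "\<pi> x \<oplus>\<^bsub>M\<^esub> \<pi> y = \<pi> (x + y)" "\<zero>\<^bsub>M\<^esub> = \<pi> 0"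
  "r \<in> C \<Longrightarrow> r \<odot>\<^bsub>M\<^esub> \<pi> x = \<pi> (act r x)"
  using presents by (simp_all add: presents_def)

lemma presents_abelian_group: "abelian_group M"
proof (rule abelian_groupI)
  fix x assume "x \<in> carrier M"
  then obtain a where "x = \<pi> a" by (auto simp: presents_simps(1))
  then have "\<pi> (- a) \<in> carrier M" "\<pi> (- a) \<oplus>\<^bsub>M\<^esub> x = \<zero>\<^bsub>M\<^esub>"
    by (simp_all add: presents_simps(1,3,4))
  then show "\<exists>y\<in>carrier M. y \<oplus>\<^bsub>M\<^esub> x = \<zero>\<^bsub>M\<^esub>" by blast
qed (auto simp: presents_simps(1,3,4) add_ac)

lemma presents_minus: "\<ominus>\<^bsub>M\<^esub> \<pi> x = \<pi> (- x)"
proof -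
  interpret abelian_group M by (rule presents_abelian_group)
  show ?thesis by (rule minus_equality) (simp_all add: presents_simps(1,3,4))
qed

lemma presents_submodule:
  assumes "carrier R = C" "submodule N R M"
  shows "\<exists>N'. Z \<subseteq> N' \<and> closed_subgroup C act N' \<and> N = \<pi> ` N'"
proof (intro exI[of _ "{x. \<pi> x \<in> N}"] conjI)
  interpret abelian_group M by (rule presents_abelian_group)
  interpret submodule N R M by fact
  have zero: "\<pi> 0 \<in> N" using one_closed by (simp add: presents_simps)
  show "Z \<subseteq> {x. \<pi> x \<in> N}"
  proof
    fix z assume "z \<in> Z"
    then have "\<pi> z = \<pi> 0" by (simp add: presents_simps(2))
    then show "z \<in> {x. \<pi> x \<in> N}" using zero by simp
  qed
  have "\<pi> (x - y) \<in> N" if "\<pi> x \<in> N" "\<pi> y \<in> N" for x y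
  proof -
    have "\<ominus>\<^bsub>M\<^esub> \<pi> y \<in> N" using m_inv_closed[OF that(2)] by (simp add: a_inv_def)
    from m_closed[OF that(1) this] show ?thesis by (simp add: presents_minus presents_simps(3))
  qed
  moreover have "\<pi> (act r x) \<in> N" if "r \<in> C" "\<pi> x \<in> N" for r x
    using smult_closed[of r "\<pi> x"] that assms(1) by (simp add: presents_simps(5))
  ultimately show "closed_subgroup C act {x. \<pi> x \<in> N}"
    using zero by (simp add: closed_subgroup_def)
  show "N = \<pi> ` {x. \<pi> x \<in> N}"
    using subset by (auto simp: presents_simps(1))
qed

lemma presents_submoduleI:
  assumes "carrier R = C" "closed_subgroup C act N'"
  shows "submodule (\<pi> ` N') R M"
proof -
  interpret abelian_group M by (rule presents_abelian_group)
  have "subgroup (\<pi> ` N') (add_monoid M)"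
  proof
    fix x assume "x \<in> \<pi> ` N'"
    then show "inv\<^bsub>add_monoid M\<^esub> x \<in> \<pi> ` N'"
      using closed_subgroupD[OF assms(2)] by (auto simp: presents_minus simp flip: a_inv_def)
  qed (use closed_subgroupD[OF assms(2)] in \<open>auto simp: presents_simps(1,3,4)\<close>)
  moreover have "submodule_axioms (\<pi> ` N') R M"
    using closed_subgroupD(3)[OF assms(2)] assms(1) by unfold_locales (auto simp: presents_simps(5))
  ultimately show ?thesis by (simp add: submodule_def)
qed

lemma presents_finsum:
  assumes "finite S"
  shows "(\<Oplus>\<^bsub>M\<^esub>s\<in>S. \<pi> (f s)) = \<pi> (\<Sum>s\<in>S. f s)"
proof -
  interpret abelian_group M by (rule presents_abelian_group)
  show ?thesis using assms
  proof (induction S rule: finite_induct)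
    case empty
    then show ?case by (simp add: presents_simps(4))
  next
    case (insert s S)
    have "(\<lambda>s. \<pi> (f s)) \<in> S \<rightarrow> carrier M" "\<pi> (f s) \<in> carrier M" by (auto simp: presents_simps(1))
    with insert show ?case by (simp add: presents_simps(3))
  qed
qed

text \<open>Cosets of the image of \<open>N'\<close> correspond to classes of the source modulo
  \<open>N'\<close>, so the source type stays and only the kernel grows. Additivity of the action
  makes the union in \<open>quot_module\<close> range over equal cosets.\<close>

lemma presents_quot:
  assumes "Z \<subseteq> N'" "closed_subgroup C act N'"
    and act_add: "\<And>r x y. r \<in> C \<Longrightarrow> act r (x + y) = act r x + act r y"
  shows "presents (quot_module M (\<pi> ` N')) C act N' (\<lambda>x. (\<pi> ` N') +>\<^bsub>M\<^esub> \<pi> x)"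
proof -
  let ?N = "\<pi> ` N'"
  note N' = closed_subgroupD[OF assms(2)]
  have coset: "?N +>\<^bsub>M\<^esub> \<pi> x = \<pi> ` {n + x | n. n \<in> N'}" for x
    by (auto simp: a_r_coset_def' presents_simps(3))
  have mem: "\<pi> y \<in> ?N +>\<^bsub>M\<^esub> \<pi> x \<longleftrightarrow> y - x \<in> N'" for x y
  proof
    assume "\<pi> y \<in> ?N +>\<^bsub>M\<^esub> \<pi> x"
    then obtain n where "n \<in> N'" "y - (n + x) \<in> N'" using assms(1) by (auto simp: coset presents_simps(2))
    from N'(5)[OF this] show "y - x \<in> N'" by (simp add: algebra_simps)
  next
    assume "y - x \<in> N'"
    then show "\<pi> y \<in> ?N +>\<^bsub>M\<^esub> \<pi> x" unfolding coset by (intro imageI CollectI exI[of _ "y - x"]) simp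
  qed
  have eq: "?N +>\<^bsub>M\<^esub> \<pi> x = ?N +>\<^bsub>M\<^esub> \<pi> y \<longleftrightarrow> x - y \<in> N'" for x y
  proof
    assume "?N +>\<^bsub>M\<^esub> \<pi> x = ?N +>\<^bsub>M\<^esub> \<pi> y"
    then show "x - y \<in> N'" using mem[of x x] mem[of x y] N'(1) by simp
  next
    assume xy: "x - y \<in> N'"
    have "z - x \<in> N' \<longleftrightarrow> z - y \<in> N'" for z
      using N'(5)[OF xy, of "z - x"] N'(2)[OF _ xy, of "z - y"] by (auto simp: algebra_simps)
    then have mem_iff: "\<pi> z \<in> ?N +>\<^bsub>M\<^esub> \<pi> x \<longleftrightarrow> \<pi> z \<in> ?N +>\<^bsub>M\<^esub> \<pi> y" for z unfolding mem .
    have sub: "?N +>\<^bsub>M\<^esub> \<pi> x \<subseteq> range \<pi>" for x unfolding coset by (rule image_mono) simp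
    show "?N +>\<^bsub>M\<^esub> \<pi> x = ?N +>\<^bsub>M\<^esub> \<pi> y"
    proof (rule Set.set_eqI)
      fix u
      show "u \<in> ?N +>\<^bsub>M\<^esub> \<pi> x \<longleftrightarrow> u \<in> ?N +>\<^bsub>M\<^esub> \<pi> y"
      proof (cases "u \<in> range \<pi>")
        case True
        then obtain z where u: "u = \<pi> z" by (elim rangeE)
        show ?thesis unfolding u by (rule mem_iff)
      next
        case False
        then show ?thesis using sub[of x] sub[of y] by blast
      qed
    qed
  qed
  have "carrier (quot_module M ?N) = range (\<lambda>x. ?N +>\<^bsub>M\<^esub> \<pi> x)"
    by (auto simp: quot_module_def A_RCOSETS_def' presents_simps(1))
  moreover have "(?N +>\<^bsub>M\<^esub> \<pi> x) <+>\<^bsub>M\<^esub> (?N +>\<^bsub>M\<^esub> \<pi> y) = ?N +>\<^bsub>M\<^esub> \<pi> (x + y)" for x y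
  proof
    show "(?N +>\<^bsub>M\<^esub> \<pi> x) <+>\<^bsub>M\<^esub> (?N +>\<^bsub>M\<^esub> \<pi> y) \<subseteq> ?N +>\<^bsub>M\<^esub> \<pi> (x + y)"
    proof
      fix z assume "z \<in> (?N +>\<^bsub>M\<^esub> \<pi> x) <+>\<^bsub>M\<^esub> (?N +>\<^bsub>M\<^esub> \<pi> y)"
      then obtain n m where "n \<in> N'" "m \<in> N'" "z = \<pi> ((n + x) + (m + y))"
        unfolding set_add_def' coset by (auto simp: presents_simps(3))
      then show "z \<in> ?N +>\<^bsub>M\<^esub> \<pi> (x + y)" using N'(5) by (simp add: mem algebra_simps)
    qed
    show "?N +>\<^bsub>M\<^esub> \<pi> (x + y) \<subseteq> (?N +>\<^bsub>M\<^esub> \<pi> x) <+>\<^bsub>M\<^esub> (?N +>\<^bsub>M\<^esub> \<pi> y)"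
    proof
      fix z assume "z \<in> ?N +>\<^bsub>M\<^esub> \<pi> (x + y)"
      then obtain n where n: "n \<in> N'" "z = \<pi> (n + (x + y))" unfolding coset by auto
      then have "z = \<pi> (n + x) \<oplus>\<^bsub>M\<^esub> \<pi> y" by (simp add: presents_simps(3) add.assoc)
      moreover have "\<pi> (n + x) \<in> ?N +>\<^bsub>M\<^esub> \<pi> x" "\<pi> y \<in> ?N +>\<^bsub>M\<^esub> \<pi> y"
        using n N'(1) by (simp_all add: mem)
      ultimately show "z \<in> (?N +>\<^bsub>M\<^esub> \<pi> x) <+>\<^bsub>M\<^esub> (?N +>\<^bsub>M\<^esub> \<pi> y)"
        unfolding set_add_def' by blast
    qed
  qed
  moreover have "?N = ?N +>\<^bsub>M\<^esub> \<pi> 0" by (simp add: coset)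
  moreover have "(\<Union>z\<in>?N +>\<^bsub>M\<^esub> \<pi> x. ?N +>\<^bsub>M\<^esub> (r \<odot>\<^bsub>M\<^esub> z)) = ?N +>\<^bsub>M\<^esub> \<pi> (act r x)" if r: "r \<in> C" for r x
  proof -
    have "?N +>\<^bsub>M\<^esub> (r \<odot>\<^bsub>M\<^esub> z) = ?N +>\<^bsub>M\<^esub> \<pi> (act r x)" if z: "z \<in> ?N +>\<^bsub>M\<^esub> \<pi> x" for z
    proof -
      obtain n where n: "n \<in> N'" "z = \<pi> (n + x)" using z unfolding coset by auto
      have "act r (n + x) - act r x \<in> N'" using N'(3)[OF r n(1)] by (simp add: act_add r)
      then show ?thesis using r n by (simp add: presents_simps(5) eq)
    qed
    then have "(\<Union>z\<in>?N +>\<^bsub>M\<^esub> \<pi> x. ?N +>\<^bsub>M\<^esub> (r \<odot>\<^bsub>M\<^esub> z))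
        = (\<Union>z\<in>?N +>\<^bsub>M\<^esub> \<pi> x. ?N +>\<^bsub>M\<^esub> \<pi> (act r x))"
      by (rule SUP_cong[OF refl])
    moreover have "\<pi> x \<in> ?N +>\<^bsub>M\<^esub> \<pi> x" using N'(1) by (simp add: mem)
    then have "?N +>\<^bsub>M\<^esub> \<pi> x \<noteq> {}" by (metis empty_iff)
    ultimately show ?thesis by (simp only: UN_constant if_False)
  qed
  ultimately show ?thesis
    unfolding presents_def by (simp add: eq) (simp add: quot_module_def)
qed

text \<open>Submodules correspond to closed subgroups containing \<open>Z\<close>; such a subgroup
  is recovered from its image because it is saturated.\<close>

lemma presents_simple:
  assumes "carrier R = C" "0 \<in> Z"
  shows "simple_module R M \<longleftrightarrow>
    Z \<noteq> UNIV \<and> (\<forall>N'. Z \<subseteq> N' \<and> closed_subgroup C act N' \<longrightarrow> N' = Z \<or> N' = UNIV)"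
proof -
  have image_zero: "\<pi> ` A = {\<zero>\<^bsub>M\<^esub>}" if "\<And>x. x \<in> A \<Longrightarrow> x \<in> Z" "0 \<in> A" for A
  proof
    show "\<pi> ` A \<subseteq> {\<zero>\<^bsub>M\<^esub>}"
      using that(1) by (intro image_subsetI) (simp add: presents_simps(2,4))
    show "{\<zero>\<^bsub>M\<^esub>} \<subseteq> \<pi> ` A" using that(2) by (simp add: presents_simps(4))
  qed
  have zero_image: "x \<in> Z" if "\<pi> ` A = {\<zero>\<^bsub>M\<^esub>}" "x \<in> A" for x A
  proof -
    have "\<pi> x \<in> {\<zero>\<^bsub>M\<^esub>}" using that(2) unfolding that(1)[symmetric] by (rule imageI)
    then show ?thesis by (simp add: presents_simps(2,4))
  qed
  have carrier: "carrier M = {\<zero>\<^bsub>M\<^esub>} \<longleftrightarrow> Z = UNIV"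
  proof
    assume h: "carrier M = {\<zero>\<^bsub>M\<^esub>}"
    show "Z = UNIV" by (rule UNIV_eq_I[symmetric], rule zero_image[OF _ UNIV_I]) (simp only: h flip: presents_simps(1))
  next
    assume "Z = UNIV"
    then show "carrier M = {\<zero>\<^bsub>M\<^esub>}" unfolding presents_simps(1) by (intro image_zero) simp_all
  qed
  have saturated: "x \<in> N'" if x: "\<pi> x \<in> \<pi> ` N'" and N': "Z \<subseteq> N'" "closed_subgroup C act N'" for x N'
  proof -
    obtain y where "y \<in> N'" "x - y \<in> N'" using x N'(1) by (auto simp: presents_simps(2))
    from closed_subgroupD(5)[OF N'(2) this] show ?thesis by simp
  qed
  have zero: "\<pi> ` N' = {\<zero>\<^bsub>M\<^esub>} \<longleftrightarrow> N' = Z" if "Z \<subseteq> N'" for N'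
  proof
    assume h: "\<pi> ` N' = {\<zero>\<^bsub>M\<^esub>}"
    show "N' = Z" by (rule equalityI[OF subsetI that]) (rule zero_image[OF h])
  next
    assume "N' = Z"
    then show "\<pi> ` N' = {\<zero>\<^bsub>M\<^esub>}" using assms(2) by (intro image_zero) simp_all
  qed
  have full: "\<pi> ` N' = carrier M \<longleftrightarrow> N' = UNIV" if "Z \<subseteq> N'" "closed_subgroup C act N'" for N'
  proof
    assume h: "\<pi> ` N' = carrier M"
    show "N' = UNIV" by (rule UNIV_eq_I[symmetric], rule saturated[OF _ that]) (simp add: h presents_simps(1))
  qed (simp add: presents_simps(1))
  show ?thesis
  proof
    assume simple: "simple_module R M"
    then have "carrier M \<noteq> {\<zero>\<^bsub>M\<^esub>}"
      and sub: "\<And>N. submodule N R M \<Longrightarrow> N = {\<zero>\<^bsub>M\<^esub>} \<or> N = carrier M"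
      unfolding simple_module_def by (rule conjunct1, simp)
    from this(1) have "Z \<noteq> UNIV" unfolding carrier .
    moreover have "N' = Z \<or> N' = UNIV" if N': "Z \<subseteq> N'" "closed_subgroup C act N'" for N'
      using sub[OF presents_submoduleI[OF assms(1) N'(2)]] by (simp only: zero[OF N'(1)] full[OF N'])
    ultimately show "Z \<noteq> UNIV \<and> (\<forall>N'. Z \<subseteq> N' \<and> closed_subgroup C act N' \<longrightarrow> N' = Z \<or> N' = UNIV)"
      by simp
  next
    assume h: "Z \<noteq> UNIV \<and> (\<forall>N'. Z \<subseteq> N' \<and> closed_subgroup C act N' \<longrightarrow> N' = Z \<or> N' = UNIV)"
    show "simple_module R M" unfolding simple_module_def
    proof (intro conjI allI impI)
      show "carrier M \<noteq> {\<zero>\<^bsub>M\<^esub>}" using h unfolding carrier by (rule conjunct1)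
      fix N assume "submodule N R M"
      from presents_submodule[OF assms(1) this]
      obtain N' where N': "Z \<subseteq> N'" "closed_subgroup C act N'" "N = \<pi> ` N'" by (elim exE conjE)
      have "N' = Z \<or> N' = UNIV" using h N'(1,2) by simp
      then show "N = {\<zero>\<^bsub>M\<^esub>} \<or> N = carrier M"
        unfolding N'(3) by (simp only: zero[OF N'(1)] full[OF N'(1,2)])
    qed
  qed
qed

end

text \<open>The point of care is that \<open>finite_dim\<close> sums over a set of elements of
  \<open>M\<close>: lifts that become equal in \<open>M\<close> are counted once. Spanning sets are
  therefore moved along subsets on which the projection is injective.\<close>

lemma presents_finite_dim:
  fixes M :: "(pol \<Rightarrow> pol, 'm) module" and \<pi> :: "pol^'n \<Rightarrow> 'm"
  assumes pr: "presents M C act Z \<pi>" and scal: "\<And>c. scal c \<in> C" "\<And>c x. act (scal c) x = pconst c *s x"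
    and Z: "closed_subgroup C act Z"
  shows "finite_dim M \<longleftrightarrow> (\<exists>S. finite S \<and> (\<forall>x. \<exists>c. x - (\<Sum>s\<in>S. pconst (c s) *s s) \<in> Z))"
proof -
  note ps = presents_simps[OF pr]
  note Zs = closed_subgroupD[OF Z]
  interpret abelian_group M by (rule presents_abelian_group[OF pr])
  have comb: "(\<Oplus>\<^bsub>M\<^esub>s\<in>\<pi> ` S. scal (c s) \<odot>\<^bsub>M\<^esub> s) = \<pi> (\<Sum>s\<in>S. pconst (c (\<pi> s)) *s s)"
    if S: "finite S" "inj_on \<pi> S" for S c
  proof -
    have "(\<lambda>s. scal (c s) \<odot>\<^bsub>M\<^esub> s) \<in> \<pi> ` S \<rightarrow> carrier M" using scal by (auto simp: ps(1,5))
    then have "(\<Oplus>\<^bsub>M\<^esub>s\<in>\<pi> ` S. scal (c s) \<odot>\<^bsub>M\<^esub> s) = (\<Oplus>\<^bsub>M\<^esub>s\<in>S. scal (c (\<pi> s)) \<odot>\<^bsub>M\<^esub> \<pi> s)"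
      by (rule finsum_reindex[OF _ S(2)])
    also have "\<dots> = (\<Oplus>\<^bsub>M\<^esub>s\<in>S. \<pi> (pconst (c (\<pi> s)) *s s))" using scal by (simp add: ps(5))
    finally show ?thesis using presents_finsum[OF pr S(1)] by simp
  qed
  show ?thesis
  proof
    assume "finite_dim M"
    then obtain S' where S': "finite S'" "S' \<subseteq> range \<pi>" 
      "\<forall>x\<in>range \<pi>. \<exists>c. x = (\<Oplus>\<^bsub>M\<^esub>s\<in>S'. scal (c s) \<odot>\<^bsub>M\<^esub> s)"
      unfolding finite_dim_def ps(1) by (elim exE conjE)
    obtain S where S: "inj_on \<pi> S" "S' = \<pi> ` S"
      using iffD1[OF subset_image_inj S'(2)] by (elim exE conjE)
    then have fin: "finite S" using S'(1) finite_imageD by blast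
    have "\<exists>c. x - (\<Sum>s\<in>S. pconst (c s) *s s) \<in> Z" for x
    proof -
      obtain c where "\<pi> x = (\<Oplus>\<^bsub>M\<^esub>s\<in>S'. scal (c s) \<odot>\<^bsub>M\<^esub> s)" using bspec[OF S'(3) rangeI[of \<pi> x]] by (elim exE)
      then have "x - (\<Sum>s\<in>S. pconst (c (\<pi> s)) *s s) \<in> Z" unfolding S(2) comb[OF fin S(1)] ps(2) .
      then show ?thesis by (rule exI[of _ "c \<circ> \<pi>", unfolded o_def])
    qed
    then show "\<exists>S. finite S \<and> (\<forall>x. \<exists>c. x - (\<Sum>s\<in>S. pconst (c s) *s s) \<in> Z)"
      by (intro exI[of _ S] conjI fin allI)
  next
    assume "\<exists>S. finite S \<and> (\<forall>x. \<exists>c. x - (\<Sum>s\<in>S. pconst (c s) *s s) \<in> Z)"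
    then obtain S where S: "finite S" "\<forall>x. \<exists>c. x - (\<Sum>s\<in>S. pconst (c s) *s s) \<in> Z" by (elim exE conjE)
    obtain T where T: "T \<subseteq> S" "inj_on \<pi> T" "\<pi> ` S = \<pi> ` T"
      using subset_image_inj[of "\<pi> ` S" \<pi> S, THEN iffD1, OF subset_refl] by (elim exE conjE)
    have finT: "finite T" using T(1) S(1) finite_subset by blast
    have "\<forall>s\<in>S. \<exists>t. t \<in> T \<and> s - t \<in> Z"
    proof
      fix s assume "s \<in> S"
      then have "\<pi> s \<in> \<pi> ` T" unfolding T(3)[symmetric] by (rule imageI)
      then obtain t where "t \<in> T" "\<pi> s = \<pi> t" by (elim imageE)
      then show "\<exists>t. t \<in> T \<and> s - t \<in> Z" unfolding ps(2) by (intro exI conjI)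
    qed
    from bchoice[OF this] obtain t where "\<forall>s\<in>S. t s \<in> T \<and> s - t s \<in> Z" by (elim exE)
    then have t: "\<And>s. s \<in> S \<Longrightarrow> t s \<in> T" "\<And>s. s \<in> S \<Longrightarrow> s - t s \<in> Z" by simp_all
    have sumZ: "sum f A \<in> Z" if "\<And>a. a \<in> A \<Longrightarrow> f a \<in> Z" for f and A :: "(pol^'n) set"
      using that by (induction A rule: infinite_finite_induct) (auto intro: Zs)
    have span: "\<exists>c. \<pi> x = (\<Oplus>\<^bsub>M\<^esub>s\<in>\<pi> ` T. scal (c s) \<odot>\<^bsub>M\<^esub> s)" for x
    proof -
      obtain c where c: "x - (\<Sum>s\<in>S. pconst (c s) *s s) \<in> Z" using spec[OF S(2), of x] by (elim exE)
      \<comment> \<open>All coefficients whose vectors share the representative \<open>u\<close> are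
        collected.\<close>
      define d where "d u = (\<Sum>s | s \<in> S \<and> t s = u. c s)" for u
      have "pconst (c s) *s (s - t s) \<in> Z" if "s \<in> S" for s
        using Zs(3)[OF scal(1) t(2)[OF that], of "c s"] by (simp add: scal(2))
      then have "(\<Sum>s\<in>S. pconst (c s) *s (s - t s)) \<in> Z" by (rule sumZ)
      from Zs(5)[OF c this] have "x - (\<Sum>s\<in>S. pconst (c s) *s t s) \<in> Z"
        by (simp add: vector_ssub_ldistrib sum_subtractf)
      also have "(\<Sum>s\<in>S. pconst (c s) *s t s) = (\<Sum>u\<in>T. \<Sum>s | s \<in> S \<and> t s = u. pconst (c s) *s t s)"
        by (rule sum.group[symmetric]) (use S(1) finT t(1) in auto)
      also have "\<dots> = (\<Sum>u\<in>T. pconst (d u) *s u)"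
        by (intro sum.cong refl) (simp add: d_def pconst_sum vec_eq_iff sum_distrib_right)
      also have "\<dots> = (\<Sum>u\<in>T. pconst (d (inv_into T \<pi> (\<pi> u))) *s u)"
        using T(2) by (intro sum.cong refl) simp
      finally have "\<pi> x = \<pi> (\<Sum>u\<in>T. pconst (d (inv_into T \<pi> (\<pi> u))) *s u)" by (simp add: ps(2))
      also have "\<dots> = (\<Oplus>\<^bsub>M\<^esub>s\<in>\<pi> ` T. scal (d (inv_into T \<pi> s)) \<odot>\<^bsub>M\<^esub> s)"
        by (rule comb[OF finT T(2), symmetric])
      finally show ?thesis by (rule exI[of _ "\<lambda>s. d (inv_into T \<pi> s)"])
    qed
    have "\<forall>y\<in>range \<pi>. \<exists>c. y = (\<Oplus>\<^bsub>M\<^esub>s\<in>\<pi> ` T. scal (c s) \<odot>\<^bsub>M\<^esub> s)"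
    proof
      fix y assume "y \<in> range \<pi>"
      then obtain x where y: "y = \<pi> x" by (elim rangeE)
      show "\<exists>c. y = (\<Oplus>\<^bsub>M\<^esub>s\<in>\<pi> ` T. scal (c s) \<odot>\<^bsub>M\<^esub> s)" unfolding y by (rule span)
    qed
    then show "finite_dim M" unfolding finite_dim_def ps(1)
      by (intro exI[of _ "\<pi> ` T"] conjI finite_imageI finT image_mono subset_UNIV)
  qed
qed

lemma mat_mult_vec: "mat c *v v = c *s (v :: complex^'n)"
  by (simp add: vec_eq_iff matrix_vector_mult_def mat_def if_distrib[of "\<lambda>x. x * _"] cong: if_cong)

lemma matrix_eqI: "(\<And>v. A *v v = B *v v) \<Longrightarrow> A = (B :: complex^'n^'n)"
  using matrix_eq[of A B] by blast

context cherednik_module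
begin

lemma alg_additive: "f \<in> alg \<Longrightarrow> f (x + y) = f x + f y"
  by (induction arbitrary: x y rule: alg.induct)
    (simp_all add: scale_right_distrib wa_add T1_add T2_add add_ac)

end

context dunkl_rep
begin

section \<open>The action of the Cherednik algebra on standard modules\<close>

lemma corr_additive: "corr f g \<Longrightarrow> f (p + q) = f p + f q" "corr f g \<Longrightarrow> g (F + G) = g F + g G"
  using PV.alg_additive[of "map_prod f g" "(p, F)" "(q, G)"] by (simp_all add: corr_def)

lemma carrier_cherednik:
  "carrier (cherednik k) = subalg (wact ` W \<union> range (\<lambda>\<alpha>. (*) (lin \<alpha>)) \<union> range (dunkl k))"
  by (simp add: cherednik_def operator_ring_def)

lemma ring_ops_cherednik [simp]:
  "f \<otimes>\<^bsub>cherednik k\<^esub> g = f \<circ> g" "f \<oplus>\<^bsub>cherednik k\<^esub> g = (\<lambda>p. f p + g p)"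
  by (simp_all add: cherednik_def operator_ring_def)

lemma corr_exists: "f \<in> carrier (cherednik k) \<Longrightarrow> \<exists>g. corr f g"
  unfolding carrier_cherednik
proof (induction rule: subalg.induct)
  case (subalg_base f)
  then show ?case by (auto intro: corr_wact corr_mult corr_dunkl)
qed (blast intro: corr_scal corr_add corr_comp)+

text \<open>The action on the standard module: well defined by \<open>corr_unique\<close> and
  defined on the whole algebra by \<open>corr_exists\<close>.\<close>

definition Theta :: "(pol \<Rightarrow> pol) \<Rightarrow> pol^'n \<Rightarrow> pol^'n" where
  "Theta f = (THE g. corr f g)"

lemma Theta_eq: "corr f g \<Longrightarrow> Theta f = g"
  unfolding Theta_def by (rule the_equality) (auto intro: corr_unique)

lemma corr_Theta: "f \<in> carrier (cherednik k) \<Longrightarrow> corr f (Theta f)"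
  using corr_exists Theta_eq by blast

lemma in_cherednik:
  "scal c \<in> carrier (cherednik k)" "w \<in> W \<Longrightarrow> wact w \<in> carrier (cherednik k)"
  "dunkl k y \<in> carrier (cherednik k)"
  "f \<in> carrier (cherednik k) \<Longrightarrow> g \<in> carrier (cherednik k) \<Longrightarrow> (\<lambda>p. f p + g p) \<in> carrier (cherednik k)"
  "f \<in> carrier (cherednik k) \<Longrightarrow> g \<in> carrier (cherednik k) \<Longrightarrow> f \<circ> g \<in> carrier (cherednik k)"
  unfolding carrier_cherednik by (auto intro: subalg.intros)

lemma mult_in_cherednik: "(*) p \<in> carrier (cherednik k)"
proof (induction p rule: pol_induct)
  case (const c)
  have eq: "(*) (pconst c) = scal c" by (rule ext) (rule scal_eq[symmetric])
  show ?case unfolding eq by (rule in_cherednik(1))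
next
  case (X1 p)
  have lin: "(*) (lin e1) \<in> carrier (cherednik k)"
    unfolding carrier_cherednik by (rule subalg_base, rule UnI1, rule UnI2, rule rangeI)
  have eq: "(*) (X1 * p) = (*) (lin e1) \<circ> (*) p"
    by (rule ext) (simp only: o_apply lin_e1 mult.assoc)
  show ?case unfolding eq by (rule in_cherednik(5)[OF lin X1])
next
  case (X2 p)
  have lin: "(*) (lin e2) \<in> carrier (cherednik k)"
    unfolding carrier_cherednik by (rule subalg_base, rule UnI1, rule UnI2, rule rangeI)
  have eq: "(*) (X2 * p) = (*) (lin e2) \<circ> (*) p"
    by (rule ext) (simp only: o_apply lin_e2 mult.assoc)
  show ?case unfolding eq by (rule in_cherednik(5)[OF lin X2])
next
  case (add p q)
  have eq: "(*) (p + q) = (\<lambda>x. p * x + q * x)" by (rule ext) (rule distrib_right)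
  show ?case unfolding eq by (rule in_cherednik(4)[OF add])
qed

lemma Theta_simps:
  "Theta ((*) p) = (*s) p" "Theta (scal c) = (*s) (pconst c)" "w \<in> W \<Longrightarrow> Theta (wact w) = wact_vec \<rho> w"
  "Theta (dunkl k y) = (\<lambda>F. pconst (y $ 1) *s dunkl_vec k \<rho> e1 F + pconst (y $ 2) *s dunkl_vec k \<rho> e2 F)"
  by (auto intro: Theta_eq corr_mult corr_scal corr_wact corr_dunkl)

lemma Theta_ring:
  assumes "f \<in> carrier (cherednik k)" "g \<in> carrier (cherednik k)"
  shows "Theta (\<lambda>p. f p + g p) = (\<lambda>F. Theta f F + Theta g F)" "Theta (f \<circ> g) = Theta f \<circ> Theta g"
  using assms by (auto intro!: Theta_eq corr_add corr_comp corr_Theta)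

lemma Theta_add: "f \<in> carrier (cherednik k) \<Longrightarrow> Theta f (F + G) = Theta f F + Theta f G"
  using corr_additive(2)[OF corr_Theta] .

lemma Theta_0: "f \<in> carrier (cherednik k) \<Longrightarrow> Theta f 0 = 0"
  using Theta_add[of f 0 0] by simp

text \<open>Links stability under the generators with stability under the whole algebra. One
  direction is induction on generated operators; the other uses that multiplication by every
  polynomial belongs to the algebra.\<close>

lemma stable_iff: "V.stable N \<longleftrightarrow> closed_subgroup (carrier (cherednik k)) Theta N"
proof
  assume N: "V.stable N"
  have "Theta f F \<in> N" if "f \<in> carrier (cherednik k)" "F \<in> N" for f F
    using that unfolding carrier_cherednik
  proof (induction arbitrary: F rule: subalg.induct)
    case (subalg_scal c)
    then show ?case by (simp add: Theta_simps V.stableD[OF N])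
  next
    case (subalg_base f)
    then show ?case by (auto simp: Theta_simps intro!: V.stableD[OF N])
  next
    case (subalg_add f g)
    then show ?case by (simp add: Theta_ring(1)[unfolded carrier_cherednik] V.stableD[OF N])
  next
    case (subalg_comp f g)
    have "Theta (f \<circ> g) F = Theta f (Theta g F)"
      unfolding Theta_ring(2)[unfolded carrier_cherednik, OF subalg_comp.hyps] by (rule o_apply)
    also have "\<dots> \<in> N" by (intro subalg_comp.IH subalg_comp.prems)
    finally show ?case .
  qed
  then show "closed_subgroup (carrier (cherednik k)) Theta N"
    using V.stableD(1)[OF N] V.stable_diff[OF N] by (simp add: closed_subgroup_def)
next
  assume N: "closed_subgroup (carrier (cherednik k)) Theta N"
  note D = closed_subgroupD[OF N]
  have "dunkl_vec k \<rho> e1 x \<in> N" "dunkl_vec k \<rho> e2 x \<in> N" if "x \<in> N" for x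
    using D(3)[OF in_cherednik(3)[of e1] that] D(3)[OF in_cherednik(3)[of e2] that]
    by (simp_all add: Theta_simps e_entries)
  moreover have "p *s x \<in> N" if "x \<in> N" for p x
    using D(3)[OF mult_in_cherednik[of p] that] by (simp add: Theta_simps)
  moreover have "wact_vec \<rho> w x \<in> N" if "x \<in> N" "w \<in> W" for w x
    using D(3)[OF in_cherednik(2)[OF that(2)] that(1)] that by (simp add: Theta_simps)
  ultimately show "V.stable N" using D(1,5) by (simp add: V.stable_def)
qed

text \<open>The subalgebra generated by Dunkl operators and \<open>W\<close> preserves the constant
  vectors of the standard module; \<open>A\<close> is the resulting matrix. This provides the map
  required in \<open>trivial_ext\<close>, whose existence cannot be read off from expressions in the
  generators.\<close>

definition const_rel :: "(pol \<Rightarrow> pol) \<Rightarrow> complex^'n^'n \<Rightarrow> bool" where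
  "const_rel f A \<longleftrightarrow> f \<in> dunkl_W_alg k \<and> f \<in> carrier (cherednik k) \<and> (\<forall>v. Theta f (vconst v) = vconst (A *v v))"

lemma const_rel_unique: "const_rel f A \<Longrightarrow> const_rel f B \<Longrightarrow> A = B"
  by (rule matrix_eqI) (simp add: const_rel_def)

lemma dunkl_alg_sub: "f \<in> dunkl_alg k \<Longrightarrow> f \<in> dunkl_W_alg k"
  by (simp add: dunkl_W_alg_def subalg_base)

lemma const_rel_scal: "const_rel (scal c) (mat c)"
  by (simp add: const_rel_def dunkl_W_alg_def subalg_scal in_cherednik Theta_simps vconst_scale mat_mult_vec)

lemma const_rel_dunkl: "const_rel (dunkl k y) 0"
  using dunkl_alg_sub[of "dunkl k y"]
  by (simp add: const_rel_def dunkl_alg_def subalg_base in_cherednik Theta_simps V.T_V0)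

lemma const_rel_wact: assumes "w \<in> W" shows "const_rel (wact w) (\<rho> w)"
proof -
  have "wact_vec \<rho> w (vconst v) = vconst (\<rho> w *v v)" for v
    by (simp add: vec_eq_iff wact_vec_def matrix_vector_mult_def pconst_sum pconst_mult)
  then show ?thesis using assms
    by (simp add: const_rel_def dunkl_W_alg_def subalg_base in_cherednik Theta_simps)
qed

lemma const_rel_add: "const_rel f A \<Longrightarrow> const_rel g B \<Longrightarrow> const_rel (\<lambda>p. f p + g p) (A + B)"
  by (simp add: const_rel_def dunkl_W_alg_def subalg_add in_cherednik Theta_ring vconst_add matrix_vector_mult_add_rdistrib)

lemma const_rel_comp: "const_rel f A \<Longrightarrow> const_rel g B \<Longrightarrow> const_rel (f \<circ> g) (A ** B)"
  by (simp add: const_rel_def dunkl_W_alg_def subalg_comp in_cherednik Theta_ring matrix_vector_mul_assoc)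

lemma const_rel_exists:
  assumes "f \<in> dunkl_W_alg k" shows "\<exists>A. const_rel f A"
proof -
  have "\<exists>A. const_rel g A" if "g \<in> dunkl_alg k" for g
    using that unfolding dunkl_alg_def
  proof (induction rule: subalg.induct)
    case (subalg_base f)
    then show ?case by (auto intro: const_rel_dunkl)
  qed (blast intro: const_rel_scal const_rel_add const_rel_comp)+
  note dunkl = this
  show ?thesis using assms unfolding dunkl_W_alg_def
  proof (induction rule: subalg.induct)
    case (subalg_base f)
    then show ?case using dunkl by (auto intro: const_rel_wact)
  qed (blast intro: const_rel_scal const_rel_add const_rel_comp)+
qed

text \<open>A nonempty word has a Dunkl operator as outermost factor, whose matrix is zero.\<close>

lemma const_rel_plus:
  assumes "f \<in> dunkl_plus k" shows "const_rel f 0"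
proof -
  have zero: "const_rel (\<lambda>p. 0) 0"
  proof -
    have "scal 0 = (\<lambda>p. 0)" by (rule ext) (simp add: scal_eq)
    moreover have "mat 0 = (0 :: complex^'n^'n)" by (simp add: mat_def vec_eq_iff)
    ultimately show ?thesis using const_rel_scal[of 0] by (elim subst)
  qed
  have zero_mult: "0 ** A = (0 :: complex^'n^'n)" for A :: "complex^'n^'n"
    by (simp add: matrix_matrix_mult_def vec_eq_iff)
  have mult_zero: "A ** 0 = (0 :: complex^'n^'n)" for A :: "complex^'n^'n"
    by (simp add: matrix_matrix_mult_def vec_eq_iff)
  have scale: "const_rel (\<lambda>p. scal c (f p)) 0" if "const_rel f 0" for c f
    using const_rel_comp[OF const_rel_scal[of c] that] unfolding o_def mult_zero .
  have word_Cons: "foldr (\<circ>) (map (dunkl k) (y # ys)) id = dunkl k y \<circ> foldr (\<circ>) (map (dunkl k) ys) id" for y ys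
    by simp
  have word: "\<exists>A. const_rel (foldr (\<circ>) (map (dunkl k) ys) id) A" for ys
  proof (induction ys)
    case Nil
    have eq: "foldr (\<circ>) (map (dunkl k) []) id = scal 1" by (rule ext) (simp add: scal_eq)
    show ?case unfolding eq by (rule exI, rule const_rel_scal)
  next
    case (Cons y ys)
    then obtain A where "const_rel (foldr (\<circ>) (map (dunkl k) ys) id) A" by (elim exE)
    from const_rel_comp[OF const_rel_dunkl[of y] this] show ?case unfolding word_Cons by (rule exI)
  qed
  have "const_rel g 0" if g: "g \<in> dunkl_homog k n" and n: "n \<ge> 1" for g n
    using g unfolding dunkl_homog_def
  proof (induction rule: lin_span.induct)
    case (span_base g)
    then obtain zs where zs: "g = foldr (\<circ>) (map (dunkl k) zs) id" "length zs = n" by blast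
    then obtain y ys where ys: "zs = y # ys" using n by (cases zs) simp_all
    obtain A where "const_rel (foldr (\<circ>) (map (dunkl k) ys) id) A" using word[of ys] by (elim exE)
    from const_rel_comp[OF const_rel_dunkl[of y] this]
    show ?case unfolding zs(1) ys word_Cons zero_mult .
  next
    case (span_add f g)
    from const_rel_add[OF span_add.IH] show ?case by simp
  qed (auto intro: zero scale)
  note homog = this
  show ?thesis using assms unfolding dunkl_plus_def
  proof (induction rule: lin_span.induct)
    case (span_add f g)
    from const_rel_add[OF span_add.IH] show ?case by simp
  qed (auto intro: zero scale homog)
qed

text \<open>Existence comes from the action on constants. For uniqueness, a competitor agrees on
  scalars, on group elements and on single Dunkl operators, which lie in \<open>dunkl_plus\<close>,
  and hence on everything they generate.\<close>

lemma trivial_ext_eq: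
  assumes "const_rel f A" shows "trivial_ext k \<rho> f = A"
proof -
  let ?B = "dunkl_W_alg k"
  let ?P = "\<lambda>\<phi>. \<phi> \<in> extensional ?B \<and> (\<forall>c. \<phi> (scal c) = mat c) \<and>
     (\<forall>f\<in>?B. \<forall>g\<in>?B. \<phi> (\<lambda>p. f p + g p) = \<phi> f + \<phi> g \<and> \<phi> (f \<circ> g) = \<phi> f ** \<phi> g) \<and>
     (\<forall>w\<in>W. \<phi> (wact w) = \<rho> w) \<and> (\<forall>f\<in>dunkl_plus k. \<phi> f = 0)"
  define \<phi> where "\<phi> = (\<lambda>f. if f \<in> ?B then THE A. const_rel f A else undefined)"
  have \<phi>: "\<phi> f = A" if "const_rel f A" for f A
    using that const_rel_unique by (auto simp: \<phi>_def const_rel_def intro!: the_equality)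
  have "?P \<phi>"
  proof (intro conjI allI ballI)
    show "\<phi> \<in> extensional ?B" by (simp add: \<phi>_def extensional_def)
    fix f g assume "f \<in> ?B" "g \<in> ?B"
    then obtain A B where AB: "const_rel f A" "const_rel g B" using const_rel_exists by blast
    show "\<phi> (\<lambda>p. f p + g p) = \<phi> f + \<phi> g" "\<phi> (f \<circ> g) = \<phi> f ** \<phi> g"
      by (simp_all only: \<phi>[OF AB(1)] \<phi>[OF AB(2)] \<phi>[OF const_rel_add[OF AB]] \<phi>[OF const_rel_comp[OF AB]])
  qed (auto intro: \<phi> const_rel_scal const_rel_wact const_rel_plus)
  moreover have "\<psi> = \<phi>" if \<psi>: "?P \<psi>" for \<psi>
  proof -
    have dunkl0: "\<psi> (dunkl k y) = 0" for y
    proof -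
      have "dunkl k y \<in> dunkl_homog k 1"
        unfolding dunkl_homog_def by (rule span_base) (auto intro: exI[of _ "[y]"])
      then have "dunkl k y \<in> dunkl_plus k" unfolding dunkl_plus_def by (intro span_base) auto
      then show ?thesis using \<psi> by blast
    qed
    note \<phi>P = \<open>?P \<phi>\<close>
    have add: "(\<lambda>p. f p + g p) \<in> ?B \<and> \<psi> (\<lambda>p. f p + g p) = \<phi> (\<lambda>p. f p + g p)"
      and comp: "f \<circ> g \<in> ?B \<and> \<psi> (f \<circ> g) = \<phi> (f \<circ> g)"
      if f: "f \<in> ?B \<and> \<psi> f = \<phi> f" and g: "g \<in> ?B \<and> \<psi> g = \<phi> g" for f g
    proof -
      have fg: "f \<in> ?B" "g \<in> ?B" using f g by simp_all
      have "\<psi> (\<lambda>p. f p + g p) = \<psi> f + \<psi> g" "\<psi> (f \<circ> g) = \<psi> f ** \<psi> g"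
        using \<psi>[THEN conjunct2, THEN conjunct2, THEN conjunct1] fg by simp_all
      moreover have "\<phi> (\<lambda>p. f p + g p) = \<phi> f + \<phi> g" "\<phi> (f \<circ> g) = \<phi> f ** \<phi> g"
        using \<phi>P[THEN conjunct2, THEN conjunct2, THEN conjunct1] fg by simp_all
      moreover have "(\<lambda>p. f p + g p) \<in> ?B" "f \<circ> g \<in> ?B"
        using fg unfolding dunkl_W_alg_def by (rule subalg.subalg_add, rule subalg.subalg_comp)
      moreover have "\<psi> f = \<phi> f" "\<psi> g = \<phi> g" using f g by simp_all
      ultimately show "(\<lambda>p. f p + g p) \<in> ?B \<and> \<psi> (\<lambda>p. f p + g p) = \<phi> (\<lambda>p. f p + g p)"
        "f \<circ> g \<in> ?B \<and> \<psi> (f \<circ> g) = \<phi> (f \<circ> g)" by (simp_all only: simp_thms)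
    qed
    have scal: "scal c \<in> ?B \<and> \<psi> (scal c) = \<phi> (scal c)" for c
      using \<psi> \<phi>P const_rel_scal[of c] by (simp add: const_rel_def)
    have alg: "g \<in> ?B \<and> \<psi> g = \<phi> g" if "g \<in> dunkl_alg k" for g
      using that unfolding dunkl_alg_def
    proof (induction rule: subalg.induct)
      case (subalg_base f)
      then obtain y where f: "f = dunkl k y" by blast
      show ?case unfolding f using dunkl0 \<phi>[OF const_rel_dunkl] const_rel_dunkl by (simp add: const_rel_def)
    qed (rule scal, rule add, assumption+, rule comp, assumption+)
    have "g \<in> ?B \<and> \<psi> g = \<phi> g" if "g \<in> ?B" for g
      using that unfolding dunkl_W_alg_def
    proof (induction rule: subalg.induct)
      case (subalg_base f)
      then consider "f \<in> dunkl_alg k" | w where "w \<in> W" "f = wact w" by blast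
      then have "f \<in> ?B \<and> \<psi> f = \<phi> f"
      proof cases
        case 1
        then show ?thesis by (rule alg)
      next
        case (2 w)
        then show ?thesis using \<psi> \<phi>P const_rel_wact[of w] by (simp add: const_rel_def)
      qed
      then show ?case by (simp only: dunkl_W_alg_def)
    qed (rule scal[unfolded dunkl_W_alg_def], rule add[unfolded dunkl_W_alg_def], assumption+,
      rule comp[unfolded dunkl_W_alg_def], assumption+)
    then show "\<psi> = \<phi>" using \<psi> by (intro extensionalityI[of _ ?B]) (auto simp: \<phi>_def extensional_def)
  qed
  ultimately have "trivial_ext k \<rho> = \<phi>" unfolding trivial_ext_def by (intro the_equality)
  then show ?thesis using \<phi>[OF assms] by simp
qed

end

context dunkl_rep
begin

section \<open>Verma modules\<close>

abbreviation "H \<equiv> carrier (cherednik k)"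

abbreviation tens :: "(pol \<Rightarrow> pol, ((pol \<Rightarrow> pol) \<times> (complex^'n)) \<Rightarrow>\<^sub>0 int) module" where
  "tens \<equiv> tensor_free (cherednik k) (lowest_module k \<rho>)"

abbreviation "free_grp \<equiv> free_Abelian_group (H \<times> (UNIV :: (complex^'n) set))"

definition rel_grp :: "(((pol \<Rightarrow> pol) \<times> (complex^'n)) \<Rightarrow>\<^sub>0 int) set" where
  "rel_grp = generate free_grp (tensor_relators (cherednik k) (dunkl_W_alg k) (lowest_module k \<rho>))"

lemma lowest_module_simps [simp]:
  "carrier (lowest_module k \<rho>) = UNIV" "v \<oplus>\<^bsub>lowest_module k \<rho>\<^esub> w = v + w"
  "b \<odot>\<^bsub>lowest_module k \<rho>\<^esub> v = trivial_ext k \<rho> b *v v"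
  by (simp_all add: lowest_module_def)

lemma tens_simps [simp]:
  "carrier tens = carrier free_grp" "\<zero>\<^bsub>tens\<^esub> = 0" "x \<oplus>\<^bsub>tens\<^esub> y = x + y"
  "r \<odot>\<^bsub>tens\<^esub> x = frag_extend (\<lambda>(a, v). frag_of (r \<circ> a, v)) x"
  by (simp_all add: tensor_free_def)

lemma dunkl_W_alg_sub: "f \<in> dunkl_W_alg k \<Longrightarrow> f \<in> H"
  using const_rel_exists by (auto simp: const_rel_def)

lemma relators_closed: "tensor_relators (cherednik k) (dunkl_W_alg k) (lowest_module k \<rho>) \<subseteq> carrier free_grp"
proof -
  have closed: "x - y \<in> carrier free_grp" if "x \<in> carrier free_grp" "y \<in> carrier free_grp"
    for x y :: "((pol \<Rightarrow> pol) \<times> (complex^'n)) \<Rightarrow>\<^sub>0 int"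
    using that keys_diff[of x y] by auto
  have of: "frag_of (a, v) \<in> carrier free_grp" if "a \<in> H" for a and v :: "complex^'n"
    using that by (simp add: keys_frag_of)
  show ?thesis
    unfolding tensor_relators_def
    by (intro Un_least; clarify; intro closed of; simp only: ring_ops_cherednik in_cherednik dunkl_W_alg_sub)
qed

lemma rel_grp_subgroup: "subgroup rel_grp free_grp"
  unfolding rel_grp_def by (rule group.generate_is_subgroup[OF group_free_Abelian_group relators_closed])

lemma rel_grp_closed:
  "0 \<in> rel_grp" "x \<in> rel_grp \<Longrightarrow> y \<in> rel_grp \<Longrightarrow> x + y \<in> rel_grp" "x \<in> rel_grp \<Longrightarrow> - x \<in> rel_grp"
  "x \<in> rel_grp \<Longrightarrow> y \<in> rel_grp \<Longrightarrow> x - y \<in> rel_grp" "x \<in> rel_grp \<Longrightarrow> x \<in> carrier free_grp"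
proof -
  interpret subgroup rel_grp free_grp by (rule rel_grp_subgroup)
  show "0 \<in> rel_grp" using one_closed by simp
  show add: "x \<in> rel_grp \<Longrightarrow> y \<in> rel_grp \<Longrightarrow> x + y \<in> rel_grp" for x y using m_closed by simp
  show car: "x \<in> rel_grp \<Longrightarrow> x \<in> carrier free_grp" for x using subset by blast
  show minus: "- x \<in> rel_grp" if h: "x \<in> rel_grp" for x
  proof -
    have "inv\<^bsub>free_grp\<^esub> x = - x" using car[OF h] by (intro inv_free_Abelian_group) simp
    then show ?thesis using m_inv_closed[OF h] by (elim subst)
  qed
  show "x \<in> rel_grp \<Longrightarrow> y \<in> rel_grp \<Longrightarrow> x - y \<in> rel_grp" using add[of x "- y"] minus[of y] by simp
qed

lemma rel_grp_relators:
  "a \<in> H \<Longrightarrow> b \<in> H \<Longrightarrow> frag_of (\<lambda>p. a p + b p, v) - frag_of (a, v) - frag_of (b, v) \<in> rel_grp"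
  "a \<in> H \<Longrightarrow> frag_of (a, v + w) - frag_of (a, v) - frag_of (a, w) \<in> rel_grp"
  "a \<in> H \<Longrightarrow> const_rel b A \<Longrightarrow> frag_of (a \<circ> b, v) - frag_of (a, A *v v) \<in> rel_grp"
proof -
  let ?T = "tensor_relators (cherednik k) (dunkl_W_alg k) (lowest_module k \<rho>)"
  have inc: "x \<in> ?T \<Longrightarrow> x \<in> rel_grp" for x unfolding rel_grp_def by (rule generate.incl)
  show "a \<in> H \<Longrightarrow> b \<in> H \<Longrightarrow> frag_of (\<lambda>p. a p + b p, v) - frag_of (a, v) - frag_of (b, v) \<in> rel_grp"
  proof (rule inc)
    assume h: "a \<in> H" "b \<in> H"
    show "frag_of (\<lambda>p. a p + b p, v) - frag_of (a, v) - frag_of (b, v) \<in> ?T"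
      unfolding tensor_relators_def
      by (intro UnI1 CollectI exI[of _ a] exI[of _ b] exI[of _ v]) (simp add: h)
  qed
  show "a \<in> H \<Longrightarrow> frag_of (a, v + w) - frag_of (a, v) - frag_of (a, w) \<in> rel_grp"
  proof (rule inc)
    assume h: "a \<in> H"
    show "frag_of (a, v + w) - frag_of (a, v) - frag_of (a, w) \<in> ?T"
      unfolding tensor_relators_def
      by (rule UnI1, rule UnI2, intro CollectI exI[of _ a] exI[of _ v] exI[of _ w]) (simp add: h)
  qed
  show "a \<in> H \<Longrightarrow> const_rel b A \<Longrightarrow> frag_of (a \<circ> b, v) - frag_of (a, A *v v) \<in> rel_grp"
  proof (rule inc)
    assume h: "a \<in> H" and b: "const_rel b A"
    have "b \<in> dunkl_W_alg k" using b by (simp add: const_rel_def)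
    then have "frag_of (a \<otimes>\<^bsub>cherednik k\<^esub> b, v) - frag_of (a, b \<odot>\<^bsub>lowest_module k \<rho>\<^esub> v) \<in> ?T"
      unfolding tensor_relators_def
      by (intro UnI2 CollectI exI[of _ a] exI[of _ b] exI[of _ v]) (simp add: h)
    then show "frag_of (a \<circ> b, v) - frag_of (a, A *v v) \<in> ?T"
      unfolding ring_ops_cherednik lowest_module_simps trivial_ext_eq[OF b] .
  qed
qed

section \<open>Tensors modulo the relations and their standard representatives\<close>

definition cong_rel :: "(((pol \<Rightarrow> pol) \<times> (complex^'n)) \<Rightarrow>\<^sub>0 int) \<Rightarrow> (((pol \<Rightarrow> pol) \<times> (complex^'n)) \<Rightarrow>\<^sub>0 int) \<Rightarrow> bool"
    (infix \<open>\<approx>\<approx>\<close> 50) where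
  "x \<approx>\<approx> y \<longleftrightarrow> x - y \<in> rel_grp"

lemma cong_refl [simp]: "x \<approx>\<approx> x" by (simp add: cong_rel_def rel_grp_closed)
lemma cong_sym: "x \<approx>\<approx> y \<Longrightarrow> y \<approx>\<approx> x" using rel_grp_closed(3)[of "x - y"] by (simp add: cong_rel_def)
lemma cong_trans [trans]: "x \<approx>\<approx> y \<Longrightarrow> y \<approx>\<approx> z \<Longrightarrow> x \<approx>\<approx> z"
  using rel_grp_closed(2)[of "x - y" "y - z"] by (simp add: cong_rel_def)
lemma cong_add: "x \<approx>\<approx> y \<Longrightarrow> x' \<approx>\<approx> y' \<Longrightarrow> x + x' \<approx>\<approx> y + y'"
  using rel_grp_closed(2)[of "x - y" "x' - y'"] by (simp add: cong_rel_def add_diff_add)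
lemma cong_sum: "(\<And>i. i \<in> A \<Longrightarrow> f i \<approx>\<approx> g i) \<Longrightarrow> sum f A \<approx>\<approx> sum g A"
  by (induction A rule: infinite_finite_induct) (simp_all add: cong_add)

lemma cong_relators:
  "a \<in> H \<Longrightarrow> b \<in> H \<Longrightarrow> frag_of (\<lambda>p. a p + b p, v) \<approx>\<approx> frag_of (a, v) + frag_of (b, v)"
  "a \<in> H \<Longrightarrow> frag_of (a, v + w) \<approx>\<approx> frag_of (a, v) + frag_of (a, w)"
  "a \<in> H \<Longrightarrow> const_rel b A \<Longrightarrow> frag_of (a \<circ> b, v) \<approx>\<approx> frag_of (a, A *v v)"
  using rel_grp_relators(1)[of a b v] rel_grp_relators(2)[of a v w] rel_grp_relators(3)[of a b A v]
  by (simp_all add: cong_rel_def diff_diff_eq)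

lemma cong_zero:
  "frag_of (\<lambda>p. 0, v) \<approx>\<approx> 0" "a \<in> H \<Longrightarrow> frag_of (a, 0) \<approx>\<approx> 0"
proof -
  have cancel: "x \<approx>\<approx> x + x \<Longrightarrow> x \<approx>\<approx> 0" for x
    using cong_sym[of x "x + x"] by (simp add: cong_rel_def)
  have "(*) 0 = (\<lambda>p. 0 :: pol)" by (rule ext) simp
  then have "(\<lambda>p. 0) \<in> H" using mult_in_cherednik[of 0] by (elim subst)
  then show "frag_of (\<lambda>p. 0, v) \<approx>\<approx> 0" using cong_relators(1)[of "\<lambda>p. 0" "\<lambda>p. 0" v] by (intro cancel) simp
  show "a \<in> H \<Longrightarrow> frag_of (a, 0) \<approx>\<approx> 0" using cong_relators(2)[of a 0 0] by (intro cancel) simp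
qed

text \<open>The tensor with polynomial coefficients on the standard basis. These representatives
  realise the decomposition of the Verma module as polynomials tensored with the lowest weight
  space.\<close>

definition std :: "pol^'n \<Rightarrow> ((pol \<Rightarrow> pol) \<times> (complex^'n)) \<Rightarrow>\<^sub>0 int" where
  "std F = (\<Sum>i\<in>UNIV. frag_of ((*) (F $ i), axis i 1))"

lemma std_add: "std (F + G) \<approx>\<approx> std F + std G"
proof -
  have "std (F + G) \<approx>\<approx> (\<Sum>i\<in>UNIV. frag_of ((*) (F $ i), axis i 1) + frag_of ((*) (G $ i), axis i 1))"
    unfolding std_def
  proof (rule cong_sum)
    fix i
    have eq: "(*) ((F + G) $ i) = (\<lambda>p. F $ i * p + G $ i * p)" by (rule ext) (simp add: distrib_right)
    show "frag_of ((*) ((F + G) $ i), axis i 1) \<approx>\<approx> frag_of ((*) (F $ i), axis i 1) + frag_of ((*) (G $ i), axis i 1)"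
      unfolding eq by (rule cong_relators(1)[OF mult_in_cherednik mult_in_cherednik])
  qed
  then show ?thesis by (simp add: std_def sum.distrib)
qed

lemma frag_of_sum_right:
  assumes "a \<in> H"
  shows "frag_of (a, sum v A) \<approx>\<approx> (\<Sum>i\<in>A. frag_of (a, v i))"
proof (induction A rule: infinite_finite_induct)
  case (insert i A)
  then have "frag_of (a, sum v (insert i A)) \<approx>\<approx> frag_of (a, v i) + frag_of (a, sum v A)"
    using cong_relators(2)[OF assms] by simp
  also have "\<dots> \<approx>\<approx> frag_of (a, v i) + (\<Sum>i\<in>A. frag_of (a, v i))"
    using insert by (intro cong_add) simp_all
  finally show ?case using insert by simp
qed (simp_all add: cong_zero(2)[OF assms])

text \<open>Expanding \<open>v\<close> in the basis and moving its scalar coordinates across the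
  tensor sign, which is permitted since scalars belong to the balancing subalgebra.\<close>

lemma frag_of_std: "frag_of ((*) p, v) \<approx>\<approx> std (p *s vconst v)"
proof -
  have "frag_of ((*) p, \<Sum>i\<in>UNIV. v $ i *s axis i 1) \<approx>\<approx> (\<Sum>i\<in>UNIV. frag_of ((*) p, v $ i *s axis i 1))"
    by (rule frag_of_sum_right[OF mult_in_cherednik])
  then have "frag_of ((*) p, v) \<approx>\<approx> (\<Sum>i\<in>UNIV. frag_of ((*) p, v $ i *s axis i 1))"
    unfolding basis_expansion .
  also have "\<dots> \<approx>\<approx> std (p *s vconst v)" unfolding std_def
  proof (rule cong_sum)
    fix i
    have eq: "(*) ((p *s vconst v) $ i) = (*) p \<circ> scal (v $ i)" by (rule ext) (simp only: vector_smult_component vconst_nth o_apply scal_eq mult.assoc)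
    show "frag_of ((*) p, v $ i *s axis i 1) \<approx>\<approx> frag_of ((*) ((p *s vconst v) $ i), axis i 1)"
      using cong_sym[OF cong_relators(3)[OF mult_in_cherednik[of p] const_rel_scal[of "v $ i"], of "axis i 1"]]
      unfolding eq mat_mult_vec .
  qed
  finally show ?thesis .
qed

definition reduces :: "(((pol \<Rightarrow> pol) \<times> (complex^'n)) \<Rightarrow>\<^sub>0 int) \<Rightarrow> bool" where
  "reduces x \<longleftrightarrow> (\<exists>F. x \<approx>\<approx> std F)"

lemma reduces_cong: "x \<approx>\<approx> y \<Longrightarrow> reduces y \<Longrightarrow> reduces x"
  unfolding reduces_def using cong_trans by (elim exE) (rule exI)

lemma reduces_std: "reduces (std F)" unfolding reduces_def by (rule exI[of _ F]) simp

lemma reduces_add: assumes "reduces x" "reduces y" shows "reduces (x + y)"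
proof -
  obtain F G where "x \<approx>\<approx> std F" "y \<approx>\<approx> std G" using assms unfolding reduces_def by (elim exE)
  then have "x + y \<approx>\<approx> std F + std G" by (rule cong_add)
  also have "\<dots> \<approx>\<approx> std (F + G)" by (rule cong_sym[OF std_add])
  finally show ?thesis unfolding reduces_def by (rule exI)
qed

lemma reduces_zero: "reduces 0"
  by (rule reduces_cong[OF cong_sym[OF cong_zero(2)[OF mult_in_cherednik]] reduces_cong[OF frag_of_std reduces_std]])

lemma reduces_sum: "(\<And>i. i \<in> A \<Longrightarrow> reduces (f i)) \<Longrightarrow> reduces (sum f A)"
  by (induction A rule: infinite_finite_induct) (simp_all add: reduces_add reduces_zero)

abbreviation hact :: "(pol \<Rightarrow> pol) \<Rightarrow> (((pol \<Rightarrow> pol) \<times> (complex^'n)) \<Rightarrow>\<^sub>0 int) \<Rightarrow> ((pol \<Rightarrow> pol) \<times> (complex^'n)) \<Rightarrow>\<^sub>0 int" where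
  "hact r \<equiv> frag_extend (\<lambda>(a, v). frag_of (r \<circ> a, v))"

text \<open>Left multiplication respects every type of relator; for additivity in the left factor
  this uses that elements of the algebra are additive operators.\<close>

lemma hact_rel_grp:
  assumes r: "r \<in> H" and "x \<in> rel_grp"
  shows "hact r x \<in> rel_grp"
  using assms(2) unfolding rel_grp_def
proof (induction rule: generate.induct)
  case one
  then show ?case using rel_grp_closed(1) by (simp add: rel_grp_def)
next
  have main: "hact r x \<in> rel_grp" if "x \<in> tensor_relators (cherednik k) (dunkl_W_alg k) (lowest_module k \<rho>)" for x
    using that unfolding tensor_relators_def
  proof (elim UnE CollectE exE conjE)
    fix a a' v assume x: "x = frag_of (a \<oplus>\<^bsub>cherednik k\<^esub> a', v) - frag_of (a, v) - frag_of (a', v)" "a \<in> H" "a' \<in> H"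
    have eq: "r \<circ> (\<lambda>p. a p + a' p) = (\<lambda>p. (r \<circ> a) p + (r \<circ> a') p)"
      by (rule ext) (simp add: corr_additive(1)[OF corr_Theta[OF r]])
    show ?thesis unfolding x(1) frag_extend_diff frag_extend_of prod.case ring_ops_cherednik eq
      by (rule rel_grp_relators(1)[OF in_cherednik(5)[OF r x(2)] in_cherednik(5)[OF r x(3)]])
  next
    fix a v v' assume x: "x = frag_of (a, v \<oplus>\<^bsub>lowest_module k \<rho>\<^esub> v') - frag_of (a, v) - frag_of (a, v')" "a \<in> H"
    show ?thesis unfolding x(1) frag_extend_diff frag_extend_of prod.case lowest_module_simps
      by (rule rel_grp_relators(2)[OF in_cherednik(5)[OF r x(2)]])
  next
    fix a b v assume x: "x = frag_of (a \<otimes>\<^bsub>cherednik k\<^esub> b, v) - frag_of (a, b \<odot>\<^bsub>lowest_module k \<rho>\<^esub> v)" "a \<in> H"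
      "b \<in> dunkl_W_alg k"
    obtain A where A: "const_rel b A" using const_rel_exists[OF x(3)] by (elim exE)
    show ?thesis unfolding x(1) frag_extend_diff frag_extend_of prod.case lowest_module_simps ring_ops_cherednik
        trivial_ext_eq[OF A] comp_assoc[symmetric]
      by (rule rel_grp_relators(3)[OF in_cherednik(5)[OF r x(2)] A])
  qed
  {
    case (incl h)
    then show ?case by (rule main[unfolded rel_grp_def])
  next
    case (inv h)
    have "h \<in> carrier free_grp" using inv relators_closed by blast
    then have eq: "inv\<^bsub>free_grp\<^esub> h = - h" by (intro inv_free_Abelian_group) simp
    show ?case unfolding eq frag_extend_minus
      using rel_grp_closed(3)[OF main[OF inv]] unfolding rel_grp_def .
  next
    case (eng h1 h2)
    show ?case unfolding mult_free_Abelian_group frag_extend_add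
      using rel_grp_closed(2)[unfolded rel_grp_def, OF eng.IH] .
  }
qed

lemma hact_cong: "r \<in> H \<Longrightarrow> x \<approx>\<approx> y \<Longrightarrow> hact r x \<approx>\<approx> hact r y"
  using hact_rel_grp[of r "x - y"] by (simp only: cong_rel_def frag_extend_diff)

lemma hact_std: "hact r (std F) = (\<Sum>i\<in>UNIV. frag_of (r \<circ> (*) (F $ i), axis i 1))"
  by (simp add: std_def frag_extend_sum o_def)

lemma reduces_const_rel:
  assumes "const_rel b A" shows "reduces (frag_of ((*) q \<circ> b, v))"
  by (rule reduces_cong[OF cong_relators(3)[OF mult_in_cherednik assms] reduces_cong[OF frag_of_std reduces_std]])

lemma frag_of_add_reduces:
  assumes "a \<in> H" "b \<in> H" "reduces (frag_of (a, v))" "reduces (frag_of (b, v))"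
  shows "reduces (frag_of (\<lambda>p. a p + b p, v))"
  by (rule reduces_cong[OF cong_relators(1)[OF assms(1,2)] reduces_add[OF assms(3,4)]])

lemma mult_comp_in: "w \<in> W \<Longrightarrow> (*) q \<circ> wact w \<in> H" "(*) q \<circ> dunkl k y \<in> H"
  by (intro in_cherednik mult_in_cherednik; assumption)+

lemma reduces_wact: assumes "w \<in> W" shows "reduces (frag_of (wact w \<circ> (*) p, v))"
proof -
  have eq: "wact w \<circ> (*) p = (*) (wact w p) \<circ> wact w" by (rule ext) (simp only: o_apply wact_mult)
  show ?thesis unfolding eq by (rule reduces_const_rel[OF const_rel_wact[OF assms]])
qed

lemma reduces_mult: "reduces (frag_of ((*) p, v))"
  by (rule reduces_cong[OF frag_of_std reduces_std])

lemma reduces_dunkl1: "reduces (frag_of (dunkl k e1 \<circ> (*) p, v))"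
proof -
  \<comment> \<open>The sum is nested to the left in exactly the shape of
    \<open>frag_of_add_reduces\<close>. In each term the operator to the right of the polynomial is
    absorbed by the lowest weight space.\<close>
  have eq: "dunkl k e1 \<circ> (*) p = (\<lambda>x. ((\<lambda>x. ((\<lambda>x. ((\<lambda>x. ((*) p \<circ> dunkl k e1) x + (*) (dderiv e1 p) x)) x
       + ((*) (pconst k1 * divdiff e1 p) \<circ> wact s1) x)) x
       + ((*) (pconst k2 * divdiff (e1 + e2) p) \<circ> wact sp) x)) x
       + ((*) (pconst k2 * divdiff (e1 - e2) p) \<circ> wact sm) x)"
    by (rule ext) (simp only: o_apply P.T1_act)
  show ?thesis unfolding eq
    by (rule frag_of_add_reduces; (rule frag_of_add_reduces in_cherednik(4) mult_comp_in mult_in_cherednik basic_refl_in_W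
        reduces_const_rel[OF const_rel_wact] reduces_const_rel[OF const_rel_dunkl] reduces_mult)+)
qed

lemma reduces_dunkl2: "reduces (frag_of (dunkl k e2 \<circ> (*) p, v))"
proof -
  have eq: "dunkl k e2 \<circ> (*) p = (\<lambda>x. ((\<lambda>x. ((\<lambda>x. ((\<lambda>x. ((*) p \<circ> dunkl k e2) x + (*) (dderiv e2 p) x)) x
       + ((*) (pconst k1 * divdiff e2 p) \<circ> wact s2) x)) x
       + ((*) (pconst k2 * divdiff (e1 + e2) p) \<circ> wact sp) x)) x
       + ((*) (- (pconst k2 * divdiff (e1 - e2) p)) \<circ> wact sm) x)"
    by (rule ext) (simp only: o_apply P.T2_act mult_minus_left diff_conv_add_uminus)
  show ?thesis unfolding eq
    by (rule frag_of_add_reduces; (rule frag_of_add_reduces in_cherednik(4) mult_comp_in mult_in_cherednik basic_refl_in_W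
        reduces_const_rel[OF const_rel_wact] reduces_const_rel[OF const_rel_dunkl] reduces_mult)+)
qed

text \<open>The spanning half of the decomposition: group elements and Dunkl operators are moved to
  the right of the polynomials and then act on the lowest weight space.\<close>

lemma hact_reduces:
  assumes "f \<in> H" shows "reduces (hact f (std F))"
proof -
  have mult: "reduces (hact ((*) q) (std F))" for q F
    unfolding hact_std
  proof (rule reduces_sum)
    fix i
    have eq: "(*) q \<circ> (*) (F $ i) = (*) (q * F $ i)" by (rule ext) (simp only: o_apply mult.assoc)
    show "reduces (frag_of ((*) q \<circ> (*) (F $ i), axis i 1))"
      unfolding eq by (rule reduces_cong[OF frag_of_std reduces_std])
  qed
  have comp: "reduces (hact (f \<circ> g) (std F))"
    if fg: "f \<in> H" "\<And>F. reduces (hact f (std F))" "\<And>F. reduces (hact g (std F))" for f g F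
  proof -
    obtain G where G: "hact g (std F) \<approx>\<approx> std G" using fg(3)[of F] unfolding reduces_def by (elim exE)
    have eq: "hact (f \<circ> g) (std F) = hact f (hact g (std F))"
      unfolding hact_std frag_extend_sum[OF finite]
      by (intro sum.cong refl) (simp only: o_apply frag_extend_of prod.case comp_assoc)
    show ?thesis unfolding eq by (rule reduces_cong[OF hact_cong[OF fg(1) G] fg(2)])
  qed
  have add: "reduces (hact (\<lambda>p. f p + g p) (std F))"
    if fg: "f \<in> H" "g \<in> H" "\<And>F. reduces (hact f (std F))" "\<And>F. reduces (hact g (std F))" for f g F
  proof -
    have "hact (\<lambda>p. f p + g p) (std F) \<approx>\<approx> (\<Sum>i\<in>UNIV. frag_of (f \<circ> (*) (F $ i), axis i 1) + frag_of (g \<circ> (*) (F $ i), axis i 1))"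
      unfolding hact_std
    proof (rule cong_sum)
      fix i
      have eq: "(\<lambda>p. f p + g p) \<circ> (*) (F $ i) = (\<lambda>p. (f \<circ> (*) (F $ i)) p + (g \<circ> (*) (F $ i)) p)" by (rule ext) (simp only: o_apply)
      show "frag_of ((\<lambda>p. f p + g p) \<circ> (*) (F $ i), axis i 1) \<approx>\<approx> frag_of (f \<circ> (*) (F $ i), axis i 1) + frag_of (g \<circ> (*) (F $ i), axis i 1)"
        unfolding eq
        by (rule cong_relators(1)[OF in_cherednik(5)[OF fg(1) mult_in_cherednik] in_cherednik(5)[OF fg(2) mult_in_cherednik]])
    qed
    also have "\<dots> = hact f (std F) + hact g (std F)" by (simp only: hact_std sum.distrib)
    finally show ?thesis by (rule reduces_cong[OF _ reduces_add[OF fg(3,4)]])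
  qed
  have wact: "reduces (hact (wact w) (std F))" if "w \<in> W" for w F
    unfolding hact_std by (rule reduces_sum, rule reduces_wact[OF that])
  have dunkl1: "reduces (hact (dunkl k e1) (std F))" for F
    unfolding hact_std by (rule reduces_sum, rule reduces_dunkl1)
  have dunkl2: "reduces (hact (dunkl k e2) (std F))" for F
    unfolding hact_std by (rule reduces_sum, rule reduces_dunkl2)
  have dunkl: "reduces (hact (dunkl k y) (std F))" for y F
  proof -
    have eq: "dunkl k y = (\<lambda>p. ((*) (pconst (y $ 1)) \<circ> dunkl k e1) p + ((*) (pconst (y $ 2)) \<circ> dunkl k e2) p)"
      by (rule ext) (simp only: o_apply dunkl_e[of y])
    show ?thesis unfolding eq
      by (rule add[OF mult_comp_in(2) mult_comp_in(2) comp[OF mult_in_cherednik mult dunkl1]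
            comp[OF mult_in_cherednik mult dunkl2]])
  qed
  show ?thesis using assms unfolding carrier_cherednik
  proof (induction arbitrary: F rule: subalg.induct)
    case (subalg_scal c)
    have eq: "scal c = (*) (pconst c)" by (rule ext) (rule scal_eq)
    show ?case unfolding eq by (rule mult)
  next
    case (subalg_base f)
    then show ?case by (elim UnE imageE rangeE) (simp_all only: mult dunkl wact)
  next
    case (subalg_add f g)
    then show ?case unfolding carrier_cherednik[symmetric] by (rule add)
  next
    case (subalg_comp f g)
    show ?case by (rule comp[OF subalg_comp.hyps(1)[folded carrier_cherednik] subalg_comp.IH])
  qed
qed

text \<open>The independence half: sending the tensor of \<open>a\<close> and \<open>v\<close> to
  the action of \<open>a\<close> on the constant vector \<open>v\<close> respects all relators, so
  congruent tensors have equal images.\<close>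

lemma std_separated:
  obtains \<Psi> :: "(((pol \<Rightarrow> pol) \<times> (complex^'n)) \<Rightarrow>\<^sub>0 int) \<Rightarrow> pol^'n" where
    "\<And>x y. x \<in> carrier free_grp \<Longrightarrow> y \<in> carrier free_grp \<Longrightarrow> \<Psi> (x + y) = \<Psi> x + \<Psi> y"
    "\<And>a v. a \<in> H \<Longrightarrow> \<Psi> (frag_of (a, v)) = Theta a (vconst v)"
    "\<And>x. x \<in> rel_grp \<Longrightarrow> \<Psi> x = 0"
proof -
  let ?G = "\<lparr>carrier = (UNIV :: (pol^'n) set), monoid.mult = (+), one = 0\<rparr>"
  interpret G: comm_group ?G
    by (rule comm_groupI) (auto simp: add_ac intro: exI[of _ "- _"] left_minus)
  obtain \<Psi> where \<Psi>: "\<Psi> \<in> hom free_grp ?G" "\<And>z. z \<in> H \<times> UNIV \<Longrightarrow> \<Psi> (frag_of z) = (\<lambda>(a, v). Theta a (vconst v)) z"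
    using G.free_Abelian_group_universal[of "\<lambda>(a, v). Theta a (vconst v)" "H \<times> (UNIV :: (complex^'n) set)"] by auto
  have add: "\<Psi> (x + y) = \<Psi> x + \<Psi> y" if "x \<in> carrier free_grp" "y \<in> carrier free_grp" for x y
    using hom_mult[OF \<Psi>(1) that] by simp
  have of: "\<Psi> (frag_of (a, v)) = Theta a (vconst v)" if "a \<in> H" for a v
    using \<Psi>(2)[of "(a, v)"] that by simp
  have zero: "\<Psi> 0 = 0" using add[of 0 0] by simp
  have minus: "\<Psi> (- x) = - \<Psi> x" if "x \<in> carrier free_grp" for x
    using add[OF that, of "- x"] that zero by (simp add: eq_neg_iff_add_eq_0 add.commute)
  have of_in: "frag_of (a, v) \<in> carrier free_grp" if "a \<in> H" for a and v :: "complex^'n"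
    using that by (simp add: keys_frag_of)
  have diff: "\<Psi> (x - y) = \<Psi> x - \<Psi> y \<and> x - y \<in> carrier free_grp" if "x \<in> carrier free_grp" "y \<in> carrier free_grp" for x y
    using add[OF that(1), of "- y"] minus[OF that(2)] that keys_diff[of x y] by auto
  have rel: "\<Psi> x = 0" if "x \<in> tensor_relators (cherednik k) (dunkl_W_alg k) (lowest_module k \<rho>)" for x
    using that unfolding tensor_relators_def
  proof (elim UnE CollectE exE conjE)
    fix a a' v assume x: "x = frag_of (a \<oplus>\<^bsub>cherednik k\<^esub> a', v) - frag_of (a, v) - frag_of (a', v)" "a \<in> H" "a' \<in> H"
    note h = of_in[OF in_cherednik(4)[OF x(2,3)]] of_in[OF x(2)] of_in[OF x(3)]
    show ?thesis unfolding x(1) ring_ops_cherednik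
      using diff[OF conjunct2[OF diff[OF h(1,2)]] h(3)] diff[OF h(1,2)] of[OF x(2)] of[OF x(3)] of[OF in_cherednik(4)[OF x(2,3)]]
      by (simp add: Theta_ring(1)[OF x(2,3)])
  next
    fix a v v' assume x: "x = frag_of (a, v \<oplus>\<^bsub>lowest_module k \<rho>\<^esub> v') - frag_of (a, v) - frag_of (a, v')" "a \<in> H"
    note h = of_in[OF x(2)]
    show ?thesis unfolding x(1) lowest_module_simps
      using diff[OF conjunct2[OF diff[OF h h]] h] diff[OF h h] of[OF x(2)]
      by (simp add: vconst_add Theta_add[OF x(2)])
  next
    fix a b v assume x: "x = frag_of (a \<otimes>\<^bsub>cherednik k\<^esub> b, v) - frag_of (a, b \<odot>\<^bsub>lowest_module k \<rho>\<^esub> v)" "a \<in> H"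
      "b \<in> dunkl_W_alg k"
    obtain A where A: "const_rel b A" using const_rel_exists[OF x(3)] by (elim exE)
    then have b: "b \<in> H" "Theta b (vconst v) = vconst (A *v v)" by (simp_all add: const_rel_def)
    have "\<Psi> (frag_of (a \<circ> b, v)) = Theta a (Theta b (vconst v))"
      unfolding of[OF in_cherednik(5)[OF x(2) b(1)]] Theta_ring(2)[OF x(2) b(1)] by (rule o_apply)
    then show ?thesis unfolding x(1) lowest_module_simps ring_ops_cherednik trivial_ext_eq[OF A]
      using diff[OF of_in[OF in_cherednik(5)[OF x(2) b(1)]] of_in[OF x(2)]] of[OF x(2)] b(2) by simp
  qed
  have "\<Psi> x = 0" if "x \<in> rel_grp" for x
    using that unfolding rel_grp_def
  proof (induction rule: generate.induct)
    case one
    then show ?case by (simp add: zero)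
  next
    case (incl h)
    then show ?case by (rule rel)
  next
    case (inv h)
    then have h: "h \<in> carrier free_grp" using relators_closed by blast
    then have "inv\<^bsub>free_grp\<^esub> h = - h" by simp
    then show ?case using minus[OF h] rel[OF inv] by simp
  next
    case (eng h1 h2)
    then have "h1 \<in> carrier free_grp" "h2 \<in> carrier free_grp"
      using rel_grp_closed(5) unfolding rel_grp_def by blast+
    then show ?case using add[of h1 h2] eng.IH by simp
  qed
  with add of show ?thesis by (rule that)
qed

end

section \<open>The Gaussian functional\<close>

context cherednik_module
begin

definition lap :: "'m \<Rightarrow> 'm" where "lap x = T1 (T1 x) + T2 (T2 x)"

text \<open>By \<open>T_refl\<close> the reflection terms from the two squares cancel, leaving the
  commutator of an ordinary Laplacian with a coordinate.\<close>

lemma lap_X1: "lap (X1 \<star> x) = X1 \<star> lap x + 2 \<star> T1 x"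
proof -
  have two: "2 \<star> y = y + y" for y using scale_left_distrib[of 1 1 y] by simp
  show ?thesis unfolding two lap_def by (simp add: T_simps T_refl algebra_simps)
qed

lemma lap_X2: "lap (X2 \<star> x) = X2 \<star> lap x + 2 \<star> T2 x"
proof -
  have two: "2 \<star> y = y + y" for y using scale_left_distrib[of 1 1 y] by simp
  show ?thesis unfolding two lap_def by (simp add: T_simps T_refl algebra_simps)
qed

lemma lap_add: "lap (x + y) = lap x + lap y"
  by (simp add: lap_def T1_add T2_add add_ac)

lemma lap_0 [simp]: "lap 0 = 0"
  by (simp add: lap_def)

lemma lap_T1: "lap (T1 x) = T1 (lap x)" and lap_T2: "lap (T2 x) = T2 (lap x)"
  by (simp_all add: lap_def T1_add T2_add T1_T2)

lemma lap_const: "lap (pconst c \<star> x) = pconst c \<star> lap x"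
  by (simp add: lap_def T1_const T2_const scale_right_distrib)

lemma lap_wa: "w \<in> W \<Longrightarrow> lap (wa w x) = wa w (lap x)"
proof (induction arbitrary: x rule: W_induct')
  case one
  then show ?case by simp
next
  case (s1 w)
  have "lap (wa s1 y) = wa s1 (lap y)" for y
    by (simp add: lap_def T_refl T1_minus T2_minus wa_add wa_minus)
  then show ?case unfolding wa_wa[OF basic_refl_in_W(1) s1(1), symmetric] s1(2)[symmetric] .
next
  case (s2 w)
  have "lap (wa s2 y) = wa s2 (lap y)" for y
    by (simp add: lap_def T_refl T1_minus T2_minus wa_add wa_minus)
  then show ?case unfolding wa_wa[OF basic_refl_in_W(2) s2(1), symmetric] s2(2)[symmetric] .
next
  case (sm w)
  have "lap (wa sm y) = wa sm (lap y)" for y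
    by (simp add: lap_def T_refl wa_add add.commute)
  then show ?case unfolding wa_wa[OF basic_refl_in_W(3) sm(1), symmetric] sm(2)[symmetric] .
next
  case (sp w)
  have "lap (wa sp y) = wa sp (lap y)" for y
    by (simp add: lap_def T_refl T1_minus T2_minus wa_add wa_minus add.commute)
  then show ?case unfolding wa_wa[OF basic_refl_in_W(4) sp(1), symmetric] sp(2)[symmetric] .
qed

lemma lap_pow_0 [simp]: "(lap ^^ m) 0 = 0"
  by (induction m) simp_all

lemma lap_pow_add: "(lap ^^ m) (x + y) = (lap ^^ m) x + (lap ^^ m) y"
  by (induction m) (simp_all add: lap_add)

lemma lap_pow_const: "(lap ^^ m) (pconst c \<star> x) = pconst c \<star> (lap ^^ m) x"
  by (induction m) (simp_all add: lap_const del: scale_scale)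

lemma lap_pow_wa: "w \<in> W \<Longrightarrow> (lap ^^ m) (wa w x) = wa w ((lap ^^ m) x)"
  by (induction m) (simp_all add: lap_wa)

lemma lap_pow_T: "(lap ^^ m) (T1 x) = T1 ((lap ^^ m) x)" "(lap ^^ m) (T2 x) = T2 ((lap ^^ m) x)"
  by (induction m) (simp_all add: lap_T1 lap_T2)

text \<open>Since \<open>lap\<close> commutes with \<open>T1\<close> and \<open>T2\<close>, each
  further power contributes the same term.\<close>

lemma lap_pow_X1: "(lap ^^ Suc m) (X1 \<star> x) = X1 \<star> (lap ^^ Suc m) x + pconst (2 * of_nat (Suc m)) \<star> T1 ((lap ^^ m) x)"
  and lap_pow_X2: "(lap ^^ Suc m) (X2 \<star> x) = X2 \<star> (lap ^^ Suc m) x + pconst (2 * of_nat (Suc m)) \<star> T2 ((lap ^^ m) x)"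
proof -
  have two: "2 = pconst 2" by (simp add: pconst_numeral)
  have step: "pconst (2 * of_nat (Suc (Suc m))) = pconst 2 + pconst (2 * of_nat (Suc m))" for m
    unfolding pconst_add[symmetric] by (simp add: algebra_simps)
  show "(lap ^^ Suc m) (X1 \<star> x) = X1 \<star> (lap ^^ Suc m) x + pconst (2 * of_nat (Suc m)) \<star> T1 ((lap ^^ m) x)"
  proof (induction m)
    case 0
    then show ?case by (simp add: lap_X1 two)
  next
    case (Suc m)
    have "(lap ^^ Suc (Suc m)) (X1 \<star> x) = lap ((lap ^^ Suc m) (X1 \<star> x))" by simp
    also have "\<dots> = X1 \<star> lap ((lap ^^ Suc m) x) + pconst 2 \<star> T1 ((lap ^^ Suc m) x) + pconst (2 * of_nat (Suc m)) \<star> T1 (lap ((lap ^^ m) x))"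
      unfolding Suc lap_add lap_const lap_X1 lap_T1 two ..
    finally show ?case unfolding step scale_left_distrib by (simp add: add.assoc)
  qed
  show "(lap ^^ Suc m) (X2 \<star> x) = X2 \<star> (lap ^^ Suc m) x + pconst (2 * of_nat (Suc m)) \<star> T2 ((lap ^^ m) x)"
  proof (induction m)
    case 0
    then show ?case by (simp add: lap_X2 two)
  next
    case (Suc m)
    have "(lap ^^ Suc (Suc m)) (X2 \<star> x) = lap ((lap ^^ Suc m) (X2 \<star> x))" by simp
    also have "\<dots> = X2 \<star> lap ((lap ^^ Suc m) x) + pconst 2 \<star> T2 ((lap ^^ Suc m) x) + pconst (2 * of_nat (Suc m)) \<star> T2 (lap ((lap ^^ m) x))"
      unfolding Suc lap_add lap_const lap_X2 lap_T2 two ..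
    finally show ?case unfolding step scale_left_distrib by (simp add: add.assoc)
  qed
qed

lemma lap_nilpotent: "\<exists>M. \<forall>m\<ge>M. (lap ^^ m) x = 0"
proof (induction x rule: m_induct)
  case (base v)
  have "(lap ^^ m) v = 0" if "m \<ge> 1" for m
    using that base by (cases m) (simp_all add: funpow_swap1 lap_def T_V0)
  then show ?case by blast
next
  case (X1 x)
  then obtain M where M: "\<And>m. m \<ge> M \<Longrightarrow> (lap ^^ m) x = 0" by blast
  have "(lap ^^ m) (X1 \<star> x) = 0" if "m \<ge> Suc M" for m
  proof -
    obtain l where l: "m = Suc l" "l \<ge> M" using \<open>m \<ge> Suc M\<close> by (cases m) simp_all
    show ?thesis unfolding l(1) lap_pow_X1 using M[of l] M[of "Suc l"] l(2) by simp
  qed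
  then show ?case by blast
next
  case (X2 x)
  then obtain M where M: "\<And>m. m \<ge> M \<Longrightarrow> (lap ^^ m) x = 0" by blast
  have "(lap ^^ m) (X2 \<star> x) = 0" if "m \<ge> Suc M" for m
  proof -
    obtain l where l: "m = Suc l" "l \<ge> M" using \<open>m \<ge> Suc M\<close> by (cases m) simp_all
    show ?thesis unfolding l(1) lap_pow_X2 using M[of l] M[of "Suc l"] l(2) by simp
  qed
  then show ?case by blast
next
  case (add x y)
  then obtain M M' where M: "\<And>m. m \<ge> M \<Longrightarrow> (lap ^^ m) x = 0" "\<And>m. m \<ge> M' \<Longrightarrow> (lap ^^ m) y = 0" by blast
  then have "(lap ^^ m) (x + y) = 0" if "m \<ge> max M M'" for m
    using that by (simp add: lap_pow_add)
  then show ?case by blast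
qed

lemma stable_lap_pow: "stable N \<Longrightarrow> x \<in> N \<Longrightarrow> (lap ^^ m) x \<in> N"
  by (induction m) (simp_all add: lap_def stableD)

end

section \<open>The functional on polynomials and integration by parts\<close>

definition pol_const_coeff :: "pol \<Rightarrow> complex" where
  "pol_const_coeff p = coeff (coeff p 0) 0"

lemma pol_const_coeff_simps [simp]:
  "pol_const_coeff (pconst c) = c" "pol_const_coeff (X1 * p) = 0" "pol_const_coeff (X2 * p) = 0"
  "pol_const_coeff (p + q) = pol_const_coeff p + pol_const_coeff q" "pol_const_coeff 0 = 0"
  "pol_const_coeff (pconst c * p) = c * pol_const_coeff p"
  by (simp_all add: pol_const_coeff_def pconst_def X1_def X2_def coeff_mult)

lemma pol_const_coeff_wact: "w \<in> W \<Longrightarrow> pol_const_coeff (wact w p) = pol_const_coeff p"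
  by (induction p rule: pol_induct) (simp_all add: wact_X1 wact_X2 distrib_right mult.assoc)

abbreviation uu :: pol where "uu \<equiv> X1\<^sup>2 + X2\<^sup>2"
text \<open>\<open>qq\<close> changes sign under both long reflections and is fixed by the short
  ones. Its square equals \<open>uu^2 - 4 * X1^2 * X2^2\<close>, so it can replace the quartic
  invariant, and it leads to moments that factor.\<close>

abbreviation qq :: pol where "qq \<equiv> X1\<^sup>2 - X2\<^sup>2"

lemma dderiv_diff: "dderiv y (a - b) = dderiv y a - dderiv y b"
  using dderiv_add[of y "a - b" b] by simp

lemma dderiv_power_Suc: "dderiv y (p ^ Suc n) = of_nat (Suc n) * (p ^ n * dderiv y p)"
proof (induction n)
  case (Suc n)
  have "dderiv y (p ^ Suc (Suc n)) = p * dderiv y (p ^ Suc n) + dderiv y p * p ^ Suc n"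
    unfolding power_Suc[of p "Suc n"] by (rule dderiv_mult)
  then show ?case unfolding Suc by (simp add: algebra_simps)
qed simp

lemma dderiv_qq: "dderiv e1 qq = 2 * X1" "dderiv e2 qq = - (2 * X2)"
  by (simp_all add: dderiv_diff dderiv_mult power2_eq_square e_entries algebra_simps)

context dunkl_multiplicity
begin

text \<open>All four reflections fix the constants, which gives the scalar
  \<open>2 * (k1 + k2)\<close>.\<close>

lemma pol_graded_cherednik_module:
  "graded_cherednik_module (*) k1 k2 wact (dunkl k e1) (dunkl k e2) (range pconst)
    (2 * (k1 + k2)) (\<lambda>p. pconst (pol_const_coeff p))"
proof (rule graded_cherednik_module.intro[OF pol_cherednik_module], rule graded_cherednik_module_axioms.intro)
  fix v assume "v \<in> range pconst"
  then obtain b where v: "v = pconst b" by (elim rangeE)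
  show "pconst k1 * (wact s1 v + wact s2 v) + pconst k2 * (wact sp v + wact sm v) = pconst (2 * (k1 + k2)) * v"
    unfolding v wact_const pconst_mult[symmetric] pconst_add[symmetric]
    by (rule arg_cong[where f = pconst]) (simp add: algebra_simps)
next
  fix u v assume "u \<in> range pconst" "v \<in> range pconst"
  then obtain a b where uv: "u = pconst a" "v = pconst b" by (elim rangeE)
  show "u + v \<in> range pconst" unfolding uv pconst_add[symmetric] by (rule rangeI)
next
  fix x y show "pconst (pol_const_coeff (x + y)) = pconst (pol_const_coeff x) + pconst (pol_const_coeff y)"
    unfolding pol_const_coeff_simps by (rule pconst_add)
next
  fix v assume "v \<in> range pconst"
  then show "pconst (pol_const_coeff v) = v" by (elim rangeE) (simp only: pol_const_coeff_simps)
next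
  fix v and N :: "pol set"
  assume v: "v \<in> range pconst" "v \<noteq> 0" "v \<in> N" and c: "\<And>a x. x \<in> N \<Longrightarrow> pconst a * x \<in> N"
  obtain b where b: "v = pconst b" using v(1) by (elim rangeE)
  then have "b \<noteq> 0" using v(2) by auto
  have "pconst a \<in> N" for a
    using c[OF v(3), of "a / b"] \<open>b \<noteq> 0\<close> unfolding b pconst_mult[symmetric] by simp
  then show "range pconst \<subseteq> N" by (intro image_subsetI)
next
  show "\<exists>v\<in>range pconst. v \<noteq> 0" by (rule bexI[of _ "pconst 1"], simp, rule rangeI)
qed (simp_all only: pol_const_coeff_simps pconst_0)

sublocale P: graded_cherednik_module "(*)" k1 k2 wact "dunkl k e1" "dunkl k e2" "range pconst"
  "2 * (k1 + k2)" "\<lambda>p. pconst (pol_const_coeff p)"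
  by (rule pol_graded_cherednik_module)

declare P.scale_scale [simp del]

text \<open>The constant term of exp(lap / 2) applied to \<open>p\<close>; for \<open>k = 0\<close>
  this is the expectation under the standard Gaussian. The series is finite because
  \<open>lap\<close> is locally nilpotent.\<close>

definition Phi :: "pol \<Rightarrow> complex" where
  "Phi p = suminf (\<lambda>m. pol_const_coeff ((P.lap ^^ m) p) / (2 ^ m * fact m))"

lemma Phi_eq:
  assumes "\<forall>m\<ge>M. (P.lap ^^ m) p = 0"
  shows "Phi p = (\<Sum>m<M. pol_const_coeff ((P.lap ^^ m) p) / (2 ^ m * fact m))"
  unfolding Phi_def by (rule suminf_finite) (simp_all add: assms)

lemma Phi_add: "Phi (p + q) = Phi p + Phi q"
proof -
  obtain M M' where M: "\<forall>m\<ge>M. (P.lap ^^ m) p = 0" "\<forall>m\<ge>M'. (P.lap ^^ m) q = 0"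
    using P.lap_nilpotent by blast
  define L where "L = max M M'"
  have z: "\<forall>m\<ge>L. (P.lap ^^ m) p = 0" "\<forall>m\<ge>L. (P.lap ^^ m) q = 0" using M by (simp_all add: L_def)
  then have "\<forall>m\<ge>L. (P.lap ^^ m) (p + q) = 0" by (simp add: P.lap_pow_add)
  from Phi_eq[OF this] show ?thesis
    unfolding Phi_eq[OF z(1)] Phi_eq[OF z(2)] by (simp add: P.lap_pow_add add_divide_distrib sum.distrib)
qed

lemma Phi_const: "Phi (pconst c * p) = c * Phi p"
proof -
  obtain M where M: "\<forall>m\<ge>M. (P.lap ^^ m) p = 0" using P.lap_nilpotent by blast
  then have "\<forall>m\<ge>M. (P.lap ^^ m) (pconst c * p) = 0" by (simp add: P.lap_pow_const)
  from Phi_eq[OF this] show ?thesis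
    unfolding Phi_eq[OF M] by (simp add: P.lap_pow_const sum_distrib_left)
qed

lemma dunkl_1: "dunkl k e1 1 = 0" "dunkl k e2 1 = 0"
  using P.T_V0[OF rangeI[of pconst 1]] by simp_all

lemma Phi_0 [simp]: "Phi 0 = 0" using Phi_const[of 0 0] by simp

lemma Phi_minus: "Phi (- p) = - Phi p" using Phi_const[of "- 1" p] by (simp add: pconst_minus)

lemma Phi_diff: "Phi (p - q) = Phi p - Phi q"
  by (simp only: diff_conv_add_uminus Phi_add Phi_minus)

lemma Phi_1: "Phi 1 = 1"
proof -
  have "P.lap 1 = 0" by (simp add: P.lap_def dunkl_1)
  then have "\<forall>m\<ge>1. (P.lap ^^ m) 1 = 0"
    using P.lap_pow_0 by (intro allI impI, case_tac m) (simp_all add: funpow_swap1)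
  from Phi_eq[OF this] show ?thesis using pol_const_coeff_simps(1)[of 1] by simp
qed

lemma Phi_wact: "w \<in> W \<Longrightarrow> Phi (wact w p) = Phi p"
  by (simp add: Phi_def P.lap_pow_wa pol_const_coeff_wact)

text \<open>Integration by parts for the Gaussian. The term with \<open>X\<close> on the left has no
  constant coefficient, and the commutator term \<open>2 * (m + 1)\<close> turns the weight of index
  \<open>m + 1\<close> into that of index \<open>m\<close>. Treating \<open>(X, D)\<close> as a pair
  covers both coordinates.\<close>

lemma Phi_parts:
  fixes X D
  assumes "(X, D) = (X1, dunkl k e1) \<or> (X, D) = (X2, dunkl k e2)"
  shows "Phi (X * p) = Phi (D p)"
proof -
  have X: "(P.lap ^^ Suc m) (X * p) = X * (P.lap ^^ Suc m) p + pconst (2 * of_nat (Suc m)) * D ((P.lap ^^ m) p)" for m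
    using assms P.lap_pow_X1[of m p] P.lap_pow_X2[of m p] by auto
  have D: "(P.lap ^^ m) (D p) = D ((P.lap ^^ m) p)" for m
    using assms P.lap_pow_T[of m p] by auto
  have c: "pol_const_coeff (X * r) = 0" "D 0 = 0" for r
    using assms P.T1_0 P.T2_0 by auto
  obtain M where M: "\<forall>m\<ge>M. (P.lap ^^ m) p = 0" using P.lap_nilpotent by blast
  have "(P.lap ^^ m) (X * p) = 0" if "m \<ge> Suc M" for m
  proof -
    obtain l where l: "m = Suc l" "l \<ge> M" using \<open>m \<ge> Suc M\<close> by (cases m) simp_all
    have "(P.lap ^^ l) p = 0" "(P.lap ^^ Suc l) p = 0" using M l(2) le_SucI by blast+
    then show ?thesis unfolding l(1) X by (simp only: c(2) mult_zero_right add_0_left)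
  qed
  then have XM: "\<forall>m\<ge>Suc M. (P.lap ^^ m) (X * p) = 0" by blast
  have DM: "\<forall>m\<ge>M. (P.lap ^^ m) (D p) = 0" using M by (simp add: D c(2))
  from Phi_eq[OF XM]
  have "Phi (X * p) = pol_const_coeff (X * p) + (\<Sum>m<M. pol_const_coeff ((P.lap ^^ Suc m) (X * p)) / (2 ^ Suc m * fact (Suc m)))"
    by (simp only: sum.lessThan_Suc_shift) simp
  also have "\<dots> = (\<Sum>m<M. pol_const_coeff (D ((P.lap ^^ m) p)) / (2 ^ m * fact m))"
    unfolding X c(1) pol_const_coeff_simps add_0_left
  proof (intro sum.cong refl)
    fix m
    have "of_nat (Suc m) \<noteq> (0 :: complex)" by (rule of_nat_neq_0)
    then show "2 * of_nat (Suc m) * pol_const_coeff (D ((P.lap ^^ m) p)) / (2 ^ Suc m * fact (Suc m))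
      = pol_const_coeff (D ((P.lap ^^ m) p)) / (2 ^ m * fact m)"
      unfolding fact_Suc power_Suc by (simp add: field_simps del: of_nat_Suc)
  qed
  also have "\<dots> = Phi (D p)"
    unfolding Phi_eq[OF DM] D ..
  finally show ?thesis .
qed

lemma Phi_X1: "Phi (X1 * p) = Phi (dunkl k e1 p)" and Phi_X2: "Phi (X2 * p) = Phi (dunkl k e2 p)"
  by (auto intro: Phi_parts)

text \<open>A proper stable subspace is preserved by \<open>lap\<close>, and by the grading its
  elements have no constant term.\<close>

lemma Phi_proper: assumes "P.stable N" "N \<noteq> UNIV" "p \<in> N" shows "Phi p = 0"
proof -
  have "pol_const_coeff ((P.lap ^^ m) p) = 0" for m
    using P.proper_c0[OF assms(1,2) P.stable_lap_pow[OF assms(1,3)]] by simp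
  then show ?thesis by (simp add: Phi_def)
qed

subsection \<open>Moments of the Gaussian functional\<close>

definition deg_op :: "pol \<Rightarrow> pol" where "deg_op p = X1 * dderiv e1 p + X2 * dderiv e2 p"

lemma deg_op_mult: "deg_op (p * q) = p * deg_op q + deg_op p * q"
  by (simp add: deg_op_def dderiv_mult algebra_simps)

lemma deg_op_base: "deg_op uu = 2 * uu" "deg_op qq = 2 * qq"
proof -
  have d: "dderiv y (a - b) = dderiv y a - dderiv y b" for y a b
    using dderiv_add[of y "a - b" b] by simp
  show "deg_op uu = 2 * uu" "deg_op qq = 2 * qq"
    by (simp_all add: deg_op_def d dderiv_add dderiv_mult power2_eq_square e_entries algebra_simps)
qed

lemma deg_op_1: "deg_op 1 = 0"
  using dderiv_const[of e1 1] dderiv_const[of e2 1] by (simp add: deg_op_def)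

lemma deg_op_pow:
  assumes "deg_op r = 2 * r" shows "deg_op (r ^ m) = of_nat (2 * m) * r ^ m"
proof (induction m)
  case 0
  then show ?case by (simp add: deg_op_1)
next
  case (Suc m)
  then show ?case by (simp add: deg_op_mult assms algebra_simps)
qed

lemma invariant_pow: "P.invariant (uu ^ m * qq ^ (2 * a))"
proof -
  have qq: "wact w (qq\<^sup>2) = qq\<^sup>2" if "w \<in> W" for w
  proof -
    have eq: "qq\<^sup>2 = uu\<^sup>2 - pconst 4 * (X1\<^sup>2 * X2\<^sup>2)"
      by (simp add: pconst_numeral power2_eq_square algebra_simps)
    show ?thesis using P.invariant_quadratic P.invariant_quartic that
      unfolding eq P.invariant_def by (simp only: wact_diff wact_mult wact_power wact_const) 
  qed
  then show ?thesis using P.invariant_quadratic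
    unfolding P.invariant_def power_mult by (simp only: wact_mult wact_power) simp
qed

definition hbar :: complex where "hbar = 2 * (k1 + k2) + 1"

text \<open>Integration by parts replaces \<open>uu * p\<close> by
  \<open>T1 (X1 * p) + T2 (X2 * p)\<close>. On an invariant \<open>p\<close> this is its degree plus
  \<open>2 + 4 * k1 + 4 * k2\<close>, that is, plus \<open>2 * hbar\<close>.\<close>

lemma Phi_uu:
  "Phi (uu ^ Suc m * qq ^ (2 * a)) = (2 * of_nat m + 4 * of_nat a + 2 * hbar) * Phi (uu ^ m * qq ^ (2 * a))"
proof -
  define p where "p = uu ^ m * qq ^ (2 * a)"
  have inv: "P.invariant p" unfolding p_def by (rule invariant_pow)
  have s: "wact s1 p = p" "wact s2 p = p" "wact sm p = p" "wact sp p = p"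
    using inv by (simp_all add: P.invariant_def)
  have D: "dunkl k e1 p = dderiv e1 p" "dunkl k e2 p = dderiv e2 p"
    using P.T_act_invariant[OF inv, of 1] by (simp_all add: dunkl_1)
  have "deg_op p = of_nat (2 * m + 4 * a) * p"
    unfolding p_def deg_op_mult deg_op_pow[OF deg_op_base(1)] deg_op_pow[OF deg_op_base(2)] by (simp add: algebra_simps)
  then have deg: "X1 * dderiv e1 p + X2 * dderiv e2 p = pconst (of_nat (2 * m + 4 * a)) * p"
    unfolding deg_op_def pconst_of_nat .
  have "uu * p = X1 * (X1 * p) + X2 * (X2 * p)" by (simp add: power2_eq_square algebra_simps)
  then have "Phi (uu * p) = Phi (dunkl k e1 (X1 * p)) + Phi (dunkl k e2 (X2 * p))"
    by (simp only: Phi_add Phi_X1 Phi_X2)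
  also have "\<dots> = Phi (dunkl k e1 (X1 * p) + dunkl k e2 (X2 * p))" by (rule Phi_add[symmetric])
  also have "dunkl k e1 (X1 * p) + dunkl k e2 (X2 * p) = pconst (of_nat (2 * m + 4 * a) + 2 * hbar) * p"
    unfolding P.T1_X1 P.T2_X2 s D pconst_add distrib_right deg[symmetric]
    by (simp add: hbar_def pconst_add pconst_mult pconst_numeral algebra_simps)
  also have "Phi \<dots> = (of_nat (2 * m + 4 * a) + 2 * hbar) * Phi p" by (rule Phi_const)
  finally show ?thesis unfolding p_def by (simp add: mult.assoc)
qed

text \<open>One factor \<open>qq\<close> is expanded and integrated by parts against the odd power
  \<open>p\<close>. The commutator terms of the two coordinates cancel, and since \<open>p\<close>
  is odd under the long reflections, its divided differences add \<open>4 * k2\<close> to the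
  derivative. What remains is a multiple of \<open>uu * r\<close>, handled by
  \<open>Phi_uu\<close>.\<close>

lemma Phi_qq:
  "Phi (qq ^ (2 * Suc a)) = (4 * of_nat a + 2 + 4 * k2) * (4 * of_nat a + 2 * hbar) * Phi (qq ^ (2 * a))"
proof -
  define r where "r = qq ^ (2 * a)"
  define p where "p = qq * r"
  have r: "wact s1 r = r" "wact s2 r = r" "wact sm r = r" "wact sp r = r"
  proof -
    have "P.invariant r" using invariant_pow[of 0 a] unfolding r_def by simp
    then show "wact s1 r = r" "wact s2 r = r" "wact sm r = r" "wact sp r = r"
      by (simp_all add: P.invariant_def)
  qed
  have p: "wact s1 p = p" "wact s2 p = p" "wact sm p = - p" "wact sp p = - p"
    by (simp_all add: p_def r minus_mult_left)
  have p_pow: "p = qq ^ Suc (2 * a)" by (simp add: p_def r_def)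
  have dp: "dderiv e1 p = of_nat (4 * a + 2) * X1 * r" "dderiv e2 p = - of_nat (4 * a + 2) * X2 * r"
    unfolding p_pow dderiv_power_Suc dderiv_qq r_def[symmetric] by (simp_all add: algebra_simps)
  have dd: "divdiff e1 p = 0" "divdiff e2 p = 0" "divdiff (e1 + e2) p = 2 * (X1 - X2) * r" "divdiff (e1 - e2) p = 2 * (X1 + X2) * r"
  proof -
    show "divdiff e1 p = 0" "divdiff e2 p = 0" by (simp_all add: divdiff_invariant p)
    show "divdiff (e1 + e2) p = 2 * (X1 - X2) * r"
      by (rule divdiffI) (simp_all add: p p_def r lin_add lin_e1 lin_e2 power2_eq_square algebra_simps)
    show "divdiff (e1 - e2) p = 2 * (X1 + X2) * r"
      by (rule divdiffI) (simp_all add: p p_def r lin_diff lin_e1 lin_e2 power2_eq_square algebra_simps)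
  qed
  note one = dunkl_1
  define t where "t = pconst (of_nat (4 * a + 2) + 4 * k2)"
  have t: "t = of_nat (4 * a + 2) + 4 * pconst k2" unfolding t_def pconst_add pconst_mult pconst_numeral pconst_of_nat ..
  have D: "dunkl k e1 p = t * (X1 * r)" "dunkl k e2 p = - t * (X2 * r)"
    using P.T1_act[of p 1] P.T2_act[of p 1] unfolding one dp dd t by (simp_all add: algebra_simps)
  have "qq ^ (2 * Suc a) = X1 * (X1 * p) - X2 * (X2 * p)"
    by (simp add: p_def r_def power2_eq_square algebra_simps)
  then have "Phi (qq ^ (2 * Suc a)) = Phi (dunkl k e1 (X1 * p) - dunkl k e2 (X2 * p))"
    by (simp only: Phi_diff Phi_X1 Phi_X2)
  also have "dunkl k e1 (X1 * p) - dunkl k e2 (X2 * p) = t * (uu * r)"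
    unfolding P.T1_X1 P.T2_X2 p D by (simp add: power2_eq_square algebra_simps)
  also have "Phi \<dots> = (of_nat (4 * a + 2) + 4 * k2) * Phi (uu * r)" unfolding t_def by (rule Phi_const)
  also have "Phi (uu * r) = (4 * of_nat a + 2 * hbar) * Phi r"
    using Phi_uu[of 0 a] by (simp add: r_def)
  finally show ?thesis by (simp add: r_def)
qed

lemma Phi_moments:
  "Phi (uu ^ m * qq ^ (2 * a)) = (\<Prod>i<m. 2 * of_nat i + 4 * of_nat a + 2 * hbar) *
     (\<Prod>i<a. (4 * of_nat i + 2 + 4 * k2) * (4 * of_nat i + 2 * hbar))"
proof (induction m)
  case 0
  show ?case
  proof (induction a)
    case 0
    then show ?case by (simp add: Phi_1)
  next
    case (Suc a)
    then show ?case using Phi_qq[of a] by simp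
  qed
next
  case (Suc m)
  then show ?case unfolding Phi_uu by simp
qed

lemma Phi_moments_zero:
  "Phi (uu ^ m * qq ^ (2 * a)) = 0 \<longleftrightarrow>
    (\<exists>i<m. 2 * of_nat i + 4 * of_nat a + 2 * hbar = 0) \<or>
    (\<exists>i<a. 4 * of_nat i + 2 + 4 * k2 = 0 \<or> 4 * of_nat i + 2 * hbar = 0)"
  unfolding Phi_moments by (auto simp: prod_zero_iff)

end

context dunkl_multiplicity
begin

section \<open>The criterion for polynomials\<close>

text \<open>The radical of the symmetric form given by \<open>Phi\<close> of the product.\<close>

definition Phi_kernel :: "pol set" where "Phi_kernel = {q. \<forall>p. Phi (p * q) = 0}"

lemma Phi_kernel_wact:
  assumes "q \<in> Phi_kernel" "w \<in> W" shows "wact w q \<in> Phi_kernel"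
  unfolding Phi_kernel_def
proof (intro CollectI allI)
  fix p
  have "wact w (wact (transpose w) p) = p"
    using W_orthogonal[OF assms(2)] by (simp add: wact_comp assms(2) transpose_in_W wact_one)
  then have "p * wact w q = wact w (wact (transpose w) p * q)" by simp
  then show "Phi (p * wact w q) = 0" using assms by (simp add: Phi_wact Phi_kernel_def del: wact_mult)
qed

text \<open>Integration by parts shows that \<open>Phi\<close> kills the Dunkl operator applied to
  \<open>p * q\<close>. In its Leibniz expansion every term except \<open>p\<close> times the Dunkl
  derivative of \<open>q\<close> contains \<open>q\<close> or a reflection of \<open>q\<close>, and
  vanishes.\<close>

lemma Phi_kernel_dunkl:
  assumes q: "q \<in> Phi_kernel"
  shows "dunkl k e1 q \<in> Phi_kernel" "dunkl k e2 q \<in> Phi_kernel"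
proof -
  have z: "Phi (p * q) = 0" for p using q by (simp add: Phi_kernel_def)
  have zw: "Phi (p * wact w q) = 0" if "w \<in> W" for p w
    using Phi_kernel_wact[OF q that] by (simp add: Phi_kernel_def)
  have "Phi (p * dunkl k e1 q) = 0" "Phi (p * dunkl k e2 q) = 0" for p
  proof -
    have 0: "Phi (dunkl k e1 (p * q)) = 0" "Phi (dunkl k e2 (p * q)) = 0"
      unfolding Phi_X1[symmetric] Phi_X2[symmetric] mult.assoc[symmetric] by (rule z)+
    show "Phi (p * dunkl k e1 q) = 0"
      using 0(1) unfolding P.T1_act Phi_add by (simp add: z zw)
    show "Phi (p * dunkl k e2 q) = 0"
      using 0(2) unfolding P.T2_act Phi_add Phi_diff by (simp add: z zw)
  qed
  then show "dunkl k e1 q \<in> Phi_kernel" "dunkl k e2 q \<in> Phi_kernel" by (simp_all add: Phi_kernel_def)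
qed

lemma stable_Phi_kernel: "P.stable Phi_kernel"
  unfolding P.stable_def
proof (intro conjI ballI allI)
  show "0 \<in> Phi_kernel" by (simp add: Phi_kernel_def)
  show "x + y \<in> Phi_kernel" if "x \<in> Phi_kernel" "y \<in> Phi_kernel" for x y
    using that by (simp add: Phi_kernel_def distrib_left Phi_add)
  show "p * x \<in> Phi_kernel" if "x \<in> Phi_kernel" for p x
    using that by (simp add: Phi_kernel_def flip: mult.assoc)
qed (simp_all add: Phi_kernel_wact Phi_kernel_dunkl)

lemma Phi_kernel_proper: "Phi_kernel \<noteq> UNIV"
proof
  assume "Phi_kernel = UNIV"
  then have "1 \<in> Phi_kernel" by simp
  then have "Phi (1 * 1) = 0" unfolding Phi_kernel_def by blast
  then show False by (simp add: Phi_1)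
qed

section \<open>Ideals of finite codimension spanned by parity-adapted monomials\<close>

abbreviation gen :: "bool \<Rightarrow> bool \<Rightarrow> nat \<Rightarrow> nat \<Rightarrow> pol" where
  "gen a b m n \<equiv> (if a then X1 else 1) * (if b then X2 else 1) * uu ^ m * qq ^ n"

text \<open>Since \<open>X1^2\<close> and \<open>X2^2\<close> are combinations of \<open>uu\<close>
  and \<open>qq\<close>, these products with at most one extra \<open>X1\<close> and one extra
  \<open>X2\<close> span all polynomials. Multiplying never lowers \<open>m + n\<close>, so bounding
  it below gives an ideal, and only finitely many generators are left out.\<close>

inductive_set high :: "nat \<Rightarrow> pol set" for d where
  high_gen: "m + n \<ge> d \<Longrightarrow> pconst c * gen a b m n \<in> high d"
| high_add: "p \<in> high d \<Longrightarrow> q \<in> high d \<Longrightarrow> p + q \<in> high d"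

lemma X_squares: "X1\<^sup>2 = pconst (1/2) * (uu + qq)" "X2\<^sup>2 = pconst (1/2) * (uu - qq)"
proof -
  have half: "pconst (1/2) * pconst 2 = 1" unfolding pconst_mult[symmetric] by simp
  have "uu + qq = pconst 2 * X1\<^sup>2" "uu - qq = pconst 2 * X2\<^sup>2" by (simp_all add: pconst_numeral)
  then show "X1\<^sup>2 = pconst (1/2) * (uu + qq)" "X2\<^sup>2 = pconst (1/2) * (uu - qq)"
    by (simp_all only: mult.assoc[symmetric] half mult_1_left)
qed

lemma high_X1: "p \<in> high d \<Longrightarrow> X1 * p \<in> high d"
proof (induction rule: high.induct)
  case (high_gen m n c a b)
  show ?case
  proof (cases a)
    case False
    then show ?thesis using high.high_gen[OF high_gen, of c True b] by (simp add: mult_ac)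
  next
    case True
    have "X1\<^sup>2 = pconst (1/2) * (uu + qq)" by (rule X_squares)
    then have "X1 * (pconst c * gen a b m n) = pconst c * (pconst (1/2) * (uu + qq)) * gen False b m n"
      using True by (simp add: power2_eq_square mult_ac)
    also have "\<dots> = pconst (c / 2) * gen False b (Suc m) n + pconst (c / 2) * gen False b m (Suc n)"
      by (simp add: pconst_mult[of c "1/2", simplified] algebra_simps)
    also have "\<dots> \<in> high d" using high_gen by (intro high.intros) simp_all
    finally show ?thesis .
  qed
next
  case (high_add p q)
  then show ?case by (simp add: distrib_left high.high_add)
qed

lemma high_X2: "p \<in> high d \<Longrightarrow> X2 * p \<in> high d"
proof (induction rule: high.induct)
  case (high_gen m n c a b)
  show ?case
  proof (cases b)
    case False
    then show ?thesis using high.high_gen[OF high_gen, of c a True] by (simp add: mult_ac)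
  next
    case True
    have "X2\<^sup>2 = pconst (1/2) * (uu - qq)" by (rule X_squares)
    then have "X2 * (pconst c * gen a b m n) = pconst c * (pconst (1/2) * (uu - qq)) * gen a False m n"
      using True by (simp add: power2_eq_square mult_ac)
    also have "\<dots> = pconst (c / 2) * gen a False (Suc m) n + pconst (- (c / 2)) * gen a False m (Suc n)"
      by (simp add: pconst_mult[of c "1/2", simplified] pconst_minus algebra_simps)
    also have "\<dots> \<in> high d" using high_gen by (intro high.intros) simp_all
    finally show ?thesis .
  qed
next
  case (high_add p q)
  then show ?case by (simp add: distrib_left high.high_add)
qed

lemma high_const: "p \<in> high d \<Longrightarrow> pconst c * p \<in> high d"
proof (induction rule: high.induct)
  case (high_gen m n c' a b)
  then show ?case using high.high_gen[OF high_gen, of "c * c'" a b] by (simp only: pconst_mult mult.assoc)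
next
  case (high_add p q)
  then show ?case by (simp add: distrib_left high.high_add)
qed

lemma high_ideal: "q \<in> high d \<Longrightarrow> p * q \<in> high d"
  by (induction p rule: pol_induct)
    (simp_all add: high_const high_X1 high_X2 high_add distrib_right mult.assoc)

lemma high_0: "p \<in> high 0"
proof -
  have "1 \<in> high 0" using high_gen[of 0 0 0 1 False False] by simp
  from high_ideal[OF this, of p] show ?thesis by simp
qed

lemma zero_high: "0 \<in> high d"
  using high_gen[of d d 0 0] by simp

lemma high_finite_codim: "P.finite_codim (high d)"
proof -
  \<comment> \<open>Every generator with \<open>m + n < d\<close> lies in this finite box of
    exponents.\<close>
  define S where "S = (\<lambda>(a, b, m, n). gen a b m n) ` (UNIV \<times> UNIV \<times> {..<d} \<times> {..<d})"
  have fin: "finite S" by (simp add: S_def)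
  have "\<exists>c. p - (\<Sum>s\<in>S. pconst (c s) * s) \<in> high d" if "p \<in> high 0" for p
    using that
  proof (induction rule: high.induct)
    case (high_gen m n c a b)
    show ?case
    proof (cases "m + n < d")
      case True
      then have in_S: "gen a b m n \<in> S" unfolding S_def by (intro image_eqI[of _ _ "(a, b, m, n)"]) auto
      have "(\<Sum>s\<in>S. pconst (if s = gen a b m n then c else 0) * s) = (\<Sum>s\<in>S. if s = gen a b m n then pconst c * s else 0)"
        by (intro sum.cong refl) simp
      also have "\<dots> = pconst c * gen a b m n" using in_S fin by (subst sum.delta) simp_all
      finally have "pconst c * gen a b m n - (\<Sum>s\<in>S. pconst (if s = gen a b m n then c else 0) * s) \<in> high d"
        using zero_high by simp
      then show ?thesis by (rule exI[of _ "\<lambda>s. if s = gen a b m n then c else 0"])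
    next
      case False
      have "pconst c * gen a b m n - (\<Sum>s\<in>S. pconst 0 * s) \<in> high d"
        using high.high_gen[of d m n c a b] False by simp
      then show ?thesis by (rule exI[of _ "\<lambda>_. 0"])
    qed
  next
    case (high_add p q)
    then obtain c c' where "p - (\<Sum>s\<in>S. pconst (c s) * s) \<in> high d" "q - (\<Sum>s\<in>S. pconst (c' s) * s) \<in> high d"
      by (elim exE)
    then have "(p - (\<Sum>s\<in>S. pconst (c s) * s)) + (q - (\<Sum>s\<in>S. pconst (c' s) * s)) \<in> high d"
      by (rule high.high_add)
    also have "(p - (\<Sum>s\<in>S. pconst (c s) * s)) + (q - (\<Sum>s\<in>S. pconst (c' s) * s))
        = p + q - (\<Sum>s\<in>S. pconst (c s + c' s) * s)"
      by (simp add: pconst_add distrib_right sum.distrib)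
    finally show ?case by (rule exI[of _ "\<lambda>s. c s + c' s"])
  qed
  then show ?thesis unfolding P.finite_codim_def using fin high_0 by (intro exI[of _ S]) simp
qed

text \<open>\<open>Phi\<close> is invariant under \<open>W\<close>, hence kills whatever a
  reflection negates: \<open>s1\<close> handles an extra \<open>X1\<close>, \<open>s2\<close> an
  extra \<open>X2\<close>, and \<open>sm\<close> an odd power of \<open>qq\<close>. Only the
  computed moments remain.\<close>

lemma Phi_gen:
  assumes "\<And>m a. m + 2 * a \<ge> d \<Longrightarrow> Phi (uu ^ m * qq ^ (2 * a)) = 0" "m + n \<ge> d"
  shows "Phi (gen a b m n) = 0"
proof -
  have neg: "Phi p = 0" if "w \<in> W" "wact w p = - p" for p w
    using Phi_wact[OF that(1), of p] that(2) by (simp add: Phi_minus)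
  show ?thesis
  proof (cases a)
    case True
    show ?thesis by (rule neg[of s1]) (auto simp: True)
  next
    case a: False
    show ?thesis
    proof (cases b)
      case True
      show ?thesis by (rule neg[of s2]) (auto simp: True a)
    next
      case b: False
      show ?thesis
      proof (cases "even n")
        case True
        then obtain l where "n = 2 * l" by (elim evenE)
        then show ?thesis using assms a b by simp
      next
        case False
        have qq: "X2\<^sup>2 - X1\<^sup>2 = - qq" by simp
        have "(- qq) ^ n = - (qq ^ n)" using False by (rule power_minus_odd)
        then show ?thesis
          by (intro neg[of sm]) (simp_all add: a b add.commute[of "X2\<^sup>2"] qq del: minus_diff_eq)
      qed
    qed
  qed
qed

lemma high_sub_Phi_kernel:
  assumes "\<And>m a. m + 2 * a \<ge> d \<Longrightarrow> Phi (uu ^ m * qq ^ (2 * a)) = 0"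
  shows "high d \<subseteq> Phi_kernel"
proof
  have zero: "Phi p = 0" if "p \<in> high d" for p
    using that
  proof (induction rule: high.induct)
    case (high_gen m n c a b)
    then show ?case unfolding Phi_const using Phi_gen[OF assms] by simp
  qed (simp add: Phi_add)
  fix q assume "q \<in> high d"
  then show "q \<in> Phi_kernel" unfolding Phi_kernel_def using zero high_ideal by blast
qed

section \<open>From vanishing moments to the numerical condition\<close>

definition finite_quotient :: bool where
  "finite_quotient \<longleftrightarrow> (\<exists>N. P.stable N \<and> N \<noteq> UNIV \<and> P.finite_codim N)"

text \<open>Some power of \<open>uu\<close> lies in the subspace, together with all its multiples by
  powers of \<open>qq\<close>, so one exponent \<open>M\<close> serves every
  \<open>a\<close>.\<close>

lemma finite_quotientD:
  assumes finite_quotient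
  shows "\<exists>M. \<forall>a. Phi (uu ^ M * qq ^ (2 * a)) = 0"
proof -
  obtain N where N: "P.stable N" "N \<noteq> UNIV" "P.finite_codim N"
    using assms unfolding finite_quotient_def by (elim exE conjE)
  obtain M where "uu ^ M * pconst 1 \<in> N"
    using P.finite_codim_quadratic_pow[OF N(1,3) rangeI[of pconst 1]] by blast
  then have "qq ^ (2 * a) * (uu ^ M * pconst 1) \<in> N" for a by (rule P.stableD(3)[OF N(1)])
  then have "Phi (uu ^ M * qq ^ (2 * a)) = 0" for a
    using Phi_proper[OF N(1,2)] by (simp add: mult.commute)
  then show ?thesis by blast
qed

text \<open>The radical itself is the witness: it is proper because \<open>Phi 1 = 1\<close>, and it
  contains an ideal of finite codimension.\<close>

lemma finite_quotientI:
  assumes "\<And>m a. m + 2 * a \<ge> d \<Longrightarrow> Phi (uu ^ m * qq ^ (2 * a)) = 0"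
  shows finite_quotient
  unfolding finite_quotient_def
  using stable_Phi_kernel Phi_kernel_proper
    P.finite_codim_mono[OF high_finite_codim high_sub_Phi_kernel[OF assms]] by blast

theorem finite_quotient_iff:
  "finite_quotient \<longleftrightarrow> (\<exists>n::nat. even n \<and> hbar = - of_nat n) \<or>
        (\<exists>n::nat. odd n \<and> hbar = - of_nat n \<and>
           (\<exists>j\<in>{1..(n + 1) div 2}. k1 = - ((2 * of_nat j - 1) / 2)))"
proof
  assume finite_quotient
  then obtain M where M: "\<And>a. (\<exists>i<M. 2 * of_nat i + 4 * of_nat a + 2 * hbar = 0) \<or>
    (\<exists>i<a. 4 * of_nat i + 2 + 4 * k2 = 0 \<or> 4 * of_nat i + 2 * hbar = 0)"
    using finite_quotientD unfolding Phi_moments_zero by blast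
  \<comment> \<open>For \<open>a = 0\<close> the second alternative is void, so a factor
    \<open>2 * i + 2 * hbar\<close> vanishes.\<close>
  from M[of 0] obtain n :: nat where "2 * of_nat n + 2 * hbar = 0" by auto
  then have n: "hbar = - of_nat n"
    by (metis add.inverse_unique distrib_left mult_eq_0_iff zero_neq_numeral)
  show "(\<exists>n::nat. even n \<and> hbar = - of_nat n) \<or>
        (\<exists>n::nat. odd n \<and> hbar = - of_nat n \<and>
           (\<exists>j\<in>{1..(n + 1) div 2}. k1 = - ((2 * of_nat j - 1) / 2)))"
  proof (cases "even n")
    case True
    then show ?thesis using n by blast
  next
    case False
    then obtain l where l: "n = 2 * l + 1" by (elim oddE)
    \<comment> \<open>For odd \<open>n\<close> the moment with \<open>a = l + 1\<close> is decisive: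
      \<open>2 * a = n + 1\<close> exceeds \<open>n\<close>, which keeps the factors from
      \<open>uu\<close> nonzero, and \<open>4 * i = 2 * n\<close> is impossible by parity. Only the
      factors with \<open>k2\<close> can vanish.\<close>
    have no1: "2 * of_nat i + 4 * of_nat (l + 1) + 2 * hbar \<noteq> 0" for i
    proof
      assume "2 * of_nat i + 4 * of_nat (l + 1) + 2 * hbar = 0"
      then have "of_nat (2 * i + 4 * (l + 1)) = (of_nat (2 * n) :: complex)"
        unfolding n by simp
      then have "2 * i + 4 * (l + 1) = 2 * n" by (rule of_nat_eq_iff[THEN iffD1])
      then show False using l by simp
    qed
    have no2: "4 * of_nat i + 2 * hbar \<noteq> 0" for i
    proof
      assume "4 * of_nat i + 2 * hbar = 0"
      then have "of_nat (4 * i) = (of_nat (2 * n) :: complex)" unfolding n by simp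
      then have "4 * i = 2 * n" by (rule of_nat_eq_iff[THEN iffD1])
      then show False using l by presburger
    qed
    obtain i where i: "i < l + 1" "4 * of_nat i + 2 + 4 * k2 = 0"
      using M[of "l + 1"] no1 no2 by blast
    \<comment> \<open>Here \<open>k1 + k2 = - (l + 1)\<close>, which turns
      \<open>2 * k2 = - (2 * i + 1)\<close> into \<open>2 * k1 = - (2 * j - 1)\<close>.\<close>
    define j where "j = l + 1 - i"
    have j: "j \<in> {1..(n + 1) div 2}" using i(1) l by (auto simp: j_def)
    have il: "of_nat i + of_nat j = (of_nat l + 1 :: complex)"
    proof -
      have "i + j = l + 1" using i(1) by (simp add: j_def)
      then have "of_nat (i + j) = (of_nat (l + 1) :: complex)" by (rule arg_cong)
      then show ?thesis by simp
    qed
    have "2 * (2 * k2 + (2 * of_nat i + 1)) = 0" using i(2) by (simp add: algebra_simps)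
    then have "2 * k2 + (2 * of_nat i + 1) = 0" by (metis mult_eq_0_iff zero_neq_numeral)
    then have k2: "2 * k2 = - (2 * of_nat i + 1)" by (simp only: eq_neg_iff_add_eq_0)
    have k1: "2 * k1 = hbar - 1 - 2 * k2" by (simp add: hbar_def algebra_simps)
    have ie: "of_nat i = (of_nat l + 1 - of_nat j :: complex)" using il by (simp add: eq_diff_eq)
    have k1': "2 * k1 = - (2 * of_nat j - 1)"
      unfolding k1 k2 n l ie by (simp add: algebra_simps)
    have "k1 = (2 * k1) / 2" by simp
    then have "k1 = - ((2 * of_nat j - 1) / 2)" unfolding k1' by (simp only: minus_divide_left)
    then show ?thesis using n False j by blast
  qed
next
  assume R: "(\<exists>n::nat. even n \<and> hbar = - of_nat n) \<or>
        (\<exists>n::nat. odd n \<and> hbar = - of_nat n \<and>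
           (\<exists>j\<in>{1..(n + 1) div 2}. k1 = - ((2 * of_nat j - 1) / 2)))"
  then obtain n :: nat where n: "hbar = - of_nat n" by blast
  show finite_quotient
  \<comment> \<open>A factor from \<open>uu\<close> vanishes at \<open>i + 2 * a = n\<close>, so
    once \<open>m + 2 * a\<close> exceeds \<open>n\<close> this index is available whenever
    \<open>2 * a \<le> n\<close>. For larger \<open>a\<close> the factors from \<open>qq\<close>
    have to vanish.\<close>
  proof (rule finite_quotientI[of "n + 1"])
    fix m a :: nat assume ma: "n + 1 \<le> m + 2 * a"
    show "Phi (uu ^ m * qq ^ (2 * a)) = 0"
      unfolding Phi_moments_zero
    proof (cases "2 * a \<le> n")
      case True
      have "2 * of_nat (n - 2 * a) + 4 * of_nat a + 2 * hbar = 0"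
        using True by (simp add: n of_nat_diff)
      moreover have "n - 2 * a < m" using ma True by simp
      ultimately show "(\<exists>i<m. 2 * of_nat i + 4 * of_nat a + 2 * hbar = 0) \<or>
        (\<exists>i<a. 4 * of_nat i + 2 + 4 * k2 = 0 \<or> 4 * of_nat i + 2 * hbar = 0)" by blast
    next
      case a: False
      have "\<exists>i<a. 4 * of_nat i + 2 + 4 * k2 = 0 \<or> 4 * of_nat i + 2 * hbar = 0"
      proof (cases "even n")
        case True
        then obtain l where l: "n = 2 * l" by (elim evenE)
        have "4 * of_nat l + 2 * hbar = 0" by (simp add: n l)
        moreover have "l < a" using a l by simp
        ultimately show ?thesis by blast
      next
        case False
        then obtain l where l: "n = 2 * l + 1" by (elim oddE)
        obtain n' :: nat and j where n': "hbar = - of_nat n'" "j \<in> {1..(n' + 1) div 2}" "k1 = - ((2 * of_nat j - 1) / 2)"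
          using R False n by auto
        have "n' = n" using n n'(1) by simp
        then have j: "1 \<le> j" "j \<le> l + 1" using n'(2) l by auto
        \<comment> \<open>The inverse of the substitution in the other direction;
          \<open>i < a\<close> holds because \<open>j \<ge> 1\<close> and \<open>2 * a > n\<close>
          forces \<open>a \<ge> l + 1\<close>.\<close>
        define i where "i = l + 1 - j"
        have "i + j = l + 1" using j by (simp add: i_def)
        then have "of_nat (i + j) = (of_nat (l + 1) :: complex)" by (rule arg_cong)
        then have ij: "of_nat i = (of_nat l + 1 - of_nat j :: complex)" by (simp add: eq_diff_eq)
        have k1: "4 * k1 = - (4 * of_nat j - 2)" unfolding n'(3) by (simp add: field_simps)
        have k2: "4 * k2 = 2 * hbar - 2 - 4 * k1" by (simp add: hbar_def algebra_simps)
        have "4 * of_nat i + 2 + 4 * k2 = 0"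
          unfolding k2 k1 n l ij by (simp add: algebra_simps)
        moreover have "i < a" using a l j by (simp add: i_def)
        ultimately show ?thesis by blast
      qed
      then show "(\<exists>i<m. 2 * of_nat i + 4 * of_nat a + 2 * hbar = 0) \<or>
        (\<exists>i<a. 4 * of_nat i + 2 + 4 * k2 = 0 \<or> 4 * of_nat i + 2 * hbar = 0)" by blast
    qed
  qed
qed

end

section \<open>The simple quotients\<close>

context dunkl_rep
begin

declare P.scale_scale [simp del]

section \<open>The Verma module as vector-valued polynomials\<close>

lemma verma_eq: "verma \<rho> k = quot_module tens rel_grp"
  unfolding verma_def induced_module_def rel_grp_def lowest_module_simps ..

lemma std_in: "std F \<in> carrier free_grp"
proof -
  have "Poly_Mapping.keys (std F) \<subseteq> (\<Union>i\<in>UNIV. Poly_Mapping.keys (frag_of ((*) (F $ i), axis i 1 :: complex^'n)))"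
    unfolding std_def by (rule keys_sum)
  also have "\<dots> \<subseteq> H \<times> UNIV" by (auto simp: keys_frag_of mult_in_cherednik)
  finally show ?thesis by simp
qed

lemma std_0: "std 0 \<approx>\<approx> 0"
proof -
  have eq: "(*) 0 = (\<lambda>p. 0 :: pol)" by (rule ext) simp
  have "std 0 \<approx>\<approx> (\<Sum>i\<in>(UNIV :: 'n set). 0)"
    unfolding std_def by (rule cong_sum) (simp add: eq cong_zero(1))
  then show ?thesis by simp
qed

lemma reduces_minus: assumes "reduces x" shows "reduces (- x)"
proof -
  obtain F where F: "x \<approx>\<approx> std F" using assms unfolding reduces_def by (elim exE)
  have "std F + std (- F) \<approx>\<approx> 0"
    using cong_trans[OF cong_sym[OF std_add[of F "- F"]]] std_0 by simp
  then have S: "std F + std (- F) \<in> rel_grp" by (simp add: cong_rel_def)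
  have "- (x - std F) - (std F + std (- F)) \<in> rel_grp"
    by (rule rel_grp_closed(4)[OF rel_grp_closed(3)[OF F[unfolded cong_rel_def]] S])
  then have "- x \<approx>\<approx> std (- F)" by (simp add: cong_rel_def algebra_simps)
  then show ?thesis unfolding reduces_def by (rule exI)
qed

lemma reduces_frag_of: assumes "a \<in> H" shows "reduces (frag_of (a, v))"
proof -
  have eq: "a \<circ> (*) 1 = a" by (rule ext) (simp only: o_apply mult_1_left)
  have "hact a (frag_of ((*) 1, v)) \<approx>\<approx> hact a (std (1 *s vconst v))"
    by (rule hact_cong[OF assms frag_of_std])
  then have "frag_of (a, v) \<approx>\<approx> hact a (std (1 *s vconst v))" unfolding frag_extend_of prod.case eq .
  then show ?thesis by (rule reduces_cong) (rule hact_reduces[OF assms])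
qed

lemma reduces_all: assumes "x \<in> carrier free_grp" shows "reduces x"
proof -
  have "Poly_Mapping.keys x \<subseteq> H \<times> UNIV" using assms by simp
  then show ?thesis
  proof (induction rule: frag_induction)
    case zero
    show ?case by (rule reduces_zero)
  next
    case (one z)
    then show ?case by (cases z) (simp add: reduces_frag_of)
  next
    case (diff a b)
    then show ?case using reduces_add[OF diff(1) reduces_minus[OF diff(2)]] by simp
  qed
qed

definition vproj :: "pol^'n \<Rightarrow> (((pol \<Rightarrow> pol) \<times> (complex^'n)) \<Rightarrow>\<^sub>0 int) set" where
  "vproj F = rel_grp +>\<^bsub>tens\<^esub> std F"

lemma coset_tens: "rel_grp +>\<^bsub>tens\<^esub> x = {y. y \<approx>\<approx> x}"
proof -
  have "y \<in> (\<lambda>h. h + x) ` rel_grp \<longleftrightarrow> y - x \<in> rel_grp" for y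
  proof
    assume "y - x \<in> rel_grp"
    then have "y - x + x \<in> (\<lambda>h. h + x) ` rel_grp" by (rule imageI)
    then show "y \<in> (\<lambda>h. h + x) ` rel_grp" by simp
  qed auto
  then show ?thesis by (auto simp: a_r_coset_def' cong_rel_def)
qed

lemma coset_eq: "rel_grp +>\<^bsub>tens\<^esub> x = rel_grp +>\<^bsub>tens\<^esub> y \<longleftrightarrow> x \<approx>\<approx> y"
proof
  assume "rel_grp +>\<^bsub>tens\<^esub> x = rel_grp +>\<^bsub>tens\<^esub> y"
  moreover have "x \<in> rel_grp +>\<^bsub>tens\<^esub> x" unfolding coset_tens by simp
  ultimately show "x \<approx>\<approx> y" unfolding coset_tens by simp
next
  assume xy: "x \<approx>\<approx> y"
  show "rel_grp +>\<^bsub>tens\<^esub> x = rel_grp +>\<^bsub>tens\<^esub> y"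
    unfolding coset_tens
  proof (rule Collect_cong)
    show "z \<approx>\<approx> x \<longleftrightarrow> z \<approx>\<approx> y" for z
      using cong_trans[OF _ xy, of z] cong_trans[OF _ cong_sym[OF xy], of z] by (rule iffI)
  qed
qed

text \<open>The map of \<open>std_separated\<close> reads off \<open>F\<close> from
  \<open>std F\<close>, which gives injectivity. As \<open>hact r (std F)\<close> is congruent to
  some standard tensor, applying the map identifies that tensor as the one of
  \<open>Theta r F\<close>.\<close>

lemma std_facts:
  shows std_inj: "std F \<approx>\<approx> std G \<longleftrightarrow> F = G"
    and hact_std_cong: "r \<in> H \<Longrightarrow> hact r (std F) \<approx>\<approx> std (Theta r F)"
proof -
  have "\<exists>\<Psi> :: (((pol \<Rightarrow> pol) \<times> (complex^'n)) \<Rightarrow>\<^sub>0 int) \<Rightarrow> pol^'n.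
      (\<forall>x\<in>carrier free_grp. \<forall>y\<in>carrier free_grp. \<Psi> (x + y) = \<Psi> x + \<Psi> y) \<and>
      (\<forall>a\<in>H. \<forall>v. \<Psi> (frag_of (a, v)) = Theta a (vconst v)) \<and> (\<forall>x\<in>rel_grp. \<Psi> x = 0)"
  proof (rule std_separated)
    fix \<Psi> :: "(((pol \<Rightarrow> pol) \<times> (complex^'n)) \<Rightarrow>\<^sub>0 int) \<Rightarrow> pol^'n"
    assume a: "\<And>x y. x \<in> carrier free_grp \<Longrightarrow> y \<in> carrier free_grp \<Longrightarrow> \<Psi> (x + y) = \<Psi> x + \<Psi> y"
      and b: "\<And>a v. a \<in> H \<Longrightarrow> \<Psi> (frag_of (a, v)) = Theta a (vconst v)"
      and c: "\<And>x. x \<in> rel_grp \<Longrightarrow> \<Psi> x = 0"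
    show ?thesis by (intro exI[of _ \<Psi>] conjI ballI allI a b c)
  qed
  then obtain \<Psi> :: "(((pol \<Rightarrow> pol) \<times> (complex^'n)) \<Rightarrow>\<^sub>0 int) \<Rightarrow> pol^'n" where
    add: "\<forall>x\<in>carrier free_grp. \<forall>y\<in>carrier free_grp. \<Psi> (x + y) = \<Psi> x + \<Psi> y" and
    of: "\<forall>a\<in>H. \<forall>v. \<Psi> (frag_of (a, v)) = Theta a (vconst v)" and
    rel: "\<forall>x\<in>rel_grp. \<Psi> x = 0"
    by (elim exE conjE)
  note add = bspec[OF bspec[OF add]] and of = spec[OF bspec[OF of]] and rel = bspec[OF rel]
  have zero: "\<Psi> 0 = 0" using rel[OF rel_grp_closed(1)] .
  have closed: "0 \<in> carrier free_grp" "x \<in> carrier free_grp \<Longrightarrow> y \<in> carrier free_grp \<Longrightarrow> x + y \<in> carrier free_grp" for x y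
    using keys_add[of x y] by auto
  have sum: "sum f A \<in> carrier free_grp \<and> \<Psi> (sum f A) = (\<Sum>i\<in>A. \<Psi> (f i))"
    if "\<And>i. f i \<in> carrier free_grp" for f and A :: "'n set"
    by (induction A rule: infinite_finite_induct) (simp_all only: sum.infinite sum.empty sum.insert zero closed add that simp_thms)
  have cong: "\<Psi> x = \<Psi> y" if "x \<approx>\<approx> y" "y \<in> carrier free_grp" for x y
    using add[of "x - y" y] rel[of "x - y"] rel_grp_closed(5)[of "x - y"] that unfolding cong_rel_def by simp
  have in_free: "a \<in> H \<Longrightarrow> frag_of (a, v) \<in> carrier free_grp" for a and v :: "complex^'n"
    by (simp add: keys_frag_of)
  have basis: "(\<Sum>i\<in>UNIV. F $ i *s vconst (axis i 1)) = F" for F :: "pol^'n"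
  proof -
    have "vconst (axis i 1 :: complex^'n) = axis i 1" for i by (simp add: vec_eq_iff axis_def)
    then show ?thesis using basis_expansion[of F] by (simp only:)
  qed
  have Theta_sum: "Theta r (sum f A) = (\<Sum>i\<in>A. Theta r (f i))" if "r \<in> H" for r f and A :: "'n set"
    by (induction A rule: infinite_finite_induct) (simp_all add: Theta_add[OF that] Theta_0[OF that])
  have hact_in: "hact r (std F) \<in> carrier free_grp" and hact: "\<Psi> (hact r (std F)) = Theta r F" if r: "r \<in> H" for r F
  proof -
    have inH: "r \<circ> (*) (F $ i) \<in> H" for i by (rule in_cherednik(5)[OF r mult_in_cherednik])
    let ?f = "\<lambda>i. frag_of (r \<circ> (*) (F $ i), axis i 1 :: complex^'n)"
    have s: "sum ?f UNIV \<in> carrier free_grp \<and> \<Psi> (sum ?f UNIV) = (\<Sum>i\<in>UNIV. \<Psi> (?f i))"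
      by (rule sum) (rule in_free[OF inH])
    show "hact r (std F) \<in> carrier free_grp" unfolding hact_std by (rule conjunct1[OF s])
    have "\<Psi> (hact r (std F)) = (\<Sum>i\<in>UNIV. Theta (r \<circ> (*) (F $ i)) (vconst (axis i 1)))"
      unfolding hact_std conjunct2[OF s] of[OF inH] ..
    also have "\<dots> = (\<Sum>i\<in>UNIV. Theta r (F $ i *s vconst (axis i 1)))"
      unfolding Theta_ring(2)[OF r mult_in_cherednik] Theta_simps(1) o_apply ..
    also have "\<dots> = Theta r F" unfolding Theta_sum[OF r, symmetric] basis ..
    finally show "\<Psi> (hact r (std F)) = Theta r F" .
  qed
  have std: "\<Psi> (std F) = F" for F
  proof -
    have eq: "hact ((*) 1) (std F) = std F"
    proof -
      have c: "(*) 1 \<circ> (*) (F $ i) = (*) (F $ i)" for i by (rule ext) (simp only: o_apply mult_1_left)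
      show ?thesis unfolding hact_std c unfolding std_def ..
    qed
    show ?thesis using hact[OF mult_in_cherednik, of 1 F] unfolding eq Theta_simps(1) by (simp add: vec_eq_iff)
  qed
  show "std F \<approx>\<approx> std G \<longleftrightarrow> F = G"
    using cong[OF _ std_in, of "std F" G] by (auto simp: std)
  show "hact r (std F) \<approx>\<approx> std (Theta r F)" if r: "r \<in> H"
  proof -
    obtain G where G: "hact r (std F) \<approx>\<approx> std G" using hact_reduces[OF r, of F] unfolding reduces_def by (elim exE)
    have "Theta r F = G" using cong[OF G std_in] unfolding std hact[OF r] .
    then show ?thesis using G by (simp only:)
  qed
qed

lemma verma_presents: "presents (verma \<rho> k) H Theta {0} vproj"
proof -
  have "carrier (verma \<rho> k) = (\<Union>x\<in>carrier free_grp. {rel_grp +>\<^bsub>tens\<^esub> x})"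
    unfolding verma_eq quot_module_def by (simp only: partial_object.select_convs A_RCOSETS_def' tens_simps(1))
  also have "\<dots> = range vproj"
  proof
    show "range vproj \<subseteq> (\<Union>x\<in>carrier free_grp. {rel_grp +>\<^bsub>tens\<^esub> x})"
      by (intro image_subsetI UN_I[OF std_in]) (simp only: vproj_def singleton_iff)
    show "(\<Union>x\<in>carrier free_grp. {rel_grp +>\<^bsub>tens\<^esub> x}) \<subseteq> range vproj"
    proof (rule UN_least)
      fix x assume "x \<in> carrier free_grp"
      then obtain F where "x \<approx>\<approx> std F" using reduces_all unfolding reduces_def by blast
      then have "rel_grp +>\<^bsub>tens\<^esub> x = vproj F" unfolding vproj_def coset_eq .
      then show "{rel_grp +>\<^bsub>tens\<^esub> x} \<subseteq> range vproj" by simp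
    qed
  qed
  finally have carrier: "carrier (verma \<rho> k) = range vproj" .
  have add: "vproj F <+>\<^bsub>tens\<^esub> vproj G = vproj (F + G)" for F G
  proof (rule Set.set_eqI)
    fix z
    have "z \<in> vproj F <+>\<^bsub>tens\<^esub> vproj G \<longleftrightarrow> (\<exists>x y. x \<approx>\<approx> std F \<and> y \<approx>\<approx> std G \<and> z = x + y)"
      unfolding vproj_def coset_tens set_add_def' tens_simps(3) by blast
    also have "\<dots> \<longleftrightarrow> z \<approx>\<approx> std (F + G)"
    proof
      assume "\<exists>x y. x \<approx>\<approx> std F \<and> y \<approx>\<approx> std G \<and> z = x + y"
      then obtain x y where "x \<approx>\<approx> std F" "y \<approx>\<approx> std G" "z = x + y" by (elim exE conjE)
      then show "z \<approx>\<approx> std (F + G)" using cong_trans[OF cong_add cong_sym[OF std_add]] by simp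
    next
      assume "z \<approx>\<approx> std (F + G)"
      then have "z \<approx>\<approx> std F + std G" by (rule cong_trans[OF _ std_add])
      then have "z - std G \<approx>\<approx> std F" by (simp add: cong_rel_def algebra_simps)
      then show "\<exists>x y. x \<approx>\<approx> std F \<and> y \<approx>\<approx> std G \<and> z = x + y"
        by (intro exI[of _ "z - std G"] exI[of _ "std G"]) simp
    qed
    finally show "z \<in> vproj F <+>\<^bsub>tens\<^esub> vproj G \<longleftrightarrow> z \<in> vproj (F + G)"
      unfolding vproj_def coset_tens by simp
  qed
  have zero: "rel_grp = vproj 0"
  proof -
    have "vproj 0 = rel_grp +>\<^bsub>tens\<^esub> 0" unfolding vproj_def coset_eq by (rule std_0)
    then show ?thesis unfolding coset_tens by (simp add: cong_rel_def)
  qed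
  have smult: "(\<Union>x\<in>vproj F. rel_grp +>\<^bsub>tens\<^esub> (r \<odot>\<^bsub>tens\<^esub> x)) = vproj (Theta r F)" if r: "r \<in> H" for r F
  proof -
    have "rel_grp +>\<^bsub>tens\<^esub> (r \<odot>\<^bsub>tens\<^esub> x) = vproj (Theta r F)" if "x \<in> vproj F" for x
    proof -
      have "x \<approx>\<approx> std F" using that unfolding vproj_def coset_tens by simp
      from cong_trans[OF hact_cong[OF r this] hact_std_cong[OF r]]
      show ?thesis unfolding vproj_def tens_simps coset_eq .
    qed
    then have "(\<Union>x\<in>vproj F. rel_grp +>\<^bsub>tens\<^esub> (r \<odot>\<^bsub>tens\<^esub> x)) = (\<Union>x\<in>vproj F. vproj (Theta r F))"
      by (rule SUP_cong[OF refl])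
    moreover have "std F \<in> vproj F" unfolding vproj_def coset_tens by simp
    then have "vproj F \<noteq> {}" by (metis empty_iff)
    ultimately show ?thesis by (simp only: UN_constant if_False)
  qed
  show ?thesis
    unfolding presents_def
  proof (intro conjI allI ballI)
    show "carrier (verma \<rho> k) = range vproj" by (rule carrier)
    show "vproj x = vproj y \<longleftrightarrow> x - y \<in> {0}" for x y
      unfolding vproj_def coset_eq std_inj by simp
    show "vproj x \<oplus>\<^bsub>verma \<rho> k\<^esub> vproj y = vproj (x + y)" for x y
      unfolding add[symmetric] unfolding verma_eq quot_module_def by simp
    show "\<zero>\<^bsub>verma \<rho> k\<^esub> = vproj 0" unfolding zero[symmetric] unfolding verma_eq quot_module_def by simp
    show "r \<odot>\<^bsub>verma \<rho> k\<^esub> vproj x = vproj (Theta r x)" if "r \<in> H" for r x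
      unfolding smult[OF that, symmetric] unfolding verma_eq quot_module_def by (simp only: module.select_convs)
  qed
qed

end

section \<open>Irreducible lowest weight spaces and the simple quotient\<close>

locale irreducible_dunkl_rep = dunkl_rep k k1 k2 \<rho>
  for k k1 k2 and \<rho> :: "complex^2^2 \<Rightarrow> complex^'n^'n" +
  fixes c :: complex
  assumes rep_central: "k1 *s (\<rho> s1 *v v + \<rho> s2 *v v) + k2 *s (\<rho> sp *v v + \<rho> sm *v v) = c *s v"
    and rep_irreducible: "\<And>(v :: complex^'n) U. v \<noteq> 0 \<Longrightarrow> v \<in> U \<Longrightarrow> (\<And>x y. x \<in> U \<Longrightarrow> y \<in> U \<Longrightarrow> x + y \<in> U) \<Longrightarrow>
      (\<And>a x. x \<in> U \<Longrightarrow> a *s x \<in> U) \<Longrightarrow> (\<And>w x. w \<in> W \<Longrightarrow> x \<in> U \<Longrightarrow> \<rho> w *v x \<in> U) \<Longrightarrow> U = UNIV"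
begin

lemma wact_vec_vconst: "wact_vec \<rho> w (vconst v) = vconst (\<rho> w *v v)"
  by (simp add: vec_eq_iff wact_vec_def matrix_vector_mult_def pconst_sum pconst_mult)

sublocale V: graded_cherednik_module "(*s)" k1 k2 "wact_vec \<rho>" "dunkl_vec k \<rho> e1" "dunkl_vec k \<rho> e2"
  "range vconst" c "\<lambda>F. vconst (\<chi> i. pol_const_coeff (F $ i))"
proof
  fix v assume "v \<in> range (vconst :: complex^'n \<Rightarrow> _)"
  then obtain u :: "complex^'n" where v: "v = vconst u" by blast
  show "pconst k1 *s (wact_vec \<rho> s1 v + wact_vec \<rho> s2 v) + pconst k2 *s (wact_vec \<rho> sp v + wact_vec \<rho> sm v) = pconst c *s v"
    unfolding v wact_vec_vconst vconst_add[symmetric] vconst_scale rep_central ..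
next
  fix u v assume "u \<in> range (vconst :: complex^'n \<Rightarrow> _)" "v \<in> range (vconst :: complex^'n \<Rightarrow> _)"
  then show "u + v \<in> range vconst" by (auto simp flip: vconst_add)
next
  fix v and N :: "(pol^'n) set"
  assume v: "v \<in> range vconst" "v \<noteq> 0" "v \<in> N" and add: "\<And>x y. x \<in> N \<Longrightarrow> y \<in> N \<Longrightarrow> x + y \<in> N"
    and sc: "\<And>a x. x \<in> N \<Longrightarrow> pconst a *s x \<in> N" and wa: "\<And>w x. w \<in> W \<Longrightarrow> x \<in> N \<Longrightarrow> wact_vec \<rho> w x \<in> N"
  obtain u where u: "v = vconst u" using v(1) by (elim rangeE)
  have "{u. vconst u \<in> N} = UNIV"
  proof (rule rep_irreducible)
    show "u \<noteq> 0" using v(2) u by auto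
    show "u \<in> {u. vconst u \<in> N}" using v(3) u by simp
  qed (simp_all add: vconst_add add sc wa flip: vconst_scale wact_vec_vconst)
  then show "range vconst \<subseteq> N" by blast
next
  show "\<exists>v\<in>range (vconst :: complex^'n \<Rightarrow> _). v \<noteq> 0"
    by (rule bexI[OF _ rangeI[of vconst "1 :: complex^'n"]]) (simp add: vec_eq_iff)
qed (auto simp: vec_eq_iff pconst_add)

text \<open>This evaluates the \<open>THE\<close> in \<open>L\<close>: submodules with simple
  quotient correspond to maximal proper stable subspaces, and every proper stable subspace lies in
  \<open>V.max_stable\<close>.\<close>

lemma L_presents: "\<exists>\<pi>. presents (L \<rho> k) H Theta V.max_stable \<pi>"
proof -
  let ?M = "V.max_stable" and ?N = "vproj ` V.max_stable"
  have M: "closed_subgroup H Theta ?M" using V.stable_max_stable unfolding stable_iff .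
  have zero: "{0} \<subseteq> N" if "closed_subgroup H Theta N" for N
    using closed_subgroupD(1)[OF that] by simp
  have quot: "presents (quot_module (verma \<rho> k) (vproj ` N)) H Theta N (\<lambda>x. (vproj ` N) +>\<^bsub>verma \<rho> k\<^esub> vproj x)"
    if "closed_subgroup H Theta N" for N
    by (rule presents_quot[OF verma_presents zero[OF that] that Theta_add])
  have le: "N \<subseteq> ?M" if "closed_subgroup H Theta N" "N \<noteq> UNIV" for N
    using that V.max_stable_ge unfolding stable_iff[symmetric] by blast
  have "(THE N. submodule N (cherednik k) (verma \<rho> k) \<and>
      simple_module (cherednik k) (quot_module (verma \<rho> k) N)) = ?N"
  proof (rule the_equality)
    have "simple_module (cherednik k) (quot_module (verma \<rho> k) ?N)"
      unfolding presents_simple[OF quot[OF M] refl closed_subgroupD(1)[OF M]]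
      using V.max_stable_proper le by blast
    then show "submodule ?N (cherednik k) (verma \<rho> k) \<and> simple_module (cherednik k) (quot_module (verma \<rho> k) ?N)"
      using presents_submoduleI[OF verma_presents refl M] by simp
  next
    fix N assume N: "submodule N (cherednik k) (verma \<rho> k) \<and> simple_module (cherednik k) (quot_module (verma \<rho> k) N)"
    obtain N' where N': "closed_subgroup H Theta N'" "N = vproj ` N'"
      using presents_submodule[OF verma_presents refl conjunct1[OF N]] by (elim exE conjE)
    have "N' \<noteq> UNIV \<and> (\<forall>K. N' \<subseteq> K \<and> closed_subgroup H Theta K \<longrightarrow> K = N' \<or> K = UNIV)"
      using conjunct2[OF N] unfolding N'(2) presents_simple[OF quot[OF N'(1)] refl closed_subgroupD(1)[OF N'(1)]] .
    then have "?M = N' \<or> ?M = UNIV" using le[OF N'(1)] M by blast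
    then show "N = ?N" using V.max_stable_proper N'(2) by simp
  qed
  then have "L \<rho> k = quot_module (verma \<rho> k) ?N" unfolding L_def by (simp only:)
  then show ?thesis using quot[OF M] by (intro exI) (simp only:)
qed

theorem finite_dim_L:
  "finite_dim (L \<rho> k) \<longleftrightarrow> (\<exists>N. V.stable N \<and> N \<noteq> UNIV \<and> V.finite_codim N)"
proof -
  obtain \<pi> where "presents (L \<rho> k) H Theta V.max_stable \<pi>" using L_presents by (elim exE)
  then have "finite_dim (L \<rho> k) \<longleftrightarrow> V.finite_codim V.max_stable"
    unfolding V.finite_codim_def
    by (rule presents_finite_dim)
      (simp_all only: in_cherednik Theta_simps V.stable_max_stable[unfolded stable_iff])
  also have "\<dots> \<longleftrightarrow> (\<exists>N. V.stable N \<and> N \<noteq> UNIV \<and> V.finite_codim N)"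
  proof
    assume fc: "V.finite_codim V.max_stable"
    show "\<exists>N. V.stable N \<and> N \<noteq> UNIV \<and> V.finite_codim N"
      by (intro exI[of _ "V.max_stable"] conjI V.stable_max_stable V.max_stable_proper fc)
  next
    assume "\<exists>N. V.stable N \<and> N \<noteq> UNIV \<and> V.finite_codim N"
    then obtain N where N: "V.stable N" "N \<noteq> UNIV" "V.finite_codim N" by (elim exE conjE)
    show "V.finite_codim V.max_stable" by (rule V.finite_codim_mono[OF N(3) V.max_stable_ge[OF N(1,2)]])
  qed
  finally show ?thesis .
qed

end

section \<open>One-dimensional representations\<close>

definition W_character :: "(complex^2^2 \<Rightarrow> complex) \<Rightarrow> bool" where
  "W_character \<tau> \<longleftrightarrow> \<tau> (mat 1) = 1 \<and> (\<forall>u\<in>W. \<forall>w\<in>W. \<tau> (u ** w) = \<tau> u * \<tau> w)"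

text \<open>Reflections in roots of equal length are conjugate, \<open>s2\<close> to
  \<open>s1\<close> by \<open>sm\<close> and \<open>sp\<close> to \<open>sm\<close> by
  \<open>s1\<close>, and the character squares to one on them.\<close>

lemma W_characterD:
  assumes "W_character \<tau>"
  shows "\<tau> (mat 1) = 1" "u \<in> W \<Longrightarrow> w \<in> W \<Longrightarrow> \<tau> (u ** w) = \<tau> u * \<tau> w"
    "\<tau> s2 = \<tau> s1" "\<tau> sp = \<tau> sm"
proof -
  show one: "\<tau> (mat 1) = 1" and mult: "u \<in> W \<Longrightarrow> w \<in> W \<Longrightarrow> \<tau> (u ** w) = \<tau> u * \<tau> w" for u w
    using assms by (auto simp: W_character_def)
  have sq: "\<tau> sm * \<tau> sm = 1" "\<tau> s1 * \<tau> s1 = 1"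
    using mult[of sm sm] mult[of s1 s1] one by simp_all
  have "sm ** s1 ** sm = s2" "s1 ** sm ** s1 = sp"
    by (simp_all add: mat_eq_iff2 matrix_mult_entry refl_entries)
  then have "\<tau> s2 = \<tau> sm * \<tau> s1 * \<tau> sm" "\<tau> sp = \<tau> s1 * \<tau> sm * \<tau> s1"
    using mult[of "sm ** s1" sm] mult[of sm s1] mult[of "s1 ** sm" s1] mult[of s1 sm] by simp_all
  then show "\<tau> s2 = \<tau> s1" "\<tau> sp = \<tau> sm" using sq by (simp_all add: mult_ac)
qed

lemma (in dunkl_multiplicity) twist_multiplicity:
  assumes "W_character \<tau>"
  shows "dunkl_multiplicity (twist \<tau> k) (\<tau> s1 * k1) (\<tau> sm * k2)"
  by unfold_locales (simp_all add: twist_def k_values W_characterD[OF assms])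

lemma (in dunkl_multiplicity) char_irreducible:
  assumes "W_character \<tau>"
  shows "irreducible_dunkl_rep k k1 k2 (char_rep \<tau>) (k1 * (\<tau> s1 + \<tau> s1) + k2 * (\<tau> sm + \<tau> sm))"
proof (intro irreducible_dunkl_rep.intro dunkl_rep.intro dunkl_rep_axioms.intro irreducible_dunkl_rep_axioms.intro)
  show "dunkl_multiplicity k k1 k2" by unfold_locales
  show "char_rep \<tau> (mat 1) = mat 1" by (simp add: char_rep_def W_characterD[OF assms])
  fix u w :: "complex^2^2" assume "u \<in> W" "w \<in> W"
  then show "char_rep \<tau> (u ** w) = char_rep \<tau> u ** char_rep \<tau> w"
    by (intro matrix_eqI) (simp add: char_rep_def W_characterD[OF assms] mat_mult_vec matrix_vector_mul_assoc[symmetric] vec_eq_iff)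
next
  fix v :: "complex^1"
  show "k1 *s (char_rep \<tau> s1 *v v + char_rep \<tau> s2 *v v) + k2 *s (char_rep \<tau> sp *v v + char_rep \<tau> sm *v v)
    = (k1 * (\<tau> s1 + \<tau> s1) + k2 * (\<tau> sm + \<tau> sm)) *s v"
    by (simp add: char_rep_def mat_mult_vec W_characterD[OF assms] vec_eq_iff algebra_simps)
next
  fix v :: "complex^1" and U
  assume v: "v \<noteq> 0" "v \<in> U" and sc: "\<And>a x. x \<in> U \<Longrightarrow> a *s x \<in> U"
  have "v $ 1 \<noteq> 0" using v(1) by (simp add: vec_eq_iff)
  then have "u = (u $ 1 / v $ 1) *s v" for u :: "complex^1" by (simp add: vec_eq_iff)
  then have "u \<in> U" for u using sc[OF v(2)] by metis
  then show "U = UNIV" by blast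
qed

definition to_vec :: "pol \<Rightarrow> pol^1" where "to_vec p = (\<chi> i. p)"

lemma to_vec_simps: "to_vec p $ 1 = p" "to_vec (F $ 1) = F"
  by (simp_all add: to_vec_def vec_eq_iff)

lemma to_vec_hom: "to_vec (p + q) = to_vec p + to_vec q" "to_vec (p * q) = p *s to_vec q" "to_vec 0 = 0"
  "to_vec (p - q) = to_vec p - to_vec q"
  by (simp_all add: to_vec_def vec_eq_iff)

lemma to_vec_sum: "to_vec (sum f A) = (\<Sum>i\<in>A. to_vec (f i))"
  by (induction A rule: infinite_finite_induct) (simp_all add: to_vec_hom)

text \<open>In dimension one, \<open>\<tau>\<close> of a reflection is a scalar and can be absorbed
  into the multiplicity, so the Dunkl operators become those of the twisted multiplicity. The two
  group actions differ by the nonzero scalar \<open>\<tau> w\<close>, so stable subspaces and finite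
  codimension agree.\<close>

lemma (in dunkl_multiplicity) finite_dim_char:
  assumes "W_character \<tau>"
  shows "finite_dim (L (char_rep \<tau>) k) \<longleftrightarrow> dunkl_multiplicity.finite_quotient (twist \<tau> k)"
proof -
  interpret Q: dunkl_multiplicity "twist \<tau> k" "\<tau> s1 * k1" "\<tau> sm * k2" by (rule twist_multiplicity[OF assms])
  interpret R: irreducible_dunkl_rep k k1 k2 "char_rep \<tau>" "k1 * (\<tau> s1 + \<tau> s1) + k2 * (\<tau> sm + \<tau> sm)"
    by (rule char_irreducible[OF assms])
  have U: "(UNIV :: 1 set) = {1}" by (rule UNIV_1)
  have mat1: "(mat c :: complex^1^1) $ i $ j = c" for c i j
  proof -
    have "i = j" by (rule trans[OF num1_eq1 num1_eq1[symmetric]])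
    then show ?thesis by (simp add: mat_def)
  qed
  have wact: "wact_vec (char_rep \<tau>) w (to_vec p) = to_vec (pconst (\<tau> w) * wact w p)" for w p
    by (simp add: vec_eq_iff wact_vec_def to_vec_def char_rep_def mat1 U)
  have dunkl: "dunkl_vec k (char_rep \<tau>) y (to_vec p) = to_vec (dunkl (twist \<tau> k) y p)" for y p
    by (simp add: vec_eq_iff dunkl_vec_def to_vec_def char_rep_def mat1 U dunkl_eq twist_def pconst_mult mult_ac
        cong: sum.cong)
  \<comment> \<open>The transpose of \<open>w\<close> is its inverse, so the product of their values
    is one.\<close>
  have nz: "\<tau> w \<noteq> 0" if "w \<in> W" for w
    using W_characterD(2)[OF assms that transpose_in_W[OF that]] W_characterD(2)[OF assms transpose_in_W[OF that] that]
      W_characterD(1)[OF assms] W_orthogonal[OF that] by auto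
  have stable: "Q.P.stable {p. to_vec p \<in> N} \<longleftrightarrow> R.V.stable N" for N
  proof
    assume N: "R.V.stable N"
    have "wact w p \<in> {p. to_vec p \<in> N}" if "w \<in> W" "to_vec p \<in> N" for w p
    proof -
      have "pconst (1 / \<tau> w) *s wact_vec (char_rep \<tau>) w (to_vec p) \<in> N"
        using that by (intro R.V.stableD[OF N])
      moreover have "pconst (1 / \<tau> w) * (pconst (\<tau> w) * wact w p) = wact w p"
        unfolding mult.assoc[symmetric] pconst_mult[symmetric] using nz[OF that(1)] by simp
      ultimately show ?thesis unfolding wact to_vec_hom(2)[symmetric] by simp
    qed
    then show "Q.P.stable {p. to_vec p \<in> N}"
      using R.V.stableD[OF N] unfolding Q.P.stable_def by (auto simp: to_vec_hom dunkl[symmetric])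
  next
    assume N: "Q.P.stable {p. to_vec p \<in> N}"
    note D = Q.P.stableD[OF N, unfolded mem_Collect_eq]
    have F: "to_vec (F $ 1) \<in> N \<longleftrightarrow> F \<in> N" for F by (simp add: to_vec_simps)
    show "R.V.stable N" unfolding R.V.stable_def
    proof (intro conjI ballI allI)
      show "0 \<in> N" using D(1) by (simp add: to_vec_hom)
      show "x + y \<in> N" if "x \<in> N" "y \<in> N" for x y
        using D(2)[of "x $ 1" "y $ 1"] that by (simp add: to_vec_hom to_vec_simps)
      show "p *s x \<in> N" if "x \<in> N" for p x
        using D(3)[of "x $ 1" p] that by (simp add: to_vec_hom to_vec_simps)
      show "wact_vec (char_rep \<tau>) w x \<in> N" if "w \<in> W" "x \<in> N" for w x
        using D(3)[OF D(4)[of w "x $ 1"], of "pconst (\<tau> w)"] that wact[of w "x $ 1"] by (simp add: to_vec_simps)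
      show "dunkl_vec k (char_rep \<tau>) e1 x \<in> N" "dunkl_vec k (char_rep \<tau>) e2 x \<in> N" if "x \<in> N" for x
        using D(5,6)[of "x $ 1"] that dunkl[of _ "x $ 1"] by (simp_all add: to_vec_simps)
    qed
  qed
  have univ: "{p. to_vec p \<in> N} \<noteq> UNIV \<longleftrightarrow> N \<noteq> UNIV" for N
    using to_vec_simps(2) by (metis UNIV_I UNIV_eq_I mem_Collect_eq)
  have inj: "inj_on to_vec S" for S by (rule inj_onI) (metis to_vec_simps(1))
  have comb: "to_vec p - (\<Sum>s\<in>to_vec ` S. pconst (c s) *s s) = to_vec (p - (\<Sum>s\<in>S. pconst (c (to_vec s)) * s))" for p S c
    by (simp add: sum.reindex[OF inj] to_vec_hom to_vec_sum)
  have codim: "Q.P.finite_codim {p. to_vec p \<in> N} \<longleftrightarrow> R.V.finite_codim N" for N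
  proof
    assume "Q.P.finite_codim {p. to_vec p \<in> N}"
    then obtain S where S: "finite S" "\<forall>p. \<exists>c. to_vec (p - (\<Sum>s\<in>S. pconst (c s) * s)) \<in> N"
      unfolding Q.P.finite_codim_def mem_Collect_eq by (elim exE conjE)
    have "\<exists>c. F - (\<Sum>s\<in>to_vec ` S. pconst (c s) *s s) \<in> N" for F
    proof -
      obtain c where c: "to_vec (F $ 1 - (\<Sum>s\<in>S. pconst (c s) * s)) \<in> N" using spec[OF S(2), of "F $ 1"] by (elim exE)
      have "to_vec (F $ 1) - (\<Sum>s\<in>to_vec ` S. pconst (c (s $ 1)) *s s) \<in> N"
        using c unfolding comb by (simp only: to_vec_simps)
      then show ?thesis unfolding to_vec_simps by (rule exI[of _ "\<lambda>s. c (s $ 1)"])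
    qed
    then show "R.V.finite_codim N" unfolding R.V.finite_codim_def
      by (intro exI[of _ "to_vec ` S"] conjI allI finite_imageI S(1))
  next
    assume "R.V.finite_codim N"
    then obtain S where S: "finite S" "\<forall>F. \<exists>c. F - (\<Sum>s\<in>S. pconst (c s) *s s) \<in> N"
      unfolding R.V.finite_codim_def by (elim exE conjE)
    define S' where "S' = (\<lambda>F. F $ 1) ` S"
    have S': "to_vec ` S' = S" unfolding S'_def image_image to_vec_simps by simp
    have "\<exists>c. to_vec (p - (\<Sum>s\<in>S'. pconst (c s) * s)) \<in> N" for p
    proof -
      obtain c where "to_vec p - (\<Sum>s\<in>S. pconst (c s) *s s) \<in> N" using spec[OF S(2), of "to_vec p"] by (elim exE)
      then show ?thesis unfolding S'[symmetric] comb by (rule exI[of _ "\<lambda>s. c (to_vec s)"])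
    qed
    then show "Q.P.finite_codim {p. to_vec p \<in> N}" unfolding Q.P.finite_codim_def mem_Collect_eq
      by (intro exI[of _ S'] conjI allI) (simp_all only: S'_def finite_imageI S(1))
  qed
  have set: "N = {p. to_vec p \<in> to_vec ` N}" for N
    using inj[of UNIV] by (auto dest: injD)
  show ?thesis
    unfolding R.finite_dim_L Q.finite_quotient_def
  proof
    assume "\<exists>N. R.V.stable N \<and> N \<noteq> UNIV \<and> R.V.finite_codim N"
    then obtain N where "R.V.stable N" "N \<noteq> UNIV" "R.V.finite_codim N" by (elim exE conjE)
    then show "\<exists>N. Q.P.stable N \<and> N \<noteq> UNIV \<and> Q.P.finite_codim N"
      unfolding stable[symmetric] univ[symmetric] codim[symmetric] by (intro exI conjI)
  next
    assume "\<exists>N. Q.P.stable N \<and> N \<noteq> UNIV \<and> Q.P.finite_codim N"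
    then obtain N where "Q.P.stable N" "N \<noteq> UNIV" "Q.P.finite_codim N" by (elim exE conjE)
    then have "R.V.stable (to_vec ` N)" "to_vec ` N \<noteq> UNIV" "R.V.finite_codim (to_vec ` N)"
      using stable[of "to_vec ` N"] univ[of "to_vec ` N"] codim[of "to_vec ` N"] unfolding set[symmetric] by blast+
    then show "\<exists>N. R.V.stable N \<and> N \<noteq> UNIV \<and> R.V.finite_codim N" by (intro exI conjI)
  qed
qed

section \<open>The reflection representation\<close>

lemma dderiv_power_quadratic:
  "dderiv e1 (uu ^ Suc m) = of_nat (2 * Suc m) * (X1 * uu ^ m)" "dderiv e2 (uu ^ Suc m) = of_nat (2 * Suc m) * (X2 * uu ^ m)"
proof -
  have "dderiv e1 uu = 2 * X1" "dderiv e2 uu = 2 * X2"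
    by (simp_all add: dderiv_add dderiv_mult power2_eq_square e_entries algebra_simps)
  then show "dderiv e1 (uu ^ Suc m) = of_nat (2 * Suc m) * (X1 * uu ^ m)" "dderiv e2 (uu ^ Suc m) = of_nat (2 * Suc m) * (X2 * uu ^ m)"
    unfolding dderiv_power_Suc by (simp_all add: algebra_simps)
qed

context graded_cherednik_module
begin

lemma invariant_power: "invariant h \<Longrightarrow> invariant (h ^ m)"
  by (simp add: invariant_def)

text \<open>Each Dunkl operator produces a factor \<open>2 * (m + 1)\<close> and a coordinate. The
  sum of \<open>T1 X1\<close> and \<open>T2 X2\<close> on the remaining vector is the degree
  \<open>2 * m\<close>, plus 2 for the dimension, plus \<open>2 * c\<close> from the
  reflections.\<close>

lemma lap_quadratic_power:
  assumes v: "v \<in> V0"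
  shows "lap (uu ^ Suc m \<star> v) = pconst (2 * of_nat (Suc m) * (2 * of_nat (Suc m) + 2 * c)) \<star> uu ^ m \<star> v"
proof -
  define F where "F = uu ^ m \<star> v"
  define t where "t = pconst (of_nat (2 * Suc m))"
  have wF: "wa w F = uu ^ m \<star> wa w v" if "w \<in> W" for w
    using invariant_power[OF invariant_quadratic, of m] that by (simp add: F_def wa_act invariant_def del: scale_scale wact_power)
  have T: "T1 (uu ^ Suc m \<star> v) = t \<star> X1 \<star> F" "T2 (uu ^ Suc m \<star> v) = t \<star> X2 \<star> F"
    unfolding T_act_invariant[OF invariant_power[OF invariant_quadratic]] T_V0(1)[OF v] T_V0(2)[OF v]
      dderiv_power_quadratic F_def t_def pconst_of_nat scale_zero_right add_0_left by (simp_all add: mult.assoc)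
  have z: "pconst k1 \<star> (wa s1 F + wa s2 F) + pconst k2 \<star> (wa sp F + wa sm F) = pconst c \<star> F"
  proof -
    have "pconst k1 \<star> (wa s1 F + wa s2 F) + pconst k2 \<star> (wa sp F + wa sm F)
      = uu ^ m \<star> (pconst k1 \<star> (wa s1 v + wa s2 v) + pconst k2 \<star> (wa sp v + wa sm v))"
      unfolding wF[OF basic_refl_in_W(1)] wF[OF basic_refl_in_W(2)] wF[OF basic_refl_in_W(3)] wF[OF basic_refl_in_W(4)]
      by (simp add: scale_right_distrib mult.commute)
    then show ?thesis unfolding central_scalar[OF v] F_def by (simp add: mult.commute)
  qed
  have eu: "X1 \<star> T1 F + X2 \<star> T2 F = pconst (2 * of_nat m) \<star> F"
    using euler_quadratic_pow[OF v, of m] unfolding F_def[symmetric] euler_def using z by (simp add: add.assoc)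
  have "T1 (X1 \<star> F) + T2 (X2 \<star> F) = (X1 \<star> T1 F + X2 \<star> T2 F) + (F + F)
      + ((pconst k1 \<star> (wa s1 F + wa s2 F) + pconst k2 \<star> (wa sp F + wa sm F))
       + (pconst k1 \<star> (wa s1 F + wa s2 F) + pconst k2 \<star> (wa sp F + wa sm F)))"
    unfolding T1_X1 T2_X2 double_scale by (simp add: scale_right_distrib add_ac)
  also have "\<dots> = pconst (2 * of_nat (Suc m) + 2 * c) \<star> F"
  proof -
    have "pconst (2 * of_nat (Suc m) + 2 * c) = pconst (2 * of_nat m) + (1 + 1) + (pconst c + pconst c)"
      unfolding pconst_1[symmetric] pconst_add[symmetric] by (simp add: algebra_simps)
    then show ?thesis unfolding eu z by (simp only: scale_left_distrib scale_one)
  qed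
  finally have sum: "T1 (X1 \<star> F) + T2 (X2 \<star> F) = pconst (2 * of_nat (Suc m) + 2 * c) \<star> F" .
  have "lap (uu ^ Suc m \<star> v) = t \<star> (T1 (X1 \<star> F) + T2 (X2 \<star> F))"
    unfolding lap_def T t_def T1_const T2_const scale_right_distrib ..
  then show ?thesis unfolding sum t_def F_def[symmetric] scale_scale pconst_mult[symmetric] by simp
qed

end

text \<open>The central scalar is zero because \<open>s1 + s2\<close> and \<open>sp + sm\<close>
  vanish as matrices.\<close>

lemma (in dunkl_multiplicity) std_irreducible: "irreducible_dunkl_rep k k1 k2 std_rep 0"
proof (intro irreducible_dunkl_rep.intro dunkl_rep.intro dunkl_rep_axioms.intro irreducible_dunkl_rep_axioms.intro)
  show "dunkl_multiplicity k k1 k2" by unfold_locales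
  fix v :: "complex^2"
  show "k1 *s (std_rep s1 *v v + std_rep s2 *v v) + k2 *s (std_rep sp *v v + std_rep sm *v v) = 0 *s v"
    by (simp add: std_rep_def vec_eq_iff forall_2 matrix_vector_mult_def sum_2 refl_entries)
next
  fix v :: "complex^2" and U
  assume v: "v \<noteq> 0" "v \<in> U" and add: "\<And>x y. x \<in> U \<Longrightarrow> y \<in> U \<Longrightarrow> x + y \<in> U"
    and sc: "\<And>a x. x \<in> U \<Longrightarrow> a *s x \<in> U" and rep: "\<And>w x. w \<in> W \<Longrightarrow> x \<in> U \<Longrightarrow> std_rep w *v x \<in> U"
  have swap: "e1 \<in> U \<longleftrightarrow> e2 \<in> U"
  proof -
    have "std_rep sm *v e1 = e2" "std_rep sm *v e2 = e1"
      by (simp_all add: std_rep_def vec_eq_iff forall_2 matrix_vector_mult_def sum_2 refl_entries e_entries)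
    then show ?thesis using rep[of sm e1] rep[of sm e2] by auto
  qed
  have "e1 \<in> U"
  proof (cases "v $ 1 = 0")
    case False
    \<comment> \<open>Averaging with a coordinate reflection projects onto the fixed axis.\<close>
    have "(1 / (2 * v $ 1)) *s (v + std_rep s2 *v v) \<in> U" by (intro sc add rep v) simp
    also have "(1 / (2 * v $ 1)) *s (v + std_rep s2 *v v) = e1"
      using False by (simp add: std_rep_def vec_eq_iff forall_2 matrix_vector_mult_def sum_2 refl_entries e_entries)
    finally show ?thesis .
  next
    case True
    then have "v $ 2 \<noteq> 0" using v(1) by (auto simp: vec_eq_iff forall_2)
    have "(1 / (2 * v $ 2)) *s (v + std_rep s1 *v v) \<in> U" by (intro sc add rep v) simp
    also have "(1 / (2 * v $ 2)) *s (v + std_rep s1 *v v) = e2"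
      using \<open>v $ 2 \<noteq> 0\<close> by (simp add: std_rep_def vec_eq_iff forall_2 matrix_vector_mult_def sum_2 refl_entries e_entries)
    finally show ?thesis using swap by simp
  qed
  then have "u $ 1 *s e1 + u $ 2 *s e2 \<in> U" for u :: "complex^2" using swap by (intro add sc) auto
  moreover have "u $ 1 *s e1 + u $ 2 *s e2 = u" for u :: "complex^2"
    by (simp add: vec_eq_iff forall_2 e_entries)
  ultimately show "U = UNIV" by (metis UNIV_eq_I)
qed (simp_all add: std_rep_def)

text \<open>With \<open>c = 0\<close> the factor in \<open>lap_quadratic_power\<close> is
  \<open>4 * (m + 1)^2\<close>, never zero, so the Laplacian leads from any power of
  \<open>uu\<close> in the subspace down to the constant vector \<open>v\<close>, which no proper
  stable subspace contains.\<close>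

lemma (in dunkl_multiplicity) infinite_dim_std: "\<not> finite_dim (L std_rep k)"
proof
  interpret R: irreducible_dunkl_rep k k1 k2 std_rep 0 by (rule std_irreducible)
  assume "finite_dim (L std_rep k)"
  then obtain N where N: "R.V.stable N" "N \<noteq> UNIV" "R.V.finite_codim N"
    unfolding R.finite_dim_L by (elim exE conjE)
  define v where "v = vconst e1"
  have v: "v \<in> range vconst" unfolding v_def by (rule rangeI)
  have "uu ^ m *s v \<in> N \<Longrightarrow> v \<in> N" for m
  proof (induction m)
    case (Suc m)
    define d :: complex where "d = 2 * of_nat (Suc m) * (2 * of_nat (Suc m) + 2 * 0)"
    have "d \<noteq> 0" unfolding d_def by (simp del: of_nat_Suc)
    have "R.V.lap (uu ^ Suc m *s v) \<in> N" using R.V.stable_lap_pow[OF N(1) Suc.prems, of 1] by simp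
    then have "pconst d *s (uu ^ m *s v) \<in> N"
      unfolding R.V.lap_quadratic_power[OF v] d_def .
    then have "pconst (1 / d) *s (pconst d *s (uu ^ m *s v)) \<in> N" by (rule R.V.stableD(3)[OF N(1)])
    also have "pconst (1 / d) *s (pconst d *s (uu ^ m *s v)) = uu ^ m *s v"
      unfolding vector_smult_assoc[of "pconst (1 / d)" "pconst d"] pconst_mult[symmetric] using \<open>d \<noteq> 0\<close> by simp
    finally show ?case by (rule Suc.IH)
  qed simp
  then have "v \<in> N" using R.V.finite_codim_quadratic_pow[OF N(1,3) v] by blast
  then have "vconst (\<chi> i. pol_const_coeff (v $ i)) = 0" by (rule R.V.proper_c0[OF N(1,2)])
  then show False by (simp add: v_def vec_eq_iff forall_2 axis_def)
qed

section \<open>The theorem\<close>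

lemma W_characters: "W_character triv" "W_character sgn_char" "W_character chi1" "W_character chi2"
proof -
  show triv: "W_character triv" by (simp add: W_character_def triv_def)
  show sgn: "W_character sgn_char" by (simp add: W_character_def sgn_char_def det_mul)
  have "chi1 (mat 1) = 1" by (simp add: chi1_def UNIV_2 sum_2 mat_1_entry)
  then show chi1: "W_character chi1" by (simp add: W_character_def chi1_mult)
  show "W_character chi2" using chi1 sgn by (simp add: W_character_def chi2_def mult_ac)
qed

theorem mainTheorem6:
  fixes k :: "complex^2 \<Rightarrow> complex" and k1 k2 hbar :: complex
  assumes "W_invariant k"
    and "\<And>\<alpha>. \<alpha> \<in> short_roots \<Longrightarrow> k \<alpha> = k1"
    and "\<And>\<alpha>. \<alpha> \<in> long_roots \<Longrightarrow> k \<alpha> = k2"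
    and "hbar = 2 * (k1 + k2) + 1"
  shows
    "(finite_dim (L (char_rep triv) k) \<longleftrightarrow>
        (\<exists>n::nat. even n \<and> hbar = - of_nat n) \<or>
        (\<exists>n::nat. odd n \<and> hbar = - of_nat n \<and>
           (\<exists>j\<in>{1..(n + 1) div 2}. k1 = - ((2 * of_nat j - 1) / 2)))) \<and>
     \<not> finite_dim (L std_rep k) \<and>
     (\<forall>\<tau>\<in>{sgn_char, chi1, chi2}.
        finite_dim (L (char_rep \<tau>) k) \<longleftrightarrow> finite_dim (L (char_rep triv) (twist \<tau> k)))"
proof -
  interpret dunkl_multiplicity k k1 k2
    by unfold_locales (simp_all add: assms(2,3) short_roots_def long_roots_def)
  have h: "hbar = dunkl_multiplicity.hbar k1 k2" unfolding hbar_def by (rule assms(4))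
  have twist_triv: "twist triv f = f" for f by (rule ext) (simp add: twist_def triv_def)
  have "finite_dim (L (char_rep triv) k) \<longleftrightarrow> finite_quotient"
    using finite_dim_char[OF W_characters(1)] unfolding twist_triv .
  \<comment> \<open>Both sides reduce to the same criterion on polynomials, the one for the
    multiplicity \<open>twist \<tau> k\<close>.\<close>
  moreover have "finite_dim (L (char_rep \<tau>) k) \<longleftrightarrow> finite_dim (L (char_rep triv) (twist \<tau> k))"
    if "W_character \<tau>" for \<tau>
    using finite_dim_char[OF that]
      dunkl_multiplicity.finite_dim_char[OF twist_multiplicity[OF that] W_characters(1)] unfolding twist_triv by simp
  ultimately show ?thesis
    unfolding h finite_quotient_iff[symmetric] using infinite_dim_std W_characters by blast
qed

end
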